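(* Let $f$ be a strongly subhyperbolic transcendental entire function. Then the escaping set $I(f)=\{z\in\mathbb{C}: f^n(z)\to\infty\text{ as }n\to\infty\}$ is disconnected.
   Context: For a transcendental entire function $f$: $\mathcal{F}(f)$ and $\mathcal{J}(f)$ are the Fatou and Julia sets, $C(f)$ the set of critical values, $A(f)$ the set of finite asymptotic values, $S(f)=\overline{C(f)\cup A(f)}$ the set of singular values, $P(f)=\overline{\bigcup_{n\ge 0} f^n(S(f))}$ the postsingular set, and $\deg(f,z)$ the local degree at $z$. $f$ is subhyperbolic if $P(f)\cap\mathcal{F}(f)$ is compact and $P(f)\cap\mathcal{J}(f)$ is finite; it is strongly subhyperbolic if moreover $\mathcal{J}(f)\cap A(f)=\emptyset$ and there is $R<\infty$ with $\deg(f,z)<R$ for all $z\in\mathcal{J}(f)$. *)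

theory Defs
  imports "HOL-Complex_Analysis.Complex_Analysis"
begin

definition transcendental_entire :: "(complex \<Rightarrow> complex) \<Rightarrow> bool" where
  "transcendental_entire f \<longleftrightarrow> f holomorphic_on UNIV \<and> \<not> (\<exists>p. \<forall>z. f z = poly p z)"

(* Montel normality on a domain U: subsequential limits may be finite functions or the constant
   infinity.  For holomorphic families on a connected open U this is normality with respect to
   the spherical metric; finite limits are then holomorphic automatically. *)
definition normal_family_on :: "complex set \<Rightarrow> (complex \<Rightarrow> complex) set \<Rightarrow> bool" where
  "normal_family_on U \<F> \<longleftrightarrow>
     (\<forall>g :: nat \<Rightarrow> complex \<Rightarrow> complex. range g \<subseteq> \<F> \<longrightarrow>
       (\<exists>r :: nat \<Rightarrow> nat. strict_mono r \<and>
         ((\<exists>h. \<forall>K. compact K \<and> K \<subseteq> U \<longrightarrow> uniform_limit K (\<lambda>k. g (r k)) h sequentially) \<or>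
          (\<forall>K. compact K \<and> K \<subseteq> U \<longrightarrow>
             (\<forall>M :: real. \<forall>\<^sub>F k in sequentially. \<forall>z\<in>K. M < norm (g (r k) z))))))"

definition fatou_set :: "(complex \<Rightarrow> complex) \<Rightarrow> complex set" where
  "fatou_set f =
     {z. \<exists>U. open U \<and> connected U \<and> z \<in> U \<and> normal_family_on U (range (\<lambda>n. f ^^ n))}"

definition julia_set :: "(complex \<Rightarrow> complex) \<Rightarrow> complex set" where
  "julia_set f = - fatou_set f"

definition critical_values :: "(complex \<Rightarrow> complex) \<Rightarrow> complex set" where
  "critical_values f = f ` {c. deriv f c = 0}"

definition asymptotic_values :: "(complex \<Rightarrow> complex) \<Rightarrow> complex set" where
  "asymptotic_values f =
     {a. \<exists>\<gamma> :: real \<Rightarrow> complex. continuous_on {0..} \<gamma> \<and> filterlim \<gamma> at_infinity at_top \<and>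
           ((\<lambda>t. f (\<gamma> t)) \<longlongrightarrow> a) at_top}"

definition singular_values :: "(complex \<Rightarrow> complex) \<Rightarrow> complex set" where
  "singular_values f = closure (critical_values f \<union> asymptotic_values f)"

definition postsingular_set :: "(complex \<Rightarrow> complex) \<Rightarrow> complex set" where
  "postsingular_set f = closure (\<Union>n. (f ^^ n) ` singular_values f)"

(* The local degree is the order of the zero of f - f z at z; it is meaningful only for f
   holomorphic and nonconstant near z. *)
definition local_degree :: "(complex \<Rightarrow> complex) \<Rightarrow> complex \<Rightarrow> int" where
  "local_degree f z = zorder (\<lambda>w. f w - f z) z"

definition subhyperbolic :: "(complex \<Rightarrow> complex) \<Rightarrow> bool" where
  "subhyperbolic f \<longleftrightarrow>
     compact (postsingular_set f \<inter> fatou_set f) \<and> finite (postsingular_set f \<inter> julia_set f)"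

definition strongly_subhyperbolic :: "(complex \<Rightarrow> complex) \<Rightarrow> bool" where
  "strongly_subhyperbolic f \<longleftrightarrow>
     subhyperbolic f \<and> julia_set f \<inter> asymptotic_values f = {} \<and>
     (\<exists>R. \<forall>z\<in>julia_set f. local_degree f z < R)"

definition escaping_set :: "(complex \<Rightarrow> complex) \<Rightarrow> complex set" where
  "escaping_set f = {z. filterlim (\<lambda>n. (f ^^ n) z) at_infinity sequentially}"

end

(* Let P be the postsingular set, contained in a disc D = {|z| <= R}.  Off P all inverse branches of f
   and its iterates continue along curves, so the radial retraction of the plane onto D lifts under
   f^n to a retraction r_n of the plane onto {|f^n z| <= R}.  Put g_n = r_n o ... o r_1; then
   f o g_(n+1) = g_n o r_0 o f.

   The analytic point is a uniform bound for all g_n on D.  It follows once inverse branches of f^n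
   contract exponentially for a metric that is only |dz| / (|z| ln |z|) near infinity.  Such a metric
   is obtained by giving the finitely many points of P in the Julia set cone singularities; finiteness
   of the orders uses the bound on the local degree and the absence of asymptotic values in J(f).
   Inverse branches of f^n on charts of this orbifold form a normal family by Schottky's theorem
   (every large round annulus contains preimages of two points of P), and their limits are constant.

   Hence the sets T_N, the closure of the union of g_n(C) for n >= N, are connected and unbounded,
   contain P, and |f^k| <= M on T_N for 1 <= k <= N.  Every escaping point
   therefore avoids some T_N, and the components of the complement of T_N are simply connected.  If
   I(f) were connected, an increasing sequence of such components would cover it; all inverse branches
   of f are defined there with disjoint images, and these images separate f^-1(I(f)) = I(f). *)
theory Submission
  imports Defs
begin

section \<open>Inverse branches off the singular values\<close>

text \<open>The set where |f^n z| <= R gives no control over the intermediate iterates. Composing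
  the retractions in the order r_n o ... o r_1 does: it puts f^k of the image, for each k from 1 to
  n, into g_(n-k)(D). Applying r_(n+1) to a point of g_n(D) moves it along a lift of a radial
  segment of bounded length. Measured by |dz| / (|z| ln |z|) the lift has length of order theta^n,
  and in this metric length bounds the change of ln ln |z|; a convergent sum of such changes cannot
  lead to infinity. The obstacle is that P may contain points of J(f), over which f has no inverse
  branches. Discs branched over these points take their place. All orders are doubled: a lift that
  meets f^-1(P) then does so in a single point and with even multiplicity, so that a square root of
  it omits enough values for Schottky's theorem. Near infinity no compactness is available; there
  the logarithm in the metric makes the contraction factor itself small.\<close>

lemma deriv_0_critical:
  assumes "deriv f z = 0" shows "f z \<in> singular_values f"
  using assms closure_subset[of "critical_values f \<union> asymptotic_values f"]
  unfolding singular_values_def critical_values_def by blast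

lemma local_inverse:
  assumes holf: "f holomorphic_on UNIV" and d: "deriv f y \<noteq> 0" and "0 < e"
  obtains \<delta> \<epsilon> g where "0 < \<delta>" "\<delta> \<le> e" "0 < \<epsilon>" "inj_on f (ball y \<delta>)" "g holomorphic_on ball (f y) \<epsilon>"
    "\<And>x. x \<in> ball (f y) \<epsilon> \<Longrightarrow> f (g x) = x \<and> g x \<in> ball y \<delta>"
    "\<And>z. z \<in> ball y \<delta> \<Longrightarrow> f z \<in> ball (f y) \<epsilon> \<Longrightarrow> g (f z) = z"
proof -
  obtain r where r: "r > 0" "inj_on f (ball y r)"
    using has_complex_derivative_locally_injective[OF holf UNIV_I open_UNIV d] by metis
  define \<delta> where "\<delta> = min r e"
  have \<delta>: "0 < \<delta>" "\<delta> \<le> e" "inj_on f (ball y \<delta>)"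
    using r(1) \<open>0 < e\<close> inj_on_subset[OF r(2), of "ball y \<delta>"] subset_ball[of \<delta> r y] unfolding \<delta>_def by simp_all
  have hol': "f holomorphic_on ball y \<delta>" using holf holomorphic_on_subset by blast
  obtain g where g: "g holomorphic_on f ` ball y \<delta>" "\<And>z. z \<in> ball y \<delta> \<Longrightarrow> g (f z) = z"
    using holomorphic_has_inverse[OF hol' open_ball \<delta>(3)] by metis
  have "open (f ` ball y \<delta>)" by (rule open_mapping_thm3[OF hol' open_ball \<delta>(3)])
  moreover have "f y \<in> f ` ball y \<delta>" using \<delta> by auto
  ultimately obtain \<epsilon> where \<epsilon>: "\<epsilon> > 0" "ball (f y) \<epsilon> \<subseteq> f ` ball y \<delta>"
    using open_contains_ball by blast
  show thesis
  proof (rule that[OF \<delta>(1,2) \<epsilon>(1) \<delta>(3)])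
    show "g holomorphic_on ball (f y) \<epsilon>" using g(1) \<epsilon>(2) holomorphic_on_subset by blast
    show "f (g x) = x \<and> g x \<in> ball y \<delta>" if x: "x \<in> ball (f y) \<epsilon>" for x
    proof -
      obtain z where "z \<in> ball y \<delta>" "x = f z" using x \<epsilon>(2) by (meson imageE subsetD)
      then show ?thesis using g(2) by auto
    qed
  qed (use g(2) in auto)
qed

text \<open>The coincidence set is closed by continuity, and open because f is injective near a
  point with non-zero derivative. The domain type is arbitrary since both real intervals and plane
  domains occur.\<close>

lemma lift_unique:
  fixes g h :: "'a::topological_space \<Rightarrow> complex"
  assumes holf: "f holomorphic_on UNIV" and U: "connected U"
    and g: "continuous_on U g" and h: "continuous_on U h"
    and eq: "\<And>x. x \<in> U \<Longrightarrow> f (g x) = f (h x)"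
    and d: "\<And>x. x \<in> U \<Longrightarrow> deriv f (g x) \<noteq> 0"
    and x0: "x0 \<in> U" "g x0 = h x0" and "x \<in> U"
  shows "g x = h x"
proof -
  define E where "E = {x \<in> U. g x = h x}"
  have "closedin (top_of_set U) E"
  proof -
    have "E = U \<inter> (\<lambda>x. g x - h x) -` {0}" unfolding E_def by auto
    moreover have "closedin (top_of_set U) (U \<inter> (\<lambda>x. g x - h x) -` {0})"
      by (intro continuous_closedin_preimage continuous_on_diff g h) auto
    ultimately show ?thesis by simp
  qed
  moreover have "openin (top_of_set U) E"
  proof (subst openin_subopen, intro ballI)
    fix x assume "x \<in> E"
    then have x: "x \<in> U" "g x = h x" unfolding E_def by auto
    obtain r where r: "r > 0" "inj_on f (ball (g x) r)"
      using has_complex_derivative_locally_injective[OF holf UNIV_I open_UNIV d[OF x(1)]] by metis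
    define T where "T = (U \<inter> g -` ball (g x) r) \<inter> (U \<inter> h -` ball (g x) r)"
    have "openin (top_of_set U) T" unfolding T_def
      by (intro openin_Int continuous_openin_preimage_gen g h) auto
    moreover have "x \<in> T" using x r unfolding T_def by auto
    moreover have "T \<subseteq> E"
      unfolding T_def E_def using eq r(2) by (auto dest: inj_onD)
    ultimately show "\<exists>T. openin (top_of_set U) T \<and> x \<in> T \<and> T \<subseteq> E" by blast
  qed
  moreover have "E \<noteq> {}" using x0 unfolding E_def by auto
  ultimately have "E = U" using U unfolding connected_clopen by blast
  then show ?thesis using \<open>x \<in> U\<close> unfolding E_def by auto
qed

lemma lift_holomorphic:
  assumes holf: "f holomorphic_on UNIV" and U: "open U" and g: "continuous_on U g"
    and h: "h holomorphic_on U" and eq: "\<And>x. x \<in> U \<Longrightarrow> f (g x) = h x"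
    and d: "\<And>x. x \<in> U \<Longrightarrow> deriv f (g x) \<noteq> 0"
  shows "g holomorphic_on U"
proof (subst holomorphic_on_open[OF U], intro ballI)
  fix x assume x: "x \<in> U"
  obtain \<delta> \<epsilon> k where k: "0 < \<delta>" "0 < \<epsilon>" "k holomorphic_on ball (f (g x)) \<epsilon>"
    "\<And>z. z \<in> ball (g x) \<delta> \<Longrightarrow> f z \<in> ball (f (g x)) \<epsilon> \<Longrightarrow> k (f z) = z"
    using local_inverse[OF holf d[OF x], of 1] by (metis zero_less_one)
  define T where "T = (U \<inter> g -` ball (g x) \<delta>) \<inter> (U \<inter> h -` ball (h x) \<epsilon>)"
  have hc: "continuous_on U h" using h holomorphic_on_imp_continuous_on by blast
  have "open T" unfolding T_def
    by (intro open_Int continuous_open_preimage g hc U) auto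
  have xT: "x \<in> T" using x k unfolding T_def by auto
  have T: "T \<subseteq> U" unfolding T_def by auto
  have eqT: "g y = (k \<circ> h) y" if "y \<in> T" for y
  proof -
    have "y \<in> U" "g y \<in> ball (g x) \<delta>" "h y \<in> ball (h x) \<epsilon>" using that unfolding T_def by auto
    then show ?thesis using k(4)[of "g y"] eq[of y] eq[OF x] by simp
  qed
  have sub: "h ` T \<subseteq> ball (f (g x)) \<epsilon>"
    unfolding eq[OF x] T_def by auto
  have "(k \<circ> h) holomorphic_on T"
    by (rule holomorphic_on_compose_gen[OF holomorphic_on_subset[OF h T] k(3) sub])
  then have "g holomorphic_on T" by (rule holomorphic_transform) (simp add: eqT)
  then show "\<exists>f'. (g has_field_derivative f') (at x)"
    using holomorphic_on_open[OF \<open>open T\<close>] xT by blast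
qed

text \<open>If the curve ran off to infinity, x would be an asymptotic value. So it returns to some
  fixed disc at arbitrarily late times, and an accumulation point there lies over x by continuity.
  Every use of asymptotic values passes through this lemma.\<close>

lemma curve_accumulates:
  fixes f :: "complex \<Rightarrow> complex" and \<gamma> :: "real \<Rightarrow> complex"
  assumes contf: "continuous_on UNIV f"
    and g: "continuous_on {0..} \<gamma>" "((\<lambda>t. f (\<gamma> t)) \<longlongrightarrow> x) at_top" and x: "x \<notin> asymptotic_values f"
  obtains y where "f y = x" "\<And>\<epsilon> t0. 0 < \<epsilon> \<Longrightarrow> \<exists>t\<ge>t0. dist (\<gamma> t) y < \<epsilon>"
proof -
  have "\<not> filterlim \<gamma> at_infinity at_top"
  proof
    assume "filterlim \<gamma> at_infinity at_top"
    then have "continuous_on {0..} \<gamma> \<and> filterlim \<gamma> at_infinity at_top \<and> ((\<lambda>t. f (\<gamma> t)) \<longlongrightarrow> x) at_top"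
      using g by (intro conjI)
    then have "x \<in> asymptotic_values f" unfolding asymptotic_values_def mem_Collect_eq by (rule exI[of _ \<gamma>])
    then show False using x by simp
  qed
  then have "\<not> (\<forall>B>0. \<forall>\<^sub>F t in at_top. B \<le> norm (\<gamma> t))"
    unfolding filterlim_at_infinity[OF order_refl] .
  then obtain B where "\<not> (\<forall>\<^sub>F t in at_top. B \<le> norm (\<gamma> t))" by fast
  then have fr: "\<exists>t\<ge>n. norm (\<gamma> t) < B" for n :: real
    unfolding eventually_at_top_linorder by (meson not_le)
  define T where "T n = (SOME t. t \<ge> real n \<and> norm (\<gamma> t) < B)" for n :: nat
  have T: "T n \<ge> real n \<and> norm (\<gamma> (T n)) < B" for n
    unfolding T_def by (rule someI_ex) (use fr in blast)
  have "range (\<gamma> \<circ> T) \<subseteq> cball 0 B" using less_imp_le[OF conjunct2[OF T]] by auto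
  then obtain y r where y: "strict_mono r" "(\<gamma> \<circ> T \<circ> r) \<longlonglongrightarrow> y"
    using compact_cball[of 0 B] unfolding compact_def by (metis rangeI subsetD image_subset_iff)
  have Tr: "filterlim (T \<circ> r) at_top sequentially"
  proof -
    have "filterlim T at_top sequentially"
      by (rule filterlim_at_top_mono[OF filterlim_real_sequentially]) (use T in auto)
    then show ?thesis using y(1) filterlim_compose filterlim_subseq unfolding o_def by blast
  qed
  have "((\<lambda>n. f ((\<gamma> \<circ> T \<circ> r) n)) \<longlonglongrightarrow> f y)"
    by (rule continuous_on_tendsto_compose[OF contf y(2)]) auto
  moreover have "((\<lambda>n. f ((\<gamma> \<circ> T \<circ> r) n)) \<longlonglongrightarrow> x)"
    using filterlim_compose[OF g(2) Tr] by (simp add: o_def)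
  ultimately have fy: "f y = x" using LIMSEQ_unique by blast
  have "\<exists>t\<ge>t0. dist (\<gamma> t) y < \<epsilon>" if "0 < \<epsilon>" for \<epsilon> t0
  proof -
    have "\<forall>\<^sub>F n in sequentially. dist ((\<gamma> \<circ> T \<circ> r) n) y < \<epsilon>" using y(2) that tendstoD by blast
    moreover have "\<forall>\<^sub>F n in sequentially. t0 \<le> (T \<circ> r) n" using Tr unfolding filterlim_at_top by blast
    ultimately have "\<forall>\<^sub>F n in sequentially. t0 \<le> (T \<circ> r) n \<and> dist (\<gamma> ((T \<circ> r) n)) y < \<epsilon>"
      by eventually_elim auto
    then show ?thesis unfolding eventually_sequentially by blast
  qed
  then show thesis using that fy by blast
qed

text \<open>The image under g of the radius ending at w1 accumulates at a preimage y of w1, and the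
  local inverse at y catches this curve at a late time. So it agrees with g at one point, hence by
  \<open>lift_unique\<close> on the convex intersection of the two discs.\<close>

lemma branch_boundary_extension:
  assumes holf: "f holomorphic_on UNIV" and "0 < \<rho>"
    and g: "g holomorphic_on ball w \<rho>" "\<And>x. x \<in> ball w \<rho> \<Longrightarrow> f (g x) = x"
    and dis: "ball w \<rho> \<inter> singular_values f = {}"
    and w1: "w1 \<in> sphere w \<rho>" "w1 \<notin> singular_values f"
  obtains \<epsilon> k where "0 < \<epsilon>" "k holomorphic_on ball w1 \<epsilon>" "\<And>x. x \<in> ball w1 \<epsilon> \<Longrightarrow> f (k x) = x"
    "\<And>x. x \<in> ball w1 \<epsilon> \<inter> ball w \<rho> \<Longrightarrow> k x = g x"
proof -
  \<comment> \<open>The factor t / (1 + t) spreads the radius over the half-line, the form in which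
    \<open>curve_accumulates\<close> takes its curves.\<close>
  define s where "s t = w + of_real (t / (1 + t)) * (w1 - w)" for t :: real
  define \<gamma> where "\<gamma> t = g (s t)" for t
  have nw: "norm (w1 - w) = \<rho>" using w1(1) by (simp add: dist_norm norm_minus_commute)
  have s_in: "s t \<in> ball w \<rho>" if "t \<ge> 0" for t
  proof -
    have "dist w (s t) = \<bar>t / (1 + t)\<bar> * \<rho>"
      unfolding s_def dist_norm using nw by (simp add: norm_mult del: of_real_divide)
    also have "\<dots> < \<rho>" using that \<open>0 < \<rho>\<close> by (simp add: field_simps)
    finally show ?thesis by simp
  qed
  have s_lim: "(s \<longlongrightarrow> w1) at_top"
  proof -
    have "((\<lambda>t::real. t / (1 + t)) \<longlongrightarrow> 1) at_top" by real_asymp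
    then have "((\<lambda>t. w + of_real (t / (1 + t)) * (w1 - w)) \<longlongrightarrow> w + of_real 1 * (w1 - w)) at_top"
      by (intro tendsto_intros)
    then show ?thesis unfolding s_def by simp
  qed
  have s_cont: "continuous_on {0..} s" unfolding s_def
    by (intro continuous_intros) auto
  have \<gamma>_cont: "continuous_on {0..} \<gamma>"
    unfolding \<gamma>_def
    by (rule continuous_on_compose2[OF holomorphic_on_imp_continuous_on[OF g(1)] s_cont])
       (use s_in in \<open>force simp del: mem_ball\<close>)
  have f\<gamma>: "f (\<gamma> t) = s t" if "t \<ge> 0" for t using g(2) s_in that unfolding \<gamma>_def by auto
  have "((\<lambda>t. f (\<gamma> t)) \<longlongrightarrow> w1) at_top"
    by (rule Lim_transform_eventually[OF s_lim])
       (use f\<gamma> in \<open>auto intro!: eventually_mono[OF eventually_ge_at_top[of 0]]\<close>)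
  moreover have "w1 \<notin> asymptotic_values f"
    using w1(2) closure_subset[of "critical_values f \<union> asymptotic_values f"] unfolding singular_values_def by blast
  ultimately obtain y where fy: "f y = w1" and acc: "\<And>\<epsilon> t0. 0 < \<epsilon> \<Longrightarrow> \<exists>t\<ge>t0. dist (\<gamma> t) y < \<epsilon>"
    using curve_accumulates[OF holomorphic_on_imp_continuous_on[OF holf] \<gamma>_cont] by blast
  have dy: "deriv f y \<noteq> 0" using deriv_0_critical w1(2) fy by blast
  obtain \<delta> \<epsilon> k where k: "0 < \<delta>" "0 < \<epsilon>" "inj_on f (ball y \<delta>)" "k holomorphic_on ball w1 \<epsilon>"
    "\<And>x. x \<in> ball w1 \<epsilon> \<Longrightarrow> f (k x) = x \<and> k x \<in> ball y \<delta>"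
    "\<And>z. z \<in> ball y \<delta> \<Longrightarrow> f z \<in> ball w1 \<epsilon> \<Longrightarrow> k (f z) = z"
    using local_inverse[OF holf dy, of 1] unfolding fy by (metis zero_less_one)
  have "\<forall>\<^sub>F t in at_top. s t \<in> ball w1 \<epsilon>"
    by (rule topological_tendstoD[OF s_lim open_ball]) (use k(2) in simp)
  then obtain t0 where t0: "\<And>t. t0 \<le> t \<Longrightarrow> s t \<in> ball w1 \<epsilon>" unfolding eventually_at_top_linorder by blast
  obtain t where t: "max 0 t0 \<le> t" "dist (\<gamma> t) y < \<delta>" using acc[OF k(1)] by blast
  have st: "s t \<in> ball w1 \<epsilon> \<inter> ball w \<rho>" "k (s t) = g (s t)"
    using t t0[of t] k(6)[of "\<gamma> t"] s_in[of t] f\<gamma>[of t] unfolding \<gamma>_def by (auto simp: dist_commute)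
  show thesis
  proof (rule that[OF k(2) k(4)])
    show "f (k x) = x" if "x \<in> ball w1 \<epsilon>" for x using k(5) that by blast
    show "k x = g x" if "x \<in> ball w1 \<epsilon> \<inter> ball w \<rho>" for x
    proof (rule lift_unique[where f=f and U="ball w1 \<epsilon> \<inter> ball w \<rho>" and ?x0.0="s t" and g=k and h=g and x=x, OF holf])
      show "s t \<in> ball w1 \<epsilon> \<inter> ball w \<rho>" "k (s t) = g (s t)" "x \<in> ball w1 \<epsilon> \<inter> ball w \<rho>"
        using st that by auto
      show "connected (ball w1 \<epsilon> \<inter> ball w \<rho>)" by (intro convex_connected convex_Int convex_ball)
      show "continuous_on (ball w1 \<epsilon> \<inter> ball w \<rho>) k"
        using k(4) holomorphic_on_imp_continuous_on continuous_on_subset by blast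
      show "continuous_on (ball w1 \<epsilon> \<inter> ball w \<rho>) g"
        using g(1) holomorphic_on_imp_continuous_on continuous_on_subset by blast
      show "f (k x) = f (g x)" if "x \<in> ball w1 \<epsilon> \<inter> ball w \<rho>" for x
        using k(5) g(2) that by simp
      show "deriv f (k x) \<noteq> 0" if "x \<in> ball w1 \<epsilon> \<inter> ball w \<rho>" for x
      proof
        assume "deriv f (k x) = 0"
        then have "f (k x) \<in> singular_values f" by (rule deriv_0_critical)
        then show False using k(5)[of x] that dis by auto
      qed
    qed
  qed
qed

text \<open>Monodromy on a disc by a supremum: were the largest radius \<open>\<sigma>\<close>
  admitting a branch smaller than r, the local extensions at the points of the sphere would glue, by
  compactness, to a branch on a larger disc.\<close>

lemma inverse_branch_ball:
  assumes holf: "f holomorphic_on UNIV" and dis: "ball w r \<inter> singular_values f = {}"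
    and "0 < r" and z: "f z = w"
  obtains g where "g holomorphic_on ball w r" "g w = z" "\<And>x. x \<in> ball w r \<Longrightarrow> f (g x) = x"
proof -
  define br where "br \<rho> g \<longleftrightarrow> g holomorphic_on ball w \<rho> \<and> g w = z \<and> (\<forall>x\<in>ball w \<rho>. f (g x) = x)" for \<rho> g
  define A where "A = {\<rho>. 0 < \<rho> \<and> \<rho> \<le> r \<and> (\<exists>g. br \<rho> g)}"
  have mono: "br \<rho>' g" if "br \<rho> g" "\<rho>' \<le> \<rho>" for \<rho> \<rho>' g
    using that holomorphic_on_subset[of g "ball w \<rho>" "ball w \<rho>'"] unfolding br_def by auto
  have uniq: "g x = h x" if "br \<rho> g" "br \<rho> h" "0 < \<rho>" "\<rho> \<le> r" "x \<in> ball w \<rho>" for \<rho> g h x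
  proof (rule lift_unique[OF holf connected_ball[of w \<rho>], of g h w])
    show "deriv f (g x) \<noteq> 0" if "x \<in> ball w \<rho>" for x
    proof
      assume "deriv f (g x) = 0"
      then have "f (g x) \<in> singular_values f" by (rule deriv_0_critical)
      moreover have "f (g x) = x" using that \<open>br \<rho> g\<close> unfolding br_def by blast
      moreover have "x \<in> ball w r" using \<open>x \<in> ball w \<rho>\<close> \<open>\<rho> \<le> r\<close> subset_ball by blast
      ultimately show False using dis by auto
    qed
  qed (use that in \<open>auto simp: br_def holomorphic_on_imp_continuous_on\<close>)
  have dz: "deriv f z \<noteq> 0" using deriv_0_critical[of f z] dis \<open>0 < r\<close> z by force
  obtain \<epsilon> g where g: "\<epsilon> > 0" "g holomorphic_on ball w \<epsilon>" "\<And>x. x \<in> ball w \<epsilon> \<Longrightarrow> f (g x) = x" "g w = z"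
    using local_inverse[OF holf dz, of 1] unfolding z by (metis centre_in_ball zero_less_one z)
  have "min \<epsilon> r \<in> A" unfolding A_def using mono[of \<epsilon> g "min \<epsilon> r"] g \<open>0 < r\<close>
    by (metis (mono_tags, lifting) CollectI br_def min.cobounded1 min.cobounded2 min_less_iff_conj)
  define \<sigma> where "\<sigma> = Sup A"
  have bdd: "bdd_above A" unfolding A_def by (rule bdd_aboveI[of _ r]) auto
  have \<sigma>: "0 < \<sigma>" "\<sigma> \<le> r"
  proof -
    show "0 < \<sigma>" using cSup_upper[OF \<open>min \<epsilon> r \<in> A\<close> bdd] g(1) \<open>0 < r\<close> unfolding \<sigma>_def by linarith
    show "\<sigma> \<le> r" unfolding \<sigma>_def by (rule cSup_least) (use \<open>min \<epsilon> r \<in> A\<close> A_def in auto)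
  qed
  have "\<exists>g. br \<rho> g" if lt: "\<rho> < \<sigma>" "0 < \<rho>" for \<rho>
  proof -
    obtain a where "a \<in> A" "\<rho> < a" using lt(1) less_cSup_iff[of A \<rho>] bdd \<open>min \<epsilon> r \<in> A\<close> unfolding \<sigma>_def by blast
    then show ?thesis using mono[of a _ \<rho>] unfolding A_def by auto
  qed
  then obtain G where G: "\<And>\<rho>. \<rho> < \<sigma> \<Longrightarrow> 0 < \<rho> \<Longrightarrow> br \<rho> (G \<rho>)" by metis
  \<comment> \<open>Any radius strictly between \<open>dist w x\<close> and \<open>\<sigma>\<close>
    gives the same value; the midpoint is a choice that depends on x alone.\<close>
  define H where "H x = G ((dist w x + \<sigma>) / 2) x" for x
  have HG: "H x = G \<rho> x" if "\<rho> < \<sigma>" "x \<in> ball w \<rho>" for x \<rho>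
  proof -
    define \<tau> where "\<tau> = (dist w x + \<sigma>) / 2"
    have "dist w x < \<sigma>" using that by simp
    then have \<tau>: "dist w x < \<tau>" "\<tau> < \<sigma>" "0 < \<tau>" unfolding \<tau>_def using \<sigma> by (auto intro: add_nonneg_pos)
    have p: "0 < \<rho>" using that(2) le_less_trans[OF zero_le_dist] unfolding mem_ball by blast
    have "br (min \<rho> \<tau>) (G \<rho>)" using mono[OF G[OF that(1) p], of "min \<rho> \<tau>"] by auto
    moreover have "br (min \<rho> \<tau>) (G \<tau>)" using mono[OF G[OF \<tau>(2,3)], of "min \<rho> \<tau>"] by auto
    ultimately show ?thesis unfolding H_def \<tau>_def[symmetric]
      using uniq[of "min \<rho> \<tau>" "G \<tau>" "G \<rho>" x] p \<tau> that \<sigma> by auto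
  qed
  have brH: "br \<sigma> H"
  proof -
    have "H holomorphic_on ball w \<sigma>"
    proof (subst holomorphic_on_open[OF open_ball], intro ballI)
      fix x assume "x \<in> ball w \<sigma>"
      then have *: "(dist w x + \<sigma>) / 2 < \<sigma>" "x \<in> ball w ((dist w x + \<sigma>) / 2)" by (auto simp: field_simps)
      define \<rho> where "\<rho> = (dist w x + \<sigma>) / 2"
      have p: "0 < \<rho>" unfolding \<rho>_def using \<sigma> by (simp add: add_nonneg_pos)
      have "G \<rho> holomorphic_on ball w \<rho>" using G[of \<rho>] * p unfolding \<rho>_def br_def by auto
      then have "H holomorphic_on ball w \<rho>"
        by (rule holomorphic_transform) (use HG[of \<rho>] * in \<open>simp add: \<rho>_def\<close>)
      then show "\<exists>f'. (H has_field_derivative f') (at x)"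
        using holomorphic_on_open[OF open_ball, of H w \<rho>] *(2) unfolding \<rho>_def[symmetric] by blast
    qed
    moreover have "H w = z" using HG[of "\<sigma>/2" w] G[of "\<sigma>/2"] \<sigma> unfolding br_def by auto
    moreover have "f (H x) = x" if "x \<in> ball w \<sigma>" for x
    proof -
      have *: "(dist w x + \<sigma>) / 2 < \<sigma>" "x \<in> ball w ((dist w x + \<sigma>) / 2)" "0 < (dist w x + \<sigma>) / 2"
        using that \<sigma> by (auto intro: add_nonneg_pos)
      show ?thesis using G[OF *(1,3)] *(2) unfolding br_def H_def by auto
    qed
    ultimately show ?thesis unfolding br_def by auto
  qed
  have "\<sigma> = r"
  proof (rule ccontr)
    assume "\<sigma> \<noteq> r"
    then have "\<sigma> < r" using \<sigma> by simp
    have dis\<sigma>: "ball w \<sigma> \<inter> singular_values f = {}" using dis \<sigma> subset_ball[of \<sigma> r w] by blast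
    have "\<exists>\<epsilon> k. 0 < \<epsilon> \<and> k holomorphic_on ball w1 \<epsilon> \<and> (\<forall>x\<in>ball w1 \<epsilon>. f (k x) = x) \<and>
        (\<forall>x \<in> ball w1 \<epsilon> \<inter> ball w \<sigma>. k x = H x)" if "w1 \<in> sphere w \<sigma>" for w1
    proof -
      have "w1 \<in> ball w r" using that \<open>\<sigma> < r\<close> by simp
      then have "w1 \<notin> singular_values f" using dis by blast
      then show ?thesis
        using branch_boundary_extension[OF holf \<sigma>(1) _ _ dis\<sigma> that, of H] brH unfolding br_def by metis
    qed
    then obtain \<epsilon> k where k: "\<And>w1. w1 \<in> sphere w \<sigma> \<Longrightarrow> 0 < \<epsilon> w1 \<and> k w1 holomorphic_on ball w1 (\<epsilon> w1) \<and>
        (\<forall>x\<in>ball w1 (\<epsilon> w1). f (k w1 x) = x) \<and> (\<forall>x \<in> ball w1 (\<epsilon> w1) \<inter> ball w \<sigma>. k w1 x = H x)" by metis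
    define V where "V = ball w \<sigma> \<union> (\<Union>w1\<in>sphere w \<sigma>. ball w1 (\<epsilon> w1))"
    have "open V" unfolding V_def by (intro open_Un open_UN) auto
    have "cball w \<sigma> \<subseteq> V"
    proof
      fix x assume "x \<in> cball w \<sigma>"
      then consider "x \<in> ball w \<sigma>" | "x \<in> sphere w \<sigma>" by fastforce
      then show "x \<in> V"
      proof cases
        case 2
        then have "x \<in> ball x (\<epsilon> x)" using k by auto
        then show ?thesis using 2 unfolding V_def by blast
      qed (auto simp: V_def)
    qed
    then obtain e where e: "e > 0" "(\<Union>x\<in>cball w \<sigma>. ball x e) \<subseteq> V"
      using compact_subset_open_imp_ball_epsilon_subset[OF compact_cball \<open>open V\<close>] by metis
    have k_agree: "k w1 x = k w2 x"
      if "w1 \<in> sphere w \<sigma>" "w2 \<in> sphere w \<sigma>" "x \<in> ball w1 (\<epsilon> w1)" "x \<in> ball w2 (\<epsilon> w2)" "x \<notin> ball w \<sigma>"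
      "x \<in> ball w r" for w1 w2 x
    proof -
      \<comment> \<open>The projection to the closed disc is 1-Lipschitz and fixes w1 and w2, so p
        is no farther from either centre than x. The two small discs therefore have a common point
        inside \<open>ball w \<sigma>\<close>, where both extensions equal H.\<close>
      define p where "p = closest_point (cball w \<sigma>) x"
      have ne: "cball w \<sigma> \<noteq> {}" using \<sigma> by auto
      have pc: "p \<in> cball w \<sigma>" unfolding p_def by (rule closest_point_in_set[OF closed_cball ne])
      have pd: "dist p u \<le> dist x u" if "u \<in> sphere w \<sigma>" for u
      proof -
        have "dist (closest_point (cball w \<sigma>) x) (closest_point (cball w \<sigma>) u) \<le> dist x u"
          by (rule closest_point_lipschitz[OF convex_cball closed_cball ne])
        moreover have "closest_point (cball w \<sigma>) u = u" by (rule closest_point_self) (use that in auto)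
        ultimately show ?thesis unfolding p_def by simp
      qed
      define I where "I = ball w1 (\<epsilon> w1) \<inter> ball w2 (\<epsilon> w2)"
      have pI: "p \<in> I" unfolding I_def using pd[OF that(1)] pd[OF that(2)] that(3,4) by (auto simp: dist_commute)
      have "open I" "convex I" unfolding I_def by (auto intro: convex_Int)
      have "p \<in> closure (ball w \<sigma>)" using pc \<sigma> by simp
      then obtain q where q: "q \<in> ball w \<sigma>" "q \<in> I"
        using \<open>open I\<close> pI by (metis closure_iff_nhds_not_empty disjoint_iff order_refl)
      define J where "J = I \<inter> ball w r"
      have "convex J" unfolding J_def by (simp add: \<open>convex I\<close> convex_Int)
      show ?thesis
      proof (rule lift_unique[OF holf convex_connected[OF \<open>convex J\<close>], of "k w1" "k w2" q])
        show "continuous_on J (k w1)" "continuous_on J (k w2)"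
          using k[OF that(1)] k[OF that(2)] unfolding J_def I_def
          by (meson continuous_on_subset holomorphic_on_imp_continuous_on inf.coboundedI1 inf_le1 inf_le2)+
        show "f (k w1 y) = f (k w2 y)" if "y \<in> J" for y
          using that k \<open>w1 \<in> _\<close> \<open>w2 \<in> _\<close> unfolding J_def I_def by auto
        show "deriv f (k w1 y) \<noteq> 0" if "y \<in> J" for y
        proof
          assume "deriv f (k w1 y) = 0"
          then have "f (k w1 y) \<in> singular_values f" by (rule deriv_0_critical)
          moreover have "f (k w1 y) = y" using that k \<open>w1 \<in> _\<close> unfolding J_def I_def by auto
          ultimately show False using that dis unfolding J_def by auto
        qed
        show "q \<in> J" using q \<sigma> unfolding J_def by auto
        show "k w1 q = k w2 q" using q k that unfolding I_def by auto
        show "x \<in> J" using that unfolding J_def I_def by auto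
      qed
    qed
    define W where "W x = (SOME u. u \<in> sphere w \<sigma> \<and> x \<in> ball u (\<epsilon> u))" for x
    define F where "F x = (if x \<in> ball w \<sigma> then H x else k (W x) x)" for x
    have Fk: "F x = k u x" if "u \<in> sphere w \<sigma>" "x \<in> ball u (\<epsilon> u)" "x \<in> ball w r" for x u
    proof (cases "x \<in> ball w \<sigma>")
      case True then show ?thesis unfolding F_def using k that by auto
    next
      case False
      have "W x \<in> sphere w \<sigma> \<and> x \<in> ball (W x) (\<epsilon> (W x))"
        unfolding W_def by (rule someI[of _ u]) (use that in auto)
      then show ?thesis using k_agree[of "W x" u x] that False unfolding F_def by auto
    qed
    define \<rho> where "\<rho> = min r (\<sigma> + e)"
    have \<rho>: "\<sigma> < \<rho>" "\<rho> \<le> r" unfolding \<rho>_def using e \<open>\<sigma> < r\<close> by auto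
    have bV: "ball w \<rho> \<subseteq> V"
    proof
      fix x assume x: "x \<in> ball w \<rho>"
      define p where "p = closest_point (cball w \<sigma>) x"
      show "x \<in> V"
      proof (cases "x \<in> ball w \<sigma>")
        case False
        define c where "c = w + of_real (\<sigma> / dist w x) * (x - w)"
        have dx: "dist w x \<ge> \<sigma>" "dist w x > 0" using False \<sigma> by auto
        have "dist w c = \<sigma>" unfolding c_def dist_norm using dx \<sigma>
          by (simp add: norm_mult norm_divide dist_norm norm_minus_commute)
        moreover have "dist c x < e"
        proof -
          have "c - x = of_real (\<sigma> / dist w x - 1) * (x - w)" unfolding c_def by (simp add: algebra_simps)
          then have "dist c x = \<bar>\<sigma> / dist w x - 1\<bar> * dist w x"
            unfolding dist_norm by (simp only: norm_mult norm_of_real norm_minus_commute)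
          also have "\<dots> = dist w x - \<sigma>" using dx by (simp add: abs_if field_simps)
          also have "\<dots> < e" using x unfolding \<rho>_def by auto
          finally show ?thesis .
        qed
        ultimately have "x \<in> (\<Union>x\<in>cball w \<sigma>. ball x e)" by (auto intro!: bexI[of _ c])
        then show ?thesis using e by blast
      qed (auto simp: V_def)
    qed
    have "br \<rho> F"
      unfolding br_def
    proof (intro conjI ballI)
      show "F w = z" using brH \<sigma> unfolding F_def br_def by auto
      show "f (F x) = x" if x: "x \<in> ball w \<rho>" for x
      proof (cases "x \<in> ball w \<sigma>")
        case True then show ?thesis using brH unfolding F_def br_def by auto
      next
        case False
        then obtain u where "u \<in> sphere w \<sigma>" "x \<in> ball u (\<epsilon> u)" using bV x unfolding V_def by blast
        then show ?thesis using Fk[of u x] k that \<rho> by auto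
      qed
      show "F holomorphic_on ball w \<rho>"
      proof (subst holomorphic_on_open[OF open_ball], intro ballI)
        fix x assume x: "x \<in> ball w \<rho>"
        show "\<exists>f'. (F has_field_derivative f') (at x)"
        proof (cases "x \<in> ball w \<sigma>")
          case True
          have "H holomorphic_on ball w \<sigma>" using brH unfolding br_def by blast
          then have "F holomorphic_on ball w \<sigma>"
            by (rule holomorphic_transform) (simp add: F_def)
          then show ?thesis using True holomorphic_on_open[OF open_ball, of F w \<sigma>] by blast
        next
          case False
          then obtain u where u: "u \<in> sphere w \<sigma>" "x \<in> ball u (\<epsilon> u)" using bV x unfolding V_def by blast
          define O' where "O' = ball u (\<epsilon> u) \<inter> ball w r"
          have "k u holomorphic_on O'" using k[OF u(1)] holomorphic_on_subset unfolding O'_def by blast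
          then have "F holomorphic_on O'"
            by (rule holomorphic_transform) (use Fk[OF u(1)] in \<open>auto simp: O'_def\<close>)
          moreover have "open O'" "x \<in> O'" unfolding O'_def using u x \<rho> by auto
          ultimately show ?thesis using holomorphic_on_open by blast
        qed
      qed
    qed
    then have "\<rho> \<in> A" unfolding A_def using \<rho> \<sigma> by auto
    then have "\<rho> \<le> \<sigma>" unfolding \<sigma>_def by (rule cSup_upper[OF _ bdd])
    then show False using \<rho> by simp
  qed
  then show thesis using that[of H] brH unfolding br_def by auto
qed

section \<open>Lifting the radial retraction\<close>

locale postsingular_cover =
  fixes f :: "complex \<Rightarrow> complex" and P :: "complex set"
  assumes holf: "f holomorphic_on UNIV" and closedP: "closed P"
    and singP: "singular_values f \<subseteq> P"
begin

lemma contf: "continuous_on A f"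
  using holf holomorphic_on_imp_continuous_on continuous_on_subset by blast

lemma deriv_nz: "f z \<notin> P \<Longrightarrow> deriv f z \<noteq> 0"
  using deriv_0_critical singP by blast

lemma branch:
  assumes "ball w r \<inter> P = {}" "0 < r" "f z = w"
  obtains g where "g holomorphic_on ball w r" "g w = z" "\<And>x. x \<in> ball w r \<Longrightarrow> f (g x) = x"
  using inverse_branch_ball[OF holf _ assms(2,3)] assms(1) singP by (metis disjoint_iff subsetD)

text \<open>The union of those components of the complement of P that f reaches (see
  \<open>connected_subset_V\<close>); a covering map has to be onto its base.\<close>

definition V where "V = f ` (- f -` P)"

lemma ball_subset_V:
  assumes "ball w r \<inter> P = {}" "w \<in> V" shows "ball w r \<subseteq> V"
proof
  fix x assume x: "x \<in> ball w r"
  then have "0 < r" using le_less_trans[OF zero_le_dist] unfolding mem_ball by blast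
  obtain z where "f z = w" using assms(2) unfolding V_def by auto
  then obtain g where "\<And>x. x \<in> ball w r \<Longrightarrow> f (g x) = x" using branch[OF assms(1) \<open>0 < r\<close>] by metis
  then show "x \<in> V" unfolding V_def using x assms(1) by (auto intro!: image_eqI[of _ _ "g x"])
qed

lemma ball_off_P: "w \<notin> P \<Longrightarrow> \<exists>r>0. ball w r \<inter> P = {}"
  using closedP open_contains_ball[of "- P"] by (auto simp: open_Compl disjoint_eq_subset_Compl)

lemma connected_subset_V:
  assumes "connected U" "U \<inter> P = {}" "f a \<in> U" shows "U \<subseteq> V"
proof -
  have "openin (top_of_set U) (U \<inter> V)"
  proof (subst openin_subopen, intro ballI)
    fix x assume x: "x \<in> U \<inter> V"
    then obtain r where r: "r > 0" "ball x r \<inter> P = {}" using ball_off_P assms(2) by blast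
    then have "ball x r \<subseteq> V" using ball_subset_V x by blast
    then have "openin (top_of_set U) (U \<inter> ball x r)" "x \<in> U \<inter> ball x r" "U \<inter> ball x r \<subseteq> U \<inter> V"
      using x r by auto
    then show "\<exists>T. openin (top_of_set U) T \<and> x \<in> T \<and> T \<subseteq> U \<inter> V" by blast
  qed
  moreover have "closedin (top_of_set U) (U \<inter> V)"
  proof -
    have "openin (top_of_set U) (U - V)"
    proof (subst openin_subopen, intro ballI)
      fix x assume x: "x \<in> U - V"
      then obtain r where r: "r > 0" "ball x r \<inter> P = {}" using ball_off_P assms(2) by blast
      have "ball x (r/2) \<inter> V = {}"
      proof (rule ccontr)
        assume "ball x (r/2) \<inter> V \<noteq> {}"
        then obtain v where v: "v \<in> ball x (r/2)" "v \<in> V" by blast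
        have sub: "ball v (r/2) \<subseteq> ball x r"
        proof
          fix y assume "y \<in> ball v (r/2)"
          then show "y \<in> ball x r" using v(1) dist_triangle[of x y v] by auto
        qed
        then have "ball v (r/2) \<subseteq> V" using ball_subset_V[of v "r/2"] r(2) v(2) by blast
        moreover have "x \<in> ball v (r/2)" using v(1) by (simp add: dist_commute)
        ultimately show False using x by blast
      qed
      then have "openin (top_of_set U) (U \<inter> ball x (r/2))" "x \<in> U \<inter> ball x (r/2)" "U \<inter> ball x (r/2) \<subseteq> U - V"
        using x r by auto
      then show "\<exists>T. openin (top_of_set U) T \<and> x \<in> T \<and> T \<subseteq> U - V" by blast
    qed
    then show ?thesis by (simp add: closedin_def Diff_Int)
  qed
  moreover have "f a \<in> U \<inter> V" using assms unfolding V_def by auto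
  ultimately have "U \<inter> V = U" using assms(1) unfolding connected_clopen by blast
  then show ?thesis by blast
qed

lemma covering: "covering_space (- f -` P) f V"
proof (rule covering_spaceI)
  show "continuous_on (- f -` P) f" by (rule contf)
  show "f ` (- f -` P) = V" unfolding V_def ..
  fix w assume w: "w \<in> V"
  then have "w \<notin> P" unfolding V_def by auto
  then obtain r where r: "r > 0" "ball w r \<inter> P = {}" using ball_off_P by blast
  \<comment> \<open>The disc of radius 2r/3 about any point of T contains T and stays inside
    \<open>ball w r\<close>. So every preimage of a point of T carries a branch on all of T, and the
    sheets are the images of these branches.\<close>
  define T where "T = ball w (r/3)"
  have TV: "T \<subseteq> V" using ball_subset_V[OF r(2) w] r(1) subset_ball[of "r/3" r w] unfolding T_def by fastforce
  have "\<exists>g. f z \<in> T \<longrightarrow> g holomorphic_on T \<and> g (f z) = z \<and> (\<forall>x\<in>T. f (g x) = x)" for z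
  proof (cases "f z \<in> T")
    case True
    have sub: "ball (f z) (2*r/3) \<subseteq> ball w r" "T \<subseteq> ball (f z) (2*r/3)"
    proof -
      show "ball (f z) (2*r/3) \<subseteq> ball w r"
      proof
        fix y assume "y \<in> ball (f z) (2*r/3)"
        then show "y \<in> ball w r" using True dist_triangle[of w y "f z"] unfolding T_def by auto
      qed
      show "T \<subseteq> ball (f z) (2*r/3)"
      proof
        fix y assume "y \<in> T"
        then show "y \<in> ball (f z) (2*r/3)" using True dist_triangle[of "f z" y w] unfolding T_def by (auto simp: dist_commute)
      qed
    qed
    obtain g where g: "g holomorphic_on ball (f z) (2*r/3)" "g (f z) = z" "\<And>x. x \<in> ball (f z) (2*r/3) \<Longrightarrow> f (g x) = x"
    proof (rule branch[of "f z" "2*r/3" z])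
      show "ball (f z) (2*r/3) \<inter> P = {}" using sub(1) r(2) by blast
    qed (use r(1) in auto)
    then show ?thesis using sub(2) holomorphic_on_subset by blast
  qed auto
  then obtain G where G: "\<And>z. f z \<in> T \<Longrightarrow> G z holomorphic_on T \<and> G z (f z) = z \<and> (\<forall>x\<in>T. f (G z x) = x)"
    by metis
  have TP: "T \<inter> P = {}" using r subset_ball[of "r/3" r w] unfolding T_def by fastforce
  define v where "v = (\<lambda>z. G z ` T) ` {z. f z \<in> T}"
  have agree: "G z x = G z' x" if "f z \<in> T" "f z' \<in> T" "x0 \<in> T" "G z x0 = G z' x0" "x \<in> T" for z z' x0 x
  proof (rule lift_unique[where f=f and U=T and g="G z" and h="G z'" and ?x0.0=x0 and x=x, OF holf])
    show "connected T" unfolding T_def by simp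
    show "continuous_on T (G z)" "continuous_on T (G z')" using G that holomorphic_on_imp_continuous_on by blast+
    show "f (G z y) = f (G z' y)" if "y \<in> T" for y using G that \<open>f z \<in> T\<close> \<open>f z' \<in> T\<close> by auto
    show "deriv f (G z y) \<noteq> 0" if "y \<in> T" for y
      using deriv_nz[of "G z y"] G[OF \<open>f z \<in> T\<close>] that TP by auto
  qed (use that in auto)
  show "\<exists>T. w \<in> T \<and> openin (top_of_set V) T \<and>
         (\<exists>v. \<Union>v = - f -` P \<inter> f -` T \<and> (\<forall>u\<in>v. openin (top_of_set (- f -` P)) u) \<and>
              pairwise disjnt v \<and> (\<forall>u\<in>v. Ex (homeomorphism u T f)))"
  proof (intro exI[of _ T] conjI exI[of _ v])
    show "w \<in> T" unfolding T_def using r by auto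
    show "openin (top_of_set V) T" using TV unfolding T_def by (simp add: openin_open_eq open_subset)
    show "\<Union>v = - f -` P \<inter> f -` T"
    proof
      show "\<Union>v \<subseteq> - f -` P \<inter> f -` T" unfolding v_def using G TP by auto
      show "- f -` P \<inter> f -` T \<subseteq> \<Union>v"
      proof
        fix z assume "z \<in> - f -` P \<inter> f -` T"
        then have z: "f z \<in> T" by auto
        then have "z \<in> G z ` T" using G[OF z] by (metis image_eqI)
        then show "z \<in> \<Union>v" unfolding v_def using z by auto
      qed
    qed
    have opG: "open (G z ` T)" if "f z \<in> T" for z
    proof (rule open_mapping_thm3)
      show "inj_on (G z) T" using G[OF that] by (metis inj_on_inverseI)
    qed (use G that T_def in auto)
    show "\<forall>u\<in>v. openin (top_of_set (- f -` P)) u"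
    proof
      fix u assume "u \<in> v"
      then obtain z where z: "f z \<in> T" "u = G z ` T" unfolding v_def by auto
      then have "u \<subseteq> - f -` P" using G[OF z(1)] TP by auto
      then show "openin (top_of_set (- f -` P)) u" using opG[OF z(1)] z(2) by (simp add: open_subset)
    qed
    show "pairwise disjnt v"
    proof (rule pairwiseI)
      fix u u' assume u: "u \<in> v" "u' \<in> v" "u \<noteq> u'"
      then obtain z z' where z: "f z \<in> T" "u = G z ` T" "f z' \<in> T" "u' = G z' ` T" unfolding v_def by auto
      show "disjnt u u'"
      proof (rule ccontr)
        assume "\<not> disjnt u u'"
        then obtain t t' where t: "t \<in> T" "t' \<in> T" "G z t = G z' t'" unfolding disjnt_def z by auto
        then have "t = t'" using G[OF z(1)] G[OF z(3)] by metis
        then have "G z x = G z' x" if "x \<in> T" for x using agree[OF z(1,3) t(1)] t that by auto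
        then show False using u(3) z by auto
      qed
    qed
    show "\<forall>u\<in>v. Ex (homeomorphism u T f)"
    proof
      fix u assume "u \<in> v"
      then obtain z where z: "f z \<in> T" "u = G z ` T" unfolding v_def by auto
      have "homeomorphism u T f (G z)"
        unfolding homeomorphism_def using G[OF z(1)] contf[of u]
        by (auto simp: z holomorphic_on_imp_continuous_on image_image)
      then show "Ex (homeomorphism u T f)" by blast
    qed
  qed
qed

lemma lift_cont:
  fixes h :: "'a::real_normed_vector \<Rightarrow> complex"
  assumes "simply_connected U" "locally path_connected U" "continuous_on U h"
    "\<And>x. x \<in> U \<Longrightarrow> h x \<notin> P" "z \<in> U" "h z = f a"
  obtains g where "continuous_on U g" "g z = a" "\<And>x. x \<in> U \<Longrightarrow> f (g x) = h x"
proof -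
  have "connected (h ` U)"
    using connected_continuous_image[OF assms(3)] simply_connected_imp_connected[OF assms(1)] by blast
  moreover have "h ` U \<inter> P = {}" using assms(4) by auto
  moreover have "f a \<in> h ` U" using assms(5,6) by (metis imageI)
  ultimately have "h ` U \<subseteq> V" by (rule connected_subset_V)
  then have hV: "h \<in> U \<rightarrow> V" by auto
  have a: "a \<in> - f -` P" using assms(4)[OF assms(5)] assms(6) by auto
  show thesis
    using covering_space_lift_strong[OF covering a assms(5,1,2,3) hV assms(6)] that by metis
qed

lemma lift_hol:
  assumes "open U" "simply_connected U" "h holomorphic_on U"
    "\<And>x. x \<in> U \<Longrightarrow> h x \<notin> P" "z \<in> U" "h z = f a"
  obtains g where "g holomorphic_on U" "g z = a" "\<And>x. x \<in> U \<Longrightarrow> f (g x) = h x"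
proof -
  obtain g where g: "continuous_on U g" "g z = a" "\<And>x. x \<in> U \<Longrightarrow> f (g x) = h x"
    using lift_cont[OF assms(2) open_imp_locally_path_connected[OF assms(1)]
        holomorphic_on_imp_continuous_on[OF assms(3)] assms(4,5,6)] by metis
  have "g holomorphic_on U"
    by (rule lift_holomorphic[OF holf assms(1) g(1) assms(3) g(3)])
       (use g(3) deriv_nz assms(4) in auto)
  then show thesis using that g by blast
qed

text \<open>Homotopy lifting for a motion of the values of f: it becomes a motion of the points
  themselves that starts from the identity.\<close>

lemma lift_hom:
  assumes cont: "continuous_on ({0..1::real} \<times> U) h"
    and nP: "\<And>t y. t \<in> {0..1} \<Longrightarrow> y \<in> U \<Longrightarrow> h (t, y) \<notin> P"
    and h0: "\<And>y. y \<in> U \<Longrightarrow> h (0, y) = f y"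
  obtains k where "continuous_on ({0..1} \<times> U) k" "\<And>y. y \<in> U \<Longrightarrow> k (0, y) = (y::complex)"
    "\<And>t y. t \<in> {0..1} \<Longrightarrow> y \<in> U \<Longrightarrow> f (k (t, y)) = h (t, y)"
proof -
  have "h (t, y) \<in> V" if "t \<in> {0..1}" "y \<in> U" for t y
  proof -
    have "connected ((\<lambda>t. h (t, y)) ` {0..1})"
      by (intro connected_continuous_image continuous_on_compose2[OF cont]) (use that in \<open>auto intro!: continuous_intros\<close>)
    moreover have "(\<lambda>t. h (t, y)) ` {0..1} \<inter> P = {}" using nP that by auto
    moreover have "f y \<in> (\<lambda>t. h (t, y)) ` {0..1}" using h0[OF that(2)] by (metis atLeastAtMost_iff imageI order_refl zero_le_one)
    ultimately have "(\<lambda>t. h (t, y)) ` {0..1} \<subseteq> V" by (rule connected_subset_V)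
    then show ?thesis using that by auto
  qed
  then have hV: "h \<in> ({0..1} \<times> U) \<rightarrow> V" by auto
  have U: "(\<lambda>y. y) \<in> U \<rightarrow> - f -` P" using nP[of 0] h0 by fastforce
  show thesis
    using covering_space_lift_homotopy[OF covering cont hV h0 continuous_on_id U] that
    by (metis mem_Sigma_iff)
qed

end

text \<open>The straight motion, in time \<open>fst p\<close>, of the point \<open>snd p\<close>
  along its ray from c to the circle of radius R. The argument is a pair because homotopies live on
  product sets.\<close>

definition radial :: "complex \<Rightarrow> real \<Rightarrow> real \<times> complex \<Rightarrow> complex" where
  "radial c R p = c + of_real (1 - fst p + fst p * R / dist c (snd p)) * (snd p - c)"

lemma dist_radial:
  assumes "0 < R" "R \<le> dist c w" "0 \<le> t" "t \<le> 1"
  shows "R \<le> dist c (radial c R (t, w))" "dist c (radial c R (t, w)) \<le> dist c w"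
    "t = 1 \<Longrightarrow> dist c (radial c R (t, w)) = R"
proof -
  define d where "d = dist c w"
  have d: "R \<le> d" "0 < d" using assms unfolding d_def by auto
  have nn: "0 \<le> 1 - t + t * R / d" using assms d by simp
  have "dist c (radial c R (t, w)) = \<bar>1 - t + t * R / d\<bar> * d"
    unfolding radial_def d_def dist_norm
    by (simp add: norm_mult norm_minus_commute del: of_real_add of_real_diff of_real_divide of_real_mult)
  also have "\<dots> = (1 - t) * d + t * R" using nn d by (simp add: field_simps)
  finally have eq: "dist c (radial c R (t, w)) = (1 - t) * d + t * R" .
  have "(1 - t) * R \<le> (1 - t) * d" "t * R \<le> t * d" using assms d by (auto intro: mult_left_mono)
  then show "R \<le> dist c (radial c R (t, w))" "dist c (radial c R (t, w)) \<le> dist c w"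
    unfolding eq d_def[symmetric] by (auto simp: algebra_simps)
  show "t = 1 \<Longrightarrow> dist c (radial c R (t, w)) = R" unfolding eq by simp
qed

section \<open>Lifting the radial motion through all iterates\<close>

locale postsingular_disc = postsingular_cover +
  fixes c :: complex and R :: real
  assumes invP: "f ` P \<subseteq> P" and Rpos: "0 < R" and Pball: "P \<subseteq> ball c R"
begin

lemma funpow_P: "x \<in> P \<Longrightarrow> (f ^^ n) x \<in> P"
  using invP by (induction n) auto

definition X where "X n = {z. R \<le> dist c ((f ^^ n) z)}"

lemma cont_funpow: "continuous_on A (f ^^ n)"
proof (induction n)
  case (Suc n)
  then show ?case using continuous_on_compose[OF Suc contf] by simp
qed (simp add: id_def)

lemma hol_funpow: "(f ^^ n) holomorphic_on A"
proof (induction n)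
  case (Suc n)
  have "f \<circ> (f ^^ n) holomorphic_on A"
    by (rule holomorphic_on_compose[OF Suc]) (use holf holomorphic_on_subset in blast)
  then show ?case by (simp add: o_def)
qed (simp add: id_def)

definition rprop where "rprop n H \<longleftrightarrow> continuous_on ({0..1} \<times> X n) H \<and> (\<forall>z\<in>X n. H (0, z) = z) \<and>
    (\<forall>t\<in>{0..1}. \<forall>z\<in>X n. (f ^^ n) (H (t, z)) = radial c R (t, (f ^^ n) z))"

text \<open>The motion for \<open>Suc n\<close> is a lift of the one for n through a single f, which
  yields the commutation with f together with the lift. Lifting is possible because the motion
  avoids P: f^n carries it to points outside \<open>ball c R\<close>, whereas P is invariant and
  lies inside.\<close>

lemma ex_radial_lifts:
  "\<exists>H. \<forall>n. rprop n (H n) \<and> (\<forall>t\<in>{0..1}. \<forall>z\<in>X (Suc n). f (H (Suc n) (t, z)) = H n (t, f z))"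
proof (rule dependent_nat_choice)
  have "continuous_on ({0..1} \<times> X 0) (radial c R)"
    unfolding radial_def by (intro continuous_intros) (use Rpos in \<open>auto simp: X_def\<close>)
  then have "rprop 0 (radial c R)" unfolding rprop_def by (auto simp: radial_def)
  then show "\<exists>H. rprop 0 H" by blast
next
  fix H n assume H: "rprop n H"
  define h where "h p = H (fst p, f (snd p))" for p
  have fX: "f z \<in> X n" if "z \<in> X (Suc n)" for z
    using that unfolding X_def by (simp add: funpow_swap1)
  have 1: "continuous_on ({0..1} \<times> X (Suc n)) h"
    unfolding h_def
    by (rule continuous_on_compose2[of "{0..1} \<times> X n" H])
       (use H fX in \<open>auto simp: rprop_def intro!: continuous_intros continuous_on_compose2[OF contf]\<close>)
  have 2: "h (t, y) \<notin> P" if "t \<in> {0..1}" "y \<in> X (Suc n)" for t y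
  proof
    assume "h (t, y) \<in> P"
    then have "(f ^^ n) (H (t, f y)) \<in> P" using funpow_P unfolding h_def by auto
    then have "radial c R (t, (f ^^ n) (f y)) \<in> ball c R"
      using H fX[OF that(2)] that Pball unfolding rprop_def by auto
    moreover have "R \<le> dist c ((f ^^ n) (f y))" using fX[OF that(2)] unfolding X_def by simp
    ultimately show False using dist_radial(1)[of R c "(f ^^ n) (f y)" t] Rpos that by auto
  qed
  have 3: "h (0, y) = f y" if "y \<in> X (Suc n)" for y
    using H fX[OF that] unfolding h_def rprop_def by auto
  obtain k where k: "continuous_on ({0..1} \<times> X (Suc n)) k" "\<And>y. y \<in> X (Suc n) \<Longrightarrow> k (0, y) = y"
    "\<And>t y. t \<in> {0..1} \<Longrightarrow> y \<in> X (Suc n) \<Longrightarrow> f (k (t, y)) = h (t, y)"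
    using lift_hom[OF 1 2 3] by metis
  have "(f ^^ Suc n) (k (t, z)) = radial c R (t, (f ^^ Suc n) z)" if "t \<in> {0..1}" "z \<in> X (Suc n)" for t z
  proof -
    have "(f ^^ Suc n) (k (t, z)) = (f ^^ n) (f (k (t, z)))" by (simp add: funpow_swap1)
    also have "\<dots> = (f ^^ n) (H (t, f z))" using k(3)[OF that] unfolding h_def by simp
    also have "\<dots> = radial c R (t, (f ^^ n) (f z))" using H fX[OF that(2)] that unfolding rprop_def by auto
    finally show ?thesis by (simp add: funpow_swap1)
  qed
  then have "rprop (Suc n) k" unfolding rprop_def using k by blast
  then show "\<exists>y. rprop (Suc n) y \<and> (\<forall>t\<in>{0..1}. \<forall>z\<in>X (Suc n). f (y (t, z)) = H (t, f z))"
    using k(3) unfolding h_def by auto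
qed

definition RH where "RH = (SOME H. \<forall>n. rprop n (H n) \<and> (\<forall>t\<in>{0..1}. \<forall>z\<in>X (Suc n). f (H (Suc n) (t, z)) = H n (t, f z)))"

lemma RH: "rprop n (RH n)" "\<And>t z. t \<in> {0..1} \<Longrightarrow> z \<in> X (Suc n) \<Longrightarrow> f (RH (Suc n) (t, z)) = RH n (t, f z)"
  using someI_ex[OF ex_radial_lifts] unfolding RH_def by blast+

lemma RH_cont: "z \<in> X n \<Longrightarrow> continuous_on {0..1} (\<lambda>t. RH n (t, z))"
  using RH(1)[of n] unfolding rprop_def
  by (auto intro!: continuous_on_compose2[of "{0..1} \<times> X n" "RH n"] continuous_intros)

lemma RH_0: "z \<in> X n \<Longrightarrow> RH n (0, z) = z"
  using RH(1)[of n] unfolding rprop_def by auto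

lemma RH_funpow: "z \<in> X n \<Longrightarrow> t \<in> {0..1} \<Longrightarrow> (f ^^ n) (RH n (t, z)) = radial c R (t, (f ^^ n) z)"
  using RH(1)[of n] unfolding rprop_def by auto

lemma X_not_P: "z \<in> X n \<Longrightarrow> z \<notin> P"
  using funpow_P[of z n] Pball unfolding X_def by fastforce

lemma X_Suc: "z \<in> X (Suc n) \<longleftrightarrow> f z \<in> X n"
  unfolding X_def by (simp add: funpow_swap1)

text \<open>Points over the circle have a constant radial motion, and a lift of a constant path is
  constant. This makes the two halves of \<open>ret\<close> fit together continuously.\<close>

lemma RH_boundary: "dist c ((f ^^ n) z) = R \<Longrightarrow> t \<in> {0..1} \<Longrightarrow> RH n (t, z) = z"
proof (induction n arbitrary: z t)
  case 0
  then have "z \<in> X 0" unfolding X_def by simp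
  then have "RH 0 (t, z) = radial c R (t, z)" using RH_funpow[of z 0 t] 0 by simp
  also have "\<dots> = z" using 0 Rpos unfolding radial_def by simp
  finally show ?case .
next
  case (Suc n)
  have z: "z \<in> X (Suc n)" "f z \<in> X n" using Suc.prems unfolding X_Suc[symmetric] by (auto simp: X_def)
  have e: "f (RH (Suc n) (s, z)) = f z" if "s \<in> {0..1}" for s
    using RH(2)[OF that z(1)] Suc.IH[of "f z" s] that Suc.prems by (simp add: funpow_swap1)
  have "(\<lambda>s. RH (Suc n) (s, z)) t = (\<lambda>s. z) t"
    by (rule lift_unique[where f=f and U="{0..1}" and ?x0.0="0::real", OF holf])
       (use RH_cont[OF z(1)] e RH_0[OF z(1)] Suc.prems deriv_nz X_not_P[OF z(2)] in auto)
  then show ?case by simp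
qed

text \<open>The retraction r_n of the overview: the lifted motion at its final time.\<close>

definition ret where "ret n z = (if dist c ((f ^^ n) z) \<le> R then z else RH n (1, z))"

lemma ret_X: "z \<in> X n \<Longrightarrow> ret n z = RH n (1, z)"
  unfolding ret_def X_def using RH_boundary[of n z 1] by force

lemma ret_id: "dist c ((f ^^ n) z) \<le> R \<Longrightarrow> ret n z = z"
  unfolding ret_def by simp

lemma ret_cont: "continuous_on UNIV (ret n)"
proof -
  define A where "A = {z. dist c ((f ^^ n) z) \<le> R}"
  have cl: "closed A" "closed (X n)" unfolding A_def X_def
    by (intro closed_Collect_le continuous_intros cont_funpow)+
  have c2: "continuous_on (X n) (\<lambda>z. RH n (1, z))"
    using RH(1)[of n] unfolding rprop_def
    by (auto intro!: continuous_on_compose2[of "{0..1} \<times> X n" "RH n"] continuous_intros)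
  have "continuous_on (A \<union> X n) (\<lambda>z. if dist c ((f ^^ n) z) \<le> R then z else RH n (1, z))"
    by (rule continuous_on_cases[OF cl continuous_on_id c2])
       (use RH_boundary[of n _ 1] in \<open>auto simp: A_def X_def\<close>)
  moreover have "A \<union> X n = UNIV" unfolding A_def X_def by auto
  ultimately show ?thesis unfolding ret_def by simp
qed

lemma ret_semiconj: "f (ret (Suc n) z) = ret n (f z)"
proof (cases "z \<in> X (Suc n)")
  case True
  then show ?thesis using ret_X RH(2)[of 1 z n] X_Suc by auto
next
  case False
  then show ?thesis using ret_id[of "Suc n" z] ret_id[of n "f z"] unfolding X_def by (auto simp: funpow_swap1)
qed

lemma ret_funpow: "dist c ((f ^^ n) (ret n z)) \<le> R"
proof (cases "z \<in> X n")
  case True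
  then show ?thesis
    using ret_X[OF True] RH_funpow[OF True, of 1] dist_radial(3)[of R c "(f ^^ n) z" 1] Rpos unfolding X_def by auto
next
  case False
  then show ?thesis using ret_id[of n z] unfolding X_def by auto
qed

text \<open>The preimage is the image of the plane under \<open>ret 1\<close>. It is needed for a
  large disc around P, and for arbitrarily small discs when P has at most one point.\<close>

lemma connected_vimage_cball: "connected (f -` cball c R)"
proof -
  have "ret 1 ` UNIV = f -` cball c R"
  proof
    show "ret 1 ` UNIV \<subseteq> f -` cball c R" using ret_funpow[of 1] by auto
    show "f -` cball c R \<subseteq> ret 1 ` UNIV"
    proof
      fix z assume "z \<in> f -` cball c R"
      then have "z = ret 1 z" using ret_id[of 1 z] by auto
      then show "z \<in> ret 1 ` UNIV" by blast
    qed
  qed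
  then show ?thesis using connected_continuous_image[OF ret_cont connected_UNIV] by metis
qed

end

section \<open>Preimages in large annuli\<close>

lemma entire_linear_growth_on_circles:
  assumes holf: "f holomorphic_on UNIV"
    and le: "\<And>B. \<exists>t\<ge>B. \<forall>z. norm z = t \<longrightarrow> norm (f z) \<le> A * t"
  shows "\<exists>p. \<forall>z. f z = poly p z"
proof -
  have zero: "(deriv ^^ n) f 0 = 0" if n: "n \<ge> 2" for n
  proof (rule ccontr)
    assume nz: "(deriv ^^ n) f 0 \<noteq> 0"
    define d where "d = norm ((deriv ^^ n) f 0)"
    have "d > 0" using nz unfolding d_def by simp
    obtain t where t: "t \<ge> max 1 (fact n * A / d + 1)" "\<And>z. norm z = t \<Longrightarrow> norm (f z) \<le> A * t"
      using le by blast
    have t1: "t \<ge> 1" "t > fact n * A / d" using t(1) by auto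
    have A0: "A \<ge> 0" using t(2)[of "of_real t"] t1 by (smt (verit) norm_ge_zero norm_of_real zero_le_mult_iff)
    have "d \<le> fact n * (A * t) / t ^ n" unfolding d_def
      by (rule Cauchy_inequality) (use holf t t1 in \<open>auto intro: holomorphic_on_subset holomorphic_on_imp_continuous_on continuous_on_subset\<close>)
    also have "\<dots> \<le> fact n * (A * t) / t ^ 2"
      by (rule divide_left_mono) (use t1 A0 n in \<open>auto intro: power_increasing\<close>)
    also have "\<dots> = fact n * A / t" using t1 by (simp add: power2_eq_square)
    also have "\<dots> < d" using t1 \<open>d > 0\<close> by (simp add: field_simps)
    finally show False by simp
  qed
  have "f z = poly [:f 0, deriv f 0:] z" for z
  proof -
    have "((\<lambda>n. (deriv ^^ n) f 0 / fact n * (z - 0) ^ n) sums f z)"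
      by (rule holomorphic_power_series[of f 0 "norm z + 1"]) (use holf holomorphic_on_subset in auto)
    moreover have "((\<lambda>n. (deriv ^^ n) f 0 / fact n * (z - 0) ^ n) sums (\<Sum>n\<in>{0,1}. (deriv ^^ n) f 0 / fact n * (z - 0) ^ n))"
      by (rule sums_finite) (use zero in \<open>auto simp: numeral_2_eq_2 not_less_eq_eq Suc_le_eq\<close>)
    ultimately have "f z = (\<Sum>n\<in>{0,1}. (deriv ^^ n) f 0 / fact n * (z - 0) ^ n)" by (rule sums_unique2)
    then show ?thesis by simp
  qed
  then show ?thesis by blast
qed

text \<open>In the coordinate w = 1 / z the function 1 / (f - p) is bounded near 0 and so extends;
  it has a limit at infinity, from which \<open>pole_at_infinity\<close> produces the
  polynomial.\<close>

lemma entire_omits_near_infinity: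
  fixes f :: "complex \<Rightarrow> complex"
  assumes holf: "f holomorphic_on UNIV" and "0 < \<epsilon>"
    and le: "\<And>z. r \<le> norm z \<Longrightarrow> \<epsilon> \<le> norm (f z - p)"
  shows "\<exists>q. \<forall>z. f z = poly q z"
proof -
  define g where "g z = f z - p" for z
  have holg: "g holomorphic_on UNIV" unfolding g_def using holf by (intro holomorphic_intros)
  define h where "h w = inverse (g (inverse w))" for w
  define s where "s = 1 / (\<bar>r\<bar> + 1)"
  have s: "s > 0" unfolding s_def by simp
  have big: "r \<le> norm (inverse w)" if "w \<in> ball 0 s - {0}" for w :: complex
  proof -
    have "norm w < s" "w \<noteq> 0" using that by auto
    then have "norm w * (\<bar>r\<bar> + 1) < 1" unfolding s_def by (simp add: field_simps)
    moreover have "norm w > 0" using \<open>w \<noteq> 0\<close> by simp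
    ultimately have "\<bar>r\<bar> + 1 < inverse (norm w)" by (simp add: field_simps)
    then have "\<bar>r\<bar> + 1 < norm (inverse w)" using \<open>w \<noteq> 0\<close> by (simp add: nonzero_norm_inverse)
    then show ?thesis by linarith
  qed
  have gn: "g (inverse w) \<noteq> 0 \<and> \<epsilon> \<le> norm (g (inverse w))" if "w \<in> ball 0 s - {0}" for w
    using le[OF big[OF that]] \<open>0 < \<epsilon>\<close> unfolding g_def by auto
  have "h holomorphic_on ball 0 s - {0}" unfolding h_def
    by (intro holomorphic_on_inverse holomorphic_on_compose_gen[OF _ holg, unfolded o_def])
       (use gn in \<open>auto intro!: holomorphic_intros\<close>)
  moreover have "\<forall>\<^sub>F w in at 0. norm (h w) \<le> 1 / \<epsilon>"
  proof -
    have "\<forall>\<^sub>F w in at 0. w \<in> ball (0::complex) s - {0}"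
      using s eventually_at_in_open[of "ball (0::complex) s" 0] by simp
    then show ?thesis
    proof eventually_elim
      case (elim w)
      then have "g (inverse w) \<noteq> 0" "\<epsilon> \<le> norm (g (inverse w))" using gn by auto
      then have "inverse (norm (g (inverse w))) \<le> inverse \<epsilon>" using \<open>0 < \<epsilon>\<close> by (intro le_imp_inverse_le) auto
      then show ?case using \<open>g (inverse w) \<noteq> 0\<close> unfolding h_def by (simp add: norm_divide inverse_eq_divide)
    qed
  qed
  ultimately obtain k where k: "k holomorphic_on ball 0 s" "\<forall>w\<in>ball 0 s - {0}. k w = h w"
    using holomorphic_on_extend_bounded[of h "ball 0 s" 0] s by auto
  have "(k \<longlongrightarrow> k 0) (at 0)"
    using holomorphic_on_imp_continuous_on[OF k(1)] s
    by (metis continuous_on_eq_continuous_at isCont_def centre_in_ball open_ball)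
  then have "(h \<longlongrightarrow> k 0) (at 0)"
    by (rule Lim_transform_within_open[of _ _ _ _ "ball 0 s"]) (use k(2) s in auto)
  then have "((inverse \<circ> g) \<longlongrightarrow> k 0) at_infinity"
    unfolding lim_at_infinity_0 h_def by (simp add: o_def)
  then obtain a n where "\<And>z. g z = (\<Sum>i\<le>n. a i * z ^ i)" using pole_at_infinity[OF holg] by metis
  then have "f z = poly ((\<Sum>i\<le>n. monom (a i) i) + [:p:]) z" for z
    unfolding g_def by (simp add: poly_sum poly_monom eq_diff_eq[symmetric] diff_eq_eq)
  then show ?thesis by blast
qed

section \<open>Schottky's theorem for omitted or evenly attained values\<close>

lemma Schottky_ball:
  assumes "0 < \<tau>" "\<tau> < 1"
  obtains K where "0 < K" "\<And>h c \<rho> z. h holomorphic_on ball c \<rho> \<Longrightarrow> norm (h c) \<le> b \<Longrightarrow>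
     (\<And>z. z \<in> ball c \<rho> \<Longrightarrow> h z \<noteq> 0 \<and> h z \<noteq> 1) \<Longrightarrow> dist c z \<le> \<tau> * \<rho> \<Longrightarrow> 0 < \<rho> \<Longrightarrow> norm (h z) \<le> K"
proof -
  \<comment> \<open>Schottky's theorem is stated on the closed unit disc. So h is rescaled from the
    disc of radius \<open>\<sigma> * \<rho>\<close>, strictly between \<open>\<tau> * \<rho>\<close>
    and \<open>\<rho>\<close>, and z keeps modulus at most \<open>t < 1\<close>.\<close>
  define \<sigma> where "\<sigma> = (1 + \<tau>) / 2"
  define t where "t = \<tau> / \<sigma>"
  have \<sigma>: "\<tau> < \<sigma>" "\<sigma> < 1" "0 < \<sigma>" unfolding \<sigma>_def using assms by auto
  have t: "0 < t" "t < 1" unfolding t_def using \<sigma> assms by auto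
  define K where "K = exp (pi * exp (pi * (2 + 2 * b + 12 * t / (1 - t))))"
  have "norm (h z) \<le> K" if h: "h holomorphic_on ball c \<rho>" "norm (h c) \<le> b"
     "\<And>z. z \<in> ball c \<rho> \<Longrightarrow> h z \<noteq> 0 \<and> h z \<noteq> 1" "dist c z \<le> \<tau> * \<rho>" "0 < \<rho>" for h c \<rho> z
  proof -
    define g where "g s = h (c + of_real (\<sigma> * \<rho>) * s)" for s
    have in_ball: "c + of_real (\<sigma> * \<rho>) * s \<in> ball c \<rho>" if "s \<in> cball 0 1" for s
    proof -
      have "dist c (c + of_real (\<sigma> * \<rho>) * s) = \<sigma> * \<rho> * norm s"
        using \<sigma> \<open>0 < \<rho>\<close> by (simp add: dist_norm norm_mult)
      also have "\<dots> \<le> \<sigma> * \<rho> * 1" using that \<sigma> \<open>0 < \<rho>\<close> by (intro mult_left_mono) auto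
      also have "\<dots> < \<rho>" using \<sigma> \<open>0 < \<rho>\<close> by simp
      finally show ?thesis by simp
    qed
    define s where "s = (z - c) / of_real (\<sigma> * \<rho>)"
    have "norm s = dist c z / (\<sigma> * \<rho>)" unfolding s_def using \<sigma> \<open>0 < \<rho>\<close>
      by (simp add: norm_divide norm_mult dist_norm norm_minus_commute)
    also have "\<dots> \<le> t" unfolding t_def using \<open>dist c z \<le> \<tau> * \<rho>\<close> \<sigma> \<open>0 < \<rho>\<close> by (simp add: field_simps)
    finally have ns: "norm s \<le> t" .
    have "norm (g s) \<le> exp (pi * exp (pi * (2 + 2 * b + 12 * t / (1 - t))))"
    proof (rule Schottky[OF _ _ _ t ns])
      show "g holomorphic_on cball 0 1" unfolding g_def
        by (rule holomorphic_on_compose_gen[OF _ h(1), unfolded o_def])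
           (use in_ball in \<open>auto intro!: holomorphic_intros\<close>)
      show "norm (g 0) \<le> b" using h(2) unfolding g_def by simp
      show "\<not> (g s = 0 \<or> g s = 1)" if "s \<in> cball 0 1" for s
        using h(3)[OF in_ball[OF that]] unfolding g_def by simp
    qed
    moreover have "g s = h z" unfolding g_def s_def using \<sigma> \<open>0 < \<rho>\<close> by simp
    ultimately show ?thesis unfolding K_def by simp
  qed
  moreover have "0 < K" unfolding K_def by simp
  ultimately show thesis using that by blast
qed

text \<open>The value x is taken with even multiplicity only, expressed through a global holomorphic
  square root. An omitted value qualifies too when D is a disc on which h is holomorphic.\<close>

definition even_at :: "(complex \<Rightarrow> complex) \<Rightarrow> complex set \<Rightarrow> complex \<Rightarrow> bool" where
  "even_at h D x \<longleftrightarrow> (\<exists>u. u holomorphic_on D \<and> (\<forall>s\<in>D. h s - x = (u s)\<^sup>2))"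

text \<open>If all zeros of \<open>H\<close> are of even order, then \<open>\<plusminus>1\<close> are omitted by a square root of \<open>H\<close>.\<close>

lemma Schottky_even_aux:
  assumes "0 < \<tau>" "\<tau> < 1" "0 \<le> b"
  obtains K where "0 < K" "\<And>H c \<rho> z. H holomorphic_on ball c \<rho> \<Longrightarrow> norm (H c) \<le> b \<Longrightarrow>
     even_at H (ball c \<rho>) 0 \<Longrightarrow> (\<And>s. s \<in> ball c \<rho> \<Longrightarrow> H s \<noteq> 1) \<Longrightarrow>
     dist c z \<le> \<tau> * \<rho> \<Longrightarrow> 0 < \<rho> \<Longrightarrow> norm (H z) \<le> K"
proof -
  obtain K where K: "0 < K" "\<And>h c \<rho> z. h holomorphic_on ball c \<rho> \<Longrightarrow> norm (h c) \<le> (sqrt b + 1) / 2 \<Longrightarrow>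
     (\<And>z. z \<in> ball c \<rho> \<Longrightarrow> h z \<noteq> 0 \<and> h z \<noteq> 1) \<Longrightarrow> dist c z \<le> \<tau> * \<rho> \<Longrightarrow> 0 < \<rho> \<Longrightarrow> norm (h z) \<le> K"
    using Schottky_ball[OF assms(1,2)] by metis
  have "norm (H z) \<le> (2 * K + 1)\<^sup>2" if H: "H holomorphic_on ball c \<rho>" "norm (H c) \<le> b"
     "even_at H (ball c \<rho>) 0" "\<And>s. s \<in> ball c \<rho> \<Longrightarrow> H s \<noteq> 1" "dist c z \<le> \<tau> * \<rho>" "0 < \<rho>" for H c \<rho> z
  proof -
    obtain u where u: "u holomorphic_on ball c \<rho>" "\<And>s. s \<in> ball c \<rho> \<Longrightarrow> H s = (u s)\<^sup>2"
      using H(3) unfolding even_at_def by auto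
    have "(norm (u c))\<^sup>2 \<le> b" using H(2,6) u(2)[of c] by (simp add: norm_power)
    then have uc: "norm (u c) \<le> sqrt b" by (rule real_le_rsqrt)
    have "norm ((u z + 1) / 2) \<le> K"
    proof (rule K(2)[OF _ _ _ H(5,6)])
      show "(\<lambda>z. (u z + 1) / 2) holomorphic_on ball c \<rho>" using u(1) by (intro holomorphic_intros) auto
      show "norm ((u c + 1) / 2) \<le> (sqrt b + 1) / 2"
        using uc norm_triangle_ineq[of "u c" 1] by (simp add: norm_divide)
      show "(u s + 1) / 2 \<noteq> 0 \<and> (u s + 1) / 2 \<noteq> 1" if "s \<in> ball c \<rho>" for s
      proof -
        have "(u s)\<^sup>2 \<noteq> 1" using u(2)[OF that] H(4)[OF that] by simp
        then have "u s \<noteq> 1" "u s \<noteq> -1" by auto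
        moreover have "u s = -1" if "(u s + 1) / 2 = 0" using that by (simp add: eq_neg_iff_add_eq_0)
        moreover have "u s = 1" if "(u s + 1) / 2 = 1"
        proof -
          have "u s + 1 = 1 + 1" using that by simp
          then show ?thesis by (rule add_right_imp_eq)
        qed
        ultimately show ?thesis by blast
      qed
    qed
    then have "norm (u z) \<le> 2 * K + 1"
      using norm_triangle_ineq4[of "u z + 1" 1] by (simp add: norm_divide)
    moreover have "z \<in> ball c \<rho>" using H(5,6) assms(2) by (simp add: le_less_trans[of _ "\<tau> * \<rho>"])
    ultimately show ?thesis using u(2)[of z] by (simp add: norm_power power_mono)
  qed
  moreover have "0 < (2 * K + 1)\<^sup>2" using K(1) by simp
  ultimately show thesis using that by blast
qed

text \<open>At most one of 0 and 1 is attained, and then evenly. If it is 0,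
  \<open>Schottky_even_aux\<close> applies to H; if it is 1, to 1 - H, whose value at the centre is
  bounded by b + 1 and whose square root is i * u.\<close>

lemma Schottky_even:
  assumes "0 < \<tau>" "\<tau> < 1" "0 \<le> b"
  obtains K where "0 < K" "\<And>H c \<rho> z. H holomorphic_on ball c \<rho> \<Longrightarrow> norm (H c) \<le> b \<Longrightarrow>
     0 \<notin> H ` ball c \<rho> \<or> even_at H (ball c \<rho>) 0 \<Longrightarrow> 1 \<notin> H ` ball c \<rho> \<or> even_at H (ball c \<rho>) 1 \<Longrightarrow>
     \<not> (0 \<in> H ` ball c \<rho> \<and> 1 \<in> H ` ball c \<rho>) \<Longrightarrow>
     dist c z \<le> \<tau> * \<rho> \<Longrightarrow> 0 < \<rho> \<Longrightarrow> norm (H z) \<le> K"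
proof -
  obtain K1 where K1: "0 < K1" "\<And>h c \<rho> z. h holomorphic_on ball c \<rho> \<Longrightarrow> norm (h c) \<le> b \<Longrightarrow>
     (\<And>z. z \<in> ball c \<rho> \<Longrightarrow> h z \<noteq> 0 \<and> h z \<noteq> 1) \<Longrightarrow> dist c z \<le> \<tau> * \<rho> \<Longrightarrow> 0 < \<rho> \<Longrightarrow> norm (h z) \<le> K1"
    using Schottky_ball[OF assms(1,2)] by metis
  obtain K2 where K2: "0 < K2" "\<And>H c \<rho> z. H holomorphic_on ball c \<rho> \<Longrightarrow> norm (H c) \<le> b + 1 \<Longrightarrow>
     even_at H (ball c \<rho>) 0 \<Longrightarrow> (\<And>s. s \<in> ball c \<rho> \<Longrightarrow> H s \<noteq> 1) \<Longrightarrow>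
     dist c z \<le> \<tau> * \<rho> \<Longrightarrow> 0 < \<rho> \<Longrightarrow> norm (H z) \<le> K2"
    using Schottky_even_aux[of \<tau> "b + 1"] assms by (metis add_nonneg_nonneg zero_le_one)
  have "norm (H z) \<le> K1 + K2 + 1" if H: "H holomorphic_on ball c \<rho>" "norm (H c) \<le> b"
     "0 \<notin> H ` ball c \<rho> \<or> even_at H (ball c \<rho>) 0" "1 \<notin> H ` ball c \<rho> \<or> even_at H (ball c \<rho>) 1"
     "\<not> (0 \<in> H ` ball c \<rho> \<and> 1 \<in> H ` ball c \<rho>)" "dist c z \<le> \<tau> * \<rho>" "0 < \<rho>" for H c \<rho> z
  proof -
    consider "0 \<notin> H ` ball c \<rho>" "1 \<notin> H ` ball c \<rho>" | "even_at H (ball c \<rho>) 0" "1 \<notin> H ` ball c \<rho>"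
      | "even_at H (ball c \<rho>) 1" "0 \<notin> H ` ball c \<rho>" using H by blast
    then show ?thesis
    proof cases
      case 1
      then have "norm (H z) \<le> K1" by (intro K1(2)[OF H(1,2) _ H(6,7)]) (metis imageI)
      then show ?thesis using K2(1) by linarith
    next
      case 2
      have "norm (H z) \<le> K2"
      proof (rule K2(2)[OF H(1) _ 2(1) _ H(6,7)])
        show "norm (H c) \<le> b + 1" using H(2) by simp
        show "H s \<noteq> 1" if "s \<in> ball c \<rho>" for s using 2(2) that by (metis imageI)
      qed
      then show ?thesis using K1(1) by linarith
    next
      case 3
      obtain u where u: "u holomorphic_on ball c \<rho>" "\<And>s. s \<in> ball c \<rho> \<Longrightarrow> H s - 1 = (u s)\<^sup>2"
        using 3 unfolding even_at_def by auto
      have "norm (1 - H z) \<le> K2"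
      proof (rule K2(2)[OF _ _ _ _ H(6,7)])
        show "(\<lambda>z. 1 - H z) holomorphic_on ball c \<rho>" using H(1) by (intro holomorphic_intros)
        show "norm (1 - H c) \<le> b + 1" using norm_triangle_ineq4[of 1 "H c"] H(2) by simp
        show "even_at (\<lambda>z. 1 - H z) (ball c \<rho>) 0" unfolding even_at_def
        proof (intro exI[of _ "\<lambda>s. \<i> * u s"] conjI ballI)
          show "(\<lambda>s. \<i> * u s) holomorphic_on ball c \<rho>" using u(1) by (intro holomorphic_intros)
          show "1 - H s - 0 = (\<i> * u s)\<^sup>2" if "s \<in> ball c \<rho>" for s
            using u(2)[OF that] by (simp add: power_mult_distrib algebra_simps)
        qed
        show "1 - H s \<noteq> 1" if "s \<in> ball c \<rho>" for s using 3(2) that by (metis add_cancel_left_right diff_eq_eq imageI)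
      qed
      then show ?thesis using norm_triangle_ineq4[of 1 "1 - H z"] K1(1) by simp
    qed
  qed
  moreover have "0 < K1 + K2 + 1" using K1 K2 by simp
  ultimately show thesis using that by blast
qed

lemma even_at_affine:
  assumes "even_at h D x" "d \<noteq> 0" shows "even_at (\<lambda>s. (h s - e) / d) D ((x - e) / d)"
proof -
  obtain u where u: "u holomorphic_on D" "\<And>s. s \<in> D \<Longrightarrow> h s - x = (u s)\<^sup>2"
    using assms unfolding even_at_def by auto
  show ?thesis unfolding even_at_def
  proof (intro exI[of _ "\<lambda>s. u s / csqrt d"] conjI ballI)
    show "(\<lambda>s. u s / csqrt d) holomorphic_on D" using u(1) assms(2) by (intro holomorphic_intros) auto
    fix s assume "s \<in> D"
    have "(h s - e) / d - (x - e) / d = (h s - x) / d" by (simp add: diff_divide_distrib)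
    then show "(h s - e) / d - (x - e) / d = (u s / csqrt d)\<^sup>2" using u(2)[OF \<open>s \<in> D\<close>] by (simp add: power_divide)
  qed
qed

section \<open>Preimages of large modulus and growth of lifts\<close>

locale transcendental_disc = postsingular_disc +
  assumes nonpoly: "\<not> (\<exists>p. \<forall>z. f z = poly p z)"
begin

text \<open>The preimage of the closed disc is connected. Were it to miss a circle that surrounds
  one of its points, it would be bounded, f would stay away from c near infinity, and f would be a
  polynomial.\<close>

lemma circle_meets:
  obtains t0 where "\<And>t. t0 \<le> t \<Longrightarrow> \<exists>z. norm z = t \<and> dist c (f z) \<le> R"
proof -
  have "\<exists>y. norm (f y - c) < R"
    using entire_omits_near_infinity[OF holf Rpos, of 0 c] nonpoly by (meson not_le)
  then obtain y where y: "dist c (f y) \<le> R" by (auto simp: dist_norm norm_minus_commute intro: less_imp_le)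
  show thesis
  proof (rule that[of "norm y + 1"])
    fix t assume t: "norm y + 1 \<le> t"
    show "\<exists>z. norm z = t \<and> dist c (f z) \<le> R"
    proof (rule ccontr)
      assume no: "\<not> ?thesis"
      have t0: "t > 0" using t norm_ge_zero[of y] by linarith
      have "f -` cball c R \<subseteq> ball 0 t"
      proof (rule ccontr)
        assume "\<not> f -` cball c R \<subseteq> ball 0 t"
        then have "f -` cball c R \<inter> frontier (ball 0 t) \<noteq> {}"
          by (intro connected_Int_frontier[OF connected_vimage_cball]) (use y t in auto)
        then show False using no t0 by (auto simp: frontier_ball)
      qed
      then have "R \<le> norm (f z - c)" if "t \<le> norm z" for z
      proof -
        have "z \<notin> f -` cball c R" using that \<open>f -` cball c R \<subseteq> ball 0 t\<close> by auto
        then show ?thesis by (simp add: dist_norm norm_minus_commute)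
      qed
      then show False using entire_omits_near_infinity[OF holf Rpos] nonpoly by blast
    qed
  qed
qed

text \<open>Otherwise, for arbitrarily large t, H omits 0 and 1 on every disc of radius t about a
  point of the circle of radius 2t. \<open>circle_meets\<close> supplies one point of this circle
  where H is bounded by \<open>k0\<close>, and a chain of Schottky estimates carries a bound
  independent of t to the whole circle; f would be a polynomial.\<close>

lemma annulus_preimage:
  assumes "a \<noteq> b"
  obtains t0 where "\<And>t. t0 \<le> t \<Longrightarrow> \<exists>x. t \<le> norm x \<and> norm x \<le> 4 * t \<and> f x \<in> {a, b}"
proof (rule ccontr)
  assume neg: "\<not> thesis"
  have no: "\<exists>t\<ge>B. \<forall>x. t \<le> norm x \<and> norm x \<le> 4 * t \<longrightarrow> f x \<notin> {a, b}" for B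
    using neg that[of B] by blast
  obtain T where T: "\<And>t. T \<le> t \<Longrightarrow> \<exists>z. norm z = t \<and> dist c (f z) \<le> R" using circle_meets by metis
  define H where "H z = (f z - a) / (b - a)" for z
  have holH: "H holomorphic_on A" for A
  proof -
    have "f holomorphic_on A" using holf holomorphic_on_subset by blast
    then show ?thesis unfolding H_def using assms by (intro holomorphic_intros) auto
  qed
  have "\<forall>b. \<exists>K. \<forall>h c \<rho> z. h holomorphic_on ball c \<rho> \<longrightarrow> norm (h c) \<le> b \<longrightarrow>
     (\<forall>z\<in>ball c \<rho>. h z \<noteq> 0 \<and> h z \<noteq> 1) \<longrightarrow> dist c z \<le> (1/2) * \<rho> \<longrightarrow> 0 < \<rho> \<longrightarrow> norm (h z) \<le> K"
    using Schottky_ball[of "1/2"] by (metis half_gt_zero_iff less_numeral_extra(1) field_sum_of_halves less_add_same_cancel1)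
  then obtain S where S: "\<And>b h c \<rho> z. h holomorphic_on ball c \<rho> \<Longrightarrow> norm (h c) \<le> b \<Longrightarrow>
     (\<forall>z\<in>ball c \<rho>. h z \<noteq> 0 \<and> h z \<noteq> 1) \<Longrightarrow> dist c z \<le> (1/2) * \<rho> \<Longrightarrow> 0 < \<rho> \<Longrightarrow> norm (h z) \<le> S b" by metis
  define k0 where "k0 = (R + norm c + norm a) / norm (b - a)"
  have "\<exists>t\<ge>B. \<forall>z. norm z = t \<longrightarrow> norm (f z) \<le> (norm a + norm (b - a) * (S ^^ 26) k0) * t" for B
  proof -
    obtain t where t: "t \<ge> max 1 (max T B)" "\<And>x. t \<le> norm x \<Longrightarrow> norm x \<le> 4 * t \<Longrightarrow> f x \<notin> {a, b}"
      using no by blast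
    have t': "1 \<le> t" "T \<le> 2 * t" "B \<le> 2 * t" using t(1) by auto
    have omit: "H z \<noteq> 0 \<and> H z \<noteq> 1" if "norm y = 2 * t" "z \<in> ball y t" for y z
    proof -
      have "norm (y - z) < t" using that(2) by (simp add: dist_norm)
      then have "t \<le> norm z" "norm z \<le> 4 * t"
        using that(1) norm_triangle_ineq2[of y z] norm_triangle_ineq3[of y z] t'(1) by linarith+
      then have "f z \<noteq> a" "f z \<noteq> b" using t(2) by auto
      then show ?thesis unfolding H_def using assms by auto
    qed
    obtain z1 where z1: "norm z1 = 2 * t" "dist c (f z1) \<le> R" using T[OF t'(2)] by blast
    have H1: "norm (H z1) \<le> k0"
    proof -
      have "norm (f z1 - a) \<le> R + norm c + norm a"
        using z1(2) norm_triangle_ineq4[of "f z1" a] norm_triangle_ineq2[of "f z1" c]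
        by (simp add: dist_norm norm_minus_commute)
      then show ?thesis unfolding H_def k0_def norm_divide by (intro divide_right_mono) auto
    qed
    have "norm (f z) \<le> (norm a + norm (b - a) * (S ^^ 26) k0) * (2 * t)" if z: "norm z = 2 * t" for z
    proof -
      define \<phi> where "\<phi> = Arg2pi (z / z1)"
      have z0: "z1 \<noteq> 0" "z \<noteq> 0" using z1 z t' by auto
      have \<phi>: "0 \<le> \<phi>" "\<phi> < 2 * pi" "z = z1 * exp (\<i> * of_real \<phi>)"
        using Arg2pi[of "z / z1"] z z1 z0 t' unfolding \<phi>_def is_Arg_def by (auto simp: norm_divide field_simps)
      define p where "p j = z1 * exp (\<i> * of_real (\<phi> * real j / 26))" for j
      have np: "norm (p j) = 2 * t" for j unfolding p_def using z1(1)
        by (simp add: norm_mult del: of_real_mult of_real_divide)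
      have dp: "dist (p j) (p (Suc j)) \<le> (1/2) * t" for j
      proof -
        have "p j - p (Suc j) = p j * (1 - exp (\<i> * of_real (\<phi> / 26)))"
          unfolding p_def by (simp add: algebra_simps exp_add[symmetric] add_divide_distrib)
        then have "dist (p j) (p (Suc j)) = 2 * t * norm (exp (\<i> * of_real (\<phi> / 26)) - 1)"
          unfolding dist_norm using np[of j] by (simp add: norm_mult norm_minus_commute del: of_real_divide)
        also have "\<dots> \<le> 2 * t * \<bar>\<phi> / 26\<bar>"
        proof (rule mult_left_mono)
          have "norm (exp (\<i> * of_real (\<phi> / 26)) - 1) = 2 * \<bar>sin (\<phi> / 26 / 2)\<bar>"
            using norm_exp_i_times dist_exp_i_1[of "\<phi> / 26"] by (simp add: )
          also have "\<dots> \<le> \<bar>\<phi> / 26\<bar>" using abs_sin_x_le_abs_x[of "\<phi> / 26 / 2"] by simp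
          finally show "norm (exp (\<i> * of_real (\<phi> / 26)) - 1) \<le> \<bar>\<phi> / 26\<bar>" .
        qed (use t' in auto)
        also have "\<dots> \<le> 2 * t * (1/4)"
          by (rule mult_left_mono) (use \<phi> t' pi_less_4 pi_approx in auto)
        finally show ?thesis by simp
      qed
      have "norm (H (p j)) \<le> (S ^^ j) k0" for j
      proof (induction j)
        case 0 then show ?case using H1 unfolding p_def by simp
      next
        case (Suc j)
        have "norm (H (p (Suc j))) \<le> S ((S ^^ j) k0)"
          by (rule S[OF holH Suc _ dp]) (use omit[OF np] t' in auto)
        then show ?case by simp
      qed
      from this[of 26] have Hz: "norm (H z) \<le> (S ^^ 26) k0" using \<phi>(3) unfolding p_def by simp
      have "f z = a + (b - a) * H z" unfolding H_def using assms by simp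
      then have "norm (f z) \<le> norm a + norm (b - a) * norm (H z)"
        by (metis norm_mult norm_triangle_ineq)
      also have "\<dots> \<le> (norm a + norm (b - a) * (S ^^ 26) k0) * 1" using Hz by (simp add: mult_left_mono)
      also have "\<dots> \<le> (norm a + norm (b - a) * (S ^^ 26) k0) * (2 * t)"
      proof (rule mult_left_mono)
        have "0 \<le> (S ^^ 26) k0" using Hz norm_ge_zero order_trans by blast
        then show "0 \<le> norm a + norm (b - a) * (S ^^ 26) k0" by simp
      qed (use t' in auto)
      finally show ?thesis .
    qed
    then show ?thesis using t'(3) by (intro exI[of _ "2 * t"]) auto
  qed
  then show False using entire_linear_growth_on_circles[OF holf] nonpoly by blast
qed

text \<open>Here h meets f^-1(P) in at most one point, and there evenly. Both a and a point x over a
  or b, of modulus comparable to 1 + |h s0|, lie in f^-1(P); so (h - a) / (x - a) falls under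
  \<open>Schottky_even\<close> with modulus at most 1 at s0. The size of x makes the bound linear in
  |h s0|.\<close>

lemma lift_bound:
  assumes "a \<in> P" "b \<in> P" "a \<noteq> b"
  obtains C where "0 < C" "\<And>h s0 s. h holomorphic_on ball 0 1 \<Longrightarrow>
     (\<And>x. f x \<in> P \<Longrightarrow> x \<in> h ` ball 0 1 \<Longrightarrow> even_at h (ball 0 1) x) \<Longrightarrow>
     (\<And>x y. f x \<in> P \<Longrightarrow> f y \<in> P \<Longrightarrow> x \<in> h ` ball 0 1 \<Longrightarrow> y \<in> h ` ball 0 1 \<Longrightarrow> x = y) \<Longrightarrow>
     norm s0 \<le> 1/8 \<Longrightarrow> norm s \<le> 5/8 \<Longrightarrow> norm (h s) \<le> C * (1 + norm (h s0))"
proof -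
  obtain T where T: "\<And>t. T \<le> t \<Longrightarrow> \<exists>x. t \<le> norm x \<and> norm x \<le> 4 * t \<and> f x \<in> {a, b}"
    using annulus_preimage[OF assms(3)] by metis
  \<comment> \<open>For |s0| <= 1/8 the disc of radius 7/8 about s0 stays in the unit disc, and |s -
    s0| <= 5/8 + 1/8 = 6/7 * 7/8.\<close>
  obtain K where K: "0 < K" "\<And>H c \<rho> z. H holomorphic_on ball c \<rho> \<Longrightarrow> norm (H c) \<le> 1 \<Longrightarrow>
     0 \<notin> H ` ball c \<rho> \<or> even_at H (ball c \<rho>) 0 \<Longrightarrow> 1 \<notin> H ` ball c \<rho> \<or> even_at H (ball c \<rho>) 1 \<Longrightarrow>
     \<not> (0 \<in> H ` ball c \<rho> \<and> 1 \<in> H ` ball c \<rho>) \<Longrightarrow>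
     dist c z \<le> (6/7) * \<rho> \<Longrightarrow> 0 < \<rho> \<Longrightarrow> norm (H z) \<le> K"
    by (rule Schottky_even[of "6/7" 1]) (simp, simp, simp, blast)
  \<comment> \<open>With |x| >= t = A + |h s0| this gives |x - a| >= |h s0| + |a| + 1, so x differs
    from a and |H s0| <= 1; the summand |T| puts t in the range of
    \<open>annulus_preimage\<close>.\<close>
  define A where "A = \<bar>T\<bar> + 2 * norm a + 1"
  define C where "C = norm a + K * (8 * A + norm a)"
  have C0: "0 < C" unfolding C_def A_def using K(1) by (intro add_nonneg_pos mult_pos_pos add_pos_nonneg) auto
  have "norm (h s) \<le> C * (1 + norm (h s0))" if h: "h holomorphic_on ball 0 1"
     "\<And>x. f x \<in> P \<Longrightarrow> x \<in> h ` ball 0 1 \<Longrightarrow> even_at h (ball 0 1) x"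
     "\<And>x y. f x \<in> P \<Longrightarrow> f y \<in> P \<Longrightarrow> x \<in> h ` ball 0 1 \<Longrightarrow> y \<in> h ` ball 0 1 \<Longrightarrow> x = y"
     "norm s0 \<le> 1/8" "norm s \<le> 5/8" for h s0 s
  proof -
    define t where "t = A + norm (h s0)"
    have "T \<le> t" unfolding t_def A_def using norm_ge_zero[of a] norm_ge_zero[of "h s0"] by linarith
    then obtain x where x: "t \<le> norm x" "norm x \<le> 4 * t" "f x \<in> P" using T assms by blast
    have a: "f a \<in> P" using assms(1) invP by blast
    have xa: "t - norm a \<le> norm (x - a)" "norm (x - a) \<le> 4 * t + norm a"
      using x norm_triangle_ineq2[of x a] norm_triangle_ineq4[of x a] by linarith+
    have pos: "0 < t - norm a" unfolding t_def A_def using norm_ge_zero[of a] norm_ge_zero[of "h s0"] by linarith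
    then have ne: "x \<noteq> a" using xa by auto
    define H where "H s = (h s - a) / (x - a)" for s
    have sub: "ball s0 (7/8) \<subseteq> ball (0::complex) 1"
      using h(4) by (auto simp: dist_norm) (smt (verit) norm_minus_commute norm_triangle_sub)
    have ev_sub: "even_at H (ball s0 (7/8)) y" if "even_at H (ball 0 1) y" for y
      using that sub holomorphic_on_subset unfolding even_at_def by blast
    have ev: "even_at H (ball s0 (7/8)) ((y - a) / (x - a))" if "f y \<in> P" "y \<in> h ` ball 0 1" for y
      using ev_sub even_at_affine[OF h(2)[OF that], of "x - a" a] ne unfolding H_def by auto
    have im0: "a \<in> h ` ball 0 1" if "0 \<in> H ` ball s0 (7/8)"
      using that sub ne unfolding H_def by (auto simp: image_iff)
    have im1: "x \<in> h ` ball 0 1" if "1 \<in> H ` ball s0 (7/8)"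
      using that sub ne unfolding H_def by (auto simp: image_iff eq_divide_eq)
    have "norm (H s) \<le> K"
    proof (rule K(2)[of H s0 "7/8" s])
      show "H holomorphic_on ball s0 (7/8)"
        using holomorphic_on_subset[OF h(1) sub] ne unfolding H_def by (intro holomorphic_intros) auto
      have "norm (h s0 - a) \<le> norm (x - a)"
        using xa(1) norm_triangle_ineq4[of "h s0" a] norm_ge_zero[of a] unfolding t_def A_def by linarith
      then show "norm (H s0) \<le> 1" unfolding H_def norm_divide using ne by simp
      show "0 \<notin> H ` ball s0 (7/8) \<or> even_at H (ball s0 (7/8)) 0" using ev[OF a] im0 by auto
      show "1 \<notin> H ` ball s0 (7/8) \<or> even_at H (ball s0 (7/8)) 1" using ev[OF x(3)] im1 ne by auto
      show "\<not> (0 \<in> H ` ball s0 (7/8) \<and> 1 \<in> H ` ball s0 (7/8))" using h(3)[OF a x(3)] im0 im1 ne by blast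
      show "dist s0 s \<le> (6/7) * (7/8)" using h(4,5) norm_triangle_ineq4[of s0 s] by (simp add: dist_norm)
    qed auto
    moreover have "h s = a + (x - a) * H s" unfolding H_def using ne by simp
    ultimately have "norm (h s) \<le> norm a + norm (x - a) * K"
      by (metis norm_ge_zero mult_left_mono norm_mult norm_triangle_mono order_refl)
    also have "\<dots> \<le> norm a + (4 * t + norm a) * K" using xa K(1) by (simp add: mult_right_mono)
    also have "\<dots> \<le> C * (1 + norm (h s0))"
    proof -
      have A1: "A \<ge> 1" unfolding A_def by simp
      have "4 * t + norm a \<le> (8 * A + norm a) * (1 + norm (h s0))"
      proof -
        have "4 * norm (h s0) \<le> 8 * A * norm (h s0)" using A1 by (intro mult_right_mono) auto
        moreover have "0 \<le> norm a * norm (h s0)" by simp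
        ultimately have "4 * t + norm a \<le> 8 * A + 8 * A * norm (h s0) + norm a + norm a * norm (h s0)"
          unfolding t_def distrib_left using A1 by linarith
        also have "\<dots> = (8 * A + norm a) * (1 + norm (h s0))" by (simp add: algebra_simps)
        finally show ?thesis .
      qed
      then have "(4 * t + norm a) * K \<le> K * (8 * A + norm a) * (1 + norm (h s0))"
        using K(1) by (simp add: mult.commute mult.left_commute mult_left_mono)
      moreover have "norm a \<le> norm a * (1 + norm (h s0))" by (simp add: algebra_simps)
      moreover have "C * (1 + norm (h s0)) = norm a * (1 + norm (h s0)) + K * (8 * A + norm a) * (1 + norm (h s0))"
        unfolding C_def by (rule distrib_right)
      ultimately show ?thesis by linarith
    qed
    finally show ?thesis .
  qed
  then show thesis using that C0 by blast
qed

end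

section \<open>Lifts near infinity and escaping points\<close>

text \<open>If P lies in {p}, every closed disc about p, however small, has connected preimage. For
  a small radius this preimage misses a circle around the zero y of f - p, so it lies inside that
  circle, and f stays away from p near infinity.\<close>

lemma singleton_postsingular_omitted:
  assumes holf: "f holomorphic_on UNIV" and nonpoly: "\<not> (\<exists>p. \<forall>z. f z = poly p z)"
    and P: "closed P" "singular_values f \<subseteq> P" "f ` P \<subseteq> P" "P \<subseteq> {p}" and y: "f y = p"
  shows False
proof -
  have conn: "connected (f -` cball p \<epsilon>)" if "\<epsilon> > 0" for \<epsilon>
  proof -
    interpret postsingular_disc f P p \<epsilon>
      by unfold_locales (use holf P that in auto)
    show ?thesis by (rule connected_vimage_cball)
  qed
  define g where "g z = f z - p" for z
  have holg: "g holomorphic_on UNIV" unfolding g_def using holf by (intro holomorphic_intros)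
  have "\<exists>\<beta>. g \<beta> \<noteq> 0"
  proof (rule ccontr)
    assume "\<not> ?thesis"
    then have "\<forall>z. f z = poly [:p:] z" unfolding g_def by simp
    then show False using nonpoly by blast
  qed
  then obtain \<beta> where \<beta>: "g \<beta> \<noteq> 0" by blast
  obtain r where r: "0 < r" "\<And>z. z \<in> ball y r - {y} \<Longrightarrow> g z \<noteq> 0"
    using isolated_zeros[OF holg open_UNIV connected_UNIV UNIV_I _ UNIV_I \<beta>, of y] y unfolding g_def by auto
  define S where "S = sphere y (r/2)"
  have S: "compact S" "S \<noteq> {}" unfolding S_def using r by auto
  have "continuous_on S (\<lambda>z. norm (g z))"
    using holg holomorphic_on_imp_continuous_on continuous_on_subset by (intro continuous_on_norm) blast
  then obtain z0 where z0: "z0 \<in> S" "\<And>z. z \<in> S \<Longrightarrow> norm (g z0) \<le> norm (g z)"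
    using continuous_attains_inf[OF S] by blast
  define \<epsilon> where "\<epsilon> = norm (g z0) / 2"
  have "g z0 \<noteq> 0" using r z0(1) unfolding S_def by auto
  then have \<epsilon>: "\<epsilon> > 0" unfolding \<epsilon>_def by simp
  have \<epsilon>2: "\<epsilon> < norm (f z - p)" if "z \<in> S" for z
  proof -
    have "\<epsilon> < norm (g z0)" using \<epsilon> unfolding \<epsilon>_def by simp
    also have "\<dots> \<le> norm (g z)" by (rule z0(2)[OF that])
    finally show ?thesis unfolding g_def .
  qed
  have "f -` cball p \<epsilon> \<subseteq> ball y (r/2)"
  proof (rule ccontr)
    assume "\<not> f -` cball p \<epsilon> \<subseteq> ball y (r/2)"
    moreover have "y \<in> f -` cball p \<epsilon> \<inter> ball y (r/2)" using y r \<epsilon> by simp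
    ultimately have "f -` cball p \<epsilon> \<inter> frontier (ball y (r/2)) \<noteq> {}"
      using connected_Int_frontier[OF conn[OF \<epsilon>], of "ball y (r/2)"] by blast
    then obtain z where "z \<in> f -` cball p \<epsilon>" "z \<in> S" using r unfolding S_def by force
    then have "z \<in> S" "dist p (f z) \<le> \<epsilon>" by simp_all
    then show False using \<epsilon>2[of z] by (simp add: dist_norm norm_minus_commute)
  qed
  have "\<epsilon> \<le> norm (f z - p)" if "norm y + r \<le> norm z" for z
  proof -
    have "dist y z \<ge> r" using that norm_triangle_ineq2[of z y] by (simp add: dist_norm norm_minus_commute)
    then have "z \<notin> f -` cball p \<epsilon>" using \<open>f -` cball p \<epsilon> \<subseteq> ball y (r/2)\<close> r by auto
    then show ?thesis by (simp add: dist_norm norm_minus_commute)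
  qed
  then show False using entire_omits_near_infinity[OF holf \<epsilon>] nonpoly by blast
qed

text \<open>If P is empty, any value of f can play the role of p in
  \<open>singleton_postsingular_omitted\<close>; if P = {p}, invariance makes p a fixed point, so p
  is a value of f.\<close>

lemma postsingular_two_points:
  assumes holf: "f holomorphic_on UNIV" and nonpoly: "\<not> (\<exists>p. \<forall>z. f z = poly p z)"
    and P: "closed P" "singular_values f \<subseteq> P" "f ` P \<subseteq> P"
  obtains a b where "a \<in> P" "b \<in> P" "a \<noteq> b"
proof (rule ccontr)
  assume neg: "\<not> thesis"
  have one: "x = y" if "x \<in> P" "y \<in> P" for x y using neg that(1,2) \<open>\<And>b a. \<lbrakk>a \<in> P; b \<in> P; a \<noteq> b\<rbrakk> \<Longrightarrow> thesis\<close> by blast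
  show False
  proof (cases "P = {}")
    case True
    then show ?thesis using singleton_postsingular_omitted[OF holf nonpoly P, of "f 0" 0] by auto
  next
    case False
    then obtain p where "p \<in> P" by blast
    then have "P \<subseteq> {p}" "f p = p" using one P(3) by auto
    then show ?thesis using singleton_postsingular_omitted[OF holf nonpoly P, of p p] by auto
  qed
qed

text \<open>The disc is centred at 0 from here on. The preimages of a and b are the points that the
  lifts omit or attain evenly in the Schottky estimates.\<close>

locale postsingular_pair = transcendental_disc f P 0 R for f P R +
  fixes a b :: complex
  assumes a: "a \<in> P" and b: "b \<in> P" and ab: "a \<noteq> b"
begin

lemma norm_P: "x \<in> P \<Longrightarrow> norm x < R"
  using Pball by auto

lemma lift_lipschitz:
  obtains C where "0 < C" "\<And>h s0 s s'. h holomorphic_on ball 0 1 \<Longrightarrow>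
     (\<And>x. f x \<in> P \<Longrightarrow> x \<in> h ` ball 0 1 \<Longrightarrow> even_at h (ball 0 1) x) \<Longrightarrow>
     (\<And>x y. f x \<in> P \<Longrightarrow> f y \<in> P \<Longrightarrow> x \<in> h ` ball 0 1 \<Longrightarrow> y \<in> h ` ball 0 1 \<Longrightarrow> x = y) \<Longrightarrow>
     norm s0 \<le> 1/8 \<Longrightarrow> norm s \<le> 1/2 \<Longrightarrow> norm s' \<le> 1/2 \<Longrightarrow>
     norm (h s) \<le> C * (1 + norm (h s0)) \<and> norm (deriv h s) \<le> C * (1 + norm (h s0)) \<and>
     norm (h s - h s') \<le> C * (1 + norm (h s0)) * norm (s - s')"
proof -
  obtain C where C: "0 < C" "\<And>h s0 s. h holomorphic_on ball 0 1 \<Longrightarrow>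
     (\<And>x. f x \<in> P \<Longrightarrow> x \<in> h ` ball 0 1 \<Longrightarrow> even_at h (ball 0 1) x) \<Longrightarrow>
     (\<And>x y. f x \<in> P \<Longrightarrow> f y \<in> P \<Longrightarrow> x \<in> h ` ball 0 1 \<Longrightarrow> y \<in> h ` ball 0 1 \<Longrightarrow> x = y) \<Longrightarrow>
     norm s0 \<le> 1/8 \<Longrightarrow> norm s \<le> 5/8 \<Longrightarrow> norm (h s) \<le> C * (1 + norm (h s0))"
    by (rule lift_bound[OF a b ab]) blast
  show thesis
  \<comment> \<open>\<open>lift_bound\<close> reaches radius 5/8, which leaves discs of radius 1/8
    for Cauchy's inequality at points of modulus at most 1/2.\<close>
  proof (rule that[of "8 * C"])
    show "0 < 8 * C" using C by simp
    fix h :: "complex \<Rightarrow> complex" and s0 s s' :: complex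
    assume h: "h holomorphic_on ball (0::complex) 1"
     "\<And>x. f x \<in> P \<Longrightarrow> x \<in> h ` ball 0 1 \<Longrightarrow> even_at h (ball 0 1) x"
     "\<And>x y. f x \<in> P \<Longrightarrow> f y \<in> P \<Longrightarrow> x \<in> h ` ball 0 1 \<Longrightarrow> y \<in> h ` ball 0 1 \<Longrightarrow> x = y"
     and s: "norm s0 \<le> 1/8" "norm s \<le> 1/2" "norm s' \<le> 1/2"
    define B where "B = C * (1 + norm (h s0))"
    have B: "norm (h z) \<le> B" if "norm z \<le> 5/8" for z
      unfolding B_def by (rule C(2)[OF h s(1) that])
    have "0 \<le> B" using C(1) unfolding B_def by simp
    have d: "norm (deriv h z) \<le> 8 * B" if "norm z \<le> 1/2" for z
    proof -
      have sub: "cball z (1/8) \<subseteq> cball 0 (5/8)"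
      proof
        fix x assume "x \<in> cball z (1/8)"
        then show "x \<in> cball 0 (5/8)" using that norm_triangle_ineq2[of x z] by (simp add: dist_norm norm_minus_commute)
      qed
      have sub2: "cball 0 (5/8) \<subseteq> ball (0::complex) 1" by auto
      have "norm ((deriv ^^ 1) h z) \<le> fact 1 * B / (1/8) ^ 1"
      proof (rule Cauchy_inequality)
        show "h holomorphic_on ball z (1/8)" using h(1) sub sub2 ball_subset_cball holomorphic_on_subset by (metis subset_trans)
        show "continuous_on (cball z (1/8)) h"
          using h(1) sub sub2 holomorphic_on_imp_continuous_on continuous_on_subset by (metis subset_trans)
        show "norm (h x) \<le> B" if "norm (z - x) = 1/8" for x
          using B[of x] sub that by (auto simp: subset_iff dist_norm)
      qed simp
      then show ?thesis by simp
    qed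
    have "norm (h s - h s') \<le> 8 * B * norm (s - s')"
    proof (rule field_differentiable_bound[of "cball 0 (1/2)" h "deriv h"])
      show "(h has_field_derivative deriv h z) (at z within cball 0 (1/2))" if "z \<in> cball 0 (1/2)" for z
        using holomorphic_derivI[OF h(1) open_ball, of z] that has_field_derivative_at_within by auto
    qed (use d s in auto)
    then show "norm (h s) \<le> 8 * C * (1 + norm (h s0)) \<and> norm (deriv h s) \<le> 8 * C * (1 + norm (h s0)) \<and>
     norm (h s - h s') \<le> 8 * C * (1 + norm (h s0)) * norm (s - s')"
      using B[of s] d[OF s(2)] s \<open>0 \<le> B\<close> unfolding B_def by (auto simp: mult.assoc)
  qed
qed

lemma iter_lift:
  assumes "open U" "simply_connected U" "h holomorphic_on U"
    "\<And>x. x \<in> U \<Longrightarrow> h x \<notin> P" "z \<in> U" "h z = (f ^^ n) y"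
  obtains g where "g holomorphic_on U" "g z = y" "\<And>x. x \<in> U \<Longrightarrow> (f ^^ n) (g x) = h x"
  using assms(3,4,6)
proof (induction n arbitrary: h thesis)
  case 0
  then show ?case by (auto simp: assms(5))
next
  case (Suc n)
  obtain h1 where h1: "h1 holomorphic_on U" "h1 z = (f ^^ n) y" "\<And>x. x \<in> U \<Longrightarrow> f (h1 x) = h x"
    using lift_hol[OF assms(1,2) Suc.prems(2,3) assms(5), of "(f ^^ n) y"] Suc.prems(4) by auto
  have "h1 x \<notin> P" if "x \<in> U" for x using h1(3)[OF that] Suc.prems(3)[OF that] invP by auto
  then obtain g where g: "g holomorphic_on U" "g z = y" "\<And>x. x \<in> U \<Longrightarrow> (f ^^ n) (g x) = h1 x"
    using Suc.IH[OF _ h1(1) _ h1(2)] by metis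
  show ?case by (rule Suc.prems(1)[OF g(1,2)]) (use g(3) h1(3) in auto)
qed

lemma iter_not_P: "(f ^^ n) z \<notin> P \<Longrightarrow> m \<le> n \<Longrightarrow> (f ^^ m) z \<notin> P"
  using funpow_P[of "(f ^^ m) z" "n - m"] by (metis comp_apply funpow_add le_add_diff_inverse2)

lemma deriv_funpow_Suc: "deriv (f ^^ Suc n) z = deriv f ((f ^^ n) z) * deriv (f ^^ n) z"
proof -
  have "deriv (f \<circ> (f ^^ n)) z = deriv f ((f ^^ n) z) * deriv (f ^^ n) z"
    by (rule deriv_chain)
       (use holf hol_funpow in \<open>auto intro!: holomorphic_on_imp_differentiable_at[OF _ open_UNIV]\<close>)
  then show ?thesis by (simp add: o_def)
qed

lemma deriv_funpow_nz: "(f ^^ n) z \<notin> P \<Longrightarrow> deriv (f ^^ n) z \<noteq> 0"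
proof (induction n)
  case 0
  have "deriv (f ^^ 0) z = 1" by (simp add: id_def)
  then show ?case by simp
next
  case (Suc n)
  have "(f ^^ n) z \<notin> P" using iter_not_P[OF Suc.prems] by simp
  moreover have "deriv f ((f ^^ n) z) \<noteq> 0" using deriv_nz[of "(f ^^ n) z"] Suc.prems by auto
  ultimately show ?case using Suc.IH unfolding deriv_funpow_Suc by simp
qed

text \<open>For lifts of discs that avoid P, the hypotheses of \<open>lift_lipschitz\<close> about
  f^-1(P) hold vacuously.\<close>

lemma plain_lift_image:
  assumes "\<And>s. s \<in> D \<Longrightarrow> (f ^^ n) (h s) \<notin> P" "1 \<le> n" "f x \<in> P" shows "x \<notin> h ` D"
  using assms iter_not_P by (metis funpow_0 funpow_Suc_right image_iff o_apply One_nat_def funpow.simps(2))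

text \<open>The disc s -> f u * exp (rho s) with rho = ln (|f u| / R) stays outside the ball of
  radius R, and v is its value at a point of modulus at most 8 / rho. The lift through u has
  Lipschitz constant comparable to |u|, so for large |f u| a preimage of v is found at a small
  fraction of |u| from u.\<close>

lemma far_preimages:
  obtains T where "\<And>u v. T \<le> norm (f u) \<Longrightarrow> 1 \<le> norm u \<Longrightarrow> norm (f u) / 2 \<le> norm v \<Longrightarrow>
    norm v \<le> 2 * norm (f u) \<Longrightarrow> \<exists>u'. norm (u' - u) \<le> norm u / 2 \<and> f u' = v"
proof -
  obtain C where C: "0 < C" "\<And>h s0 s s'. h holomorphic_on ball 0 1 \<Longrightarrow>
     (\<And>x. f x \<in> P \<Longrightarrow> x \<in> h ` ball 0 1 \<Longrightarrow> even_at h (ball 0 1) x) \<Longrightarrow>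
     (\<And>x y. f x \<in> P \<Longrightarrow> f y \<in> P \<Longrightarrow> x \<in> h ` ball 0 1 \<Longrightarrow> y \<in> h ` ball 0 1 \<Longrightarrow> x = y) \<Longrightarrow>
     norm s0 \<le> 1/8 \<Longrightarrow> norm s \<le> 1/2 \<Longrightarrow> norm s' \<le> 1/2 \<Longrightarrow>
     norm (h s) \<le> C * (1 + norm (h s0)) \<and> norm (deriv h s) \<le> C * (1 + norm (h s0)) \<and>
     norm (h s - h s') \<le> C * (1 + norm (h s0)) * norm (s - s')"
    by (rule lift_lipschitz) blast
  \<comment> \<open>16 gives 8 / \<open>\<rho>\<close> <= 1/2, and 32 * C gives the displacement |u|
    / 2; the 8 is 1 + pi, generously rounded up.\<close>
  define L where "L = 16 + 32 * C"
  show thesis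
  proof (rule that[of "R * exp L"])
    fix u v :: complex assume fu: "R * exp L \<le> norm (f u)" and u: "1 \<le> norm u"
      and v: "norm (f u) / 2 \<le> norm v" "norm v \<le> 2 * norm (f u)"
    have fu0: "0 < norm (f u)" using fu Rpos by (meson exp_gt_zero less_le_trans mult_pos_pos)
    have v0: "v \<noteq> 0" "f u \<noteq> 0" using v fu0 by auto
    define \<rho> where "\<rho> = ln (norm (f u)) - ln R"
    have "ln (R * exp L) \<le> ln (norm (f u))" using fu fu0 Rpos by (subst ln_le_cancel_iff) auto
    then have \<rho>: "L \<le> \<rho>" unfolding \<rho>_def using Rpos by (simp add: ln_mult)
    have \<rho>0: "16 \<le> \<rho>" "32 * C \<le> \<rho>" using \<rho> C(1) unfolding L_def by auto
    define h where "h s = f u * exp (of_real \<rho> * s)" for s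
    have nP: "h s \<notin> P" if "s \<in> ball 0 1" for s
    proof
      assume "h s \<in> P"
      then have "norm (h s) < R" by (rule norm_P)
      moreover have "norm (h s) = norm (f u) * exp (\<rho> * Re s)" unfolding h_def by (simp add: norm_mult)
      moreover have "- 1 < Re s" using that abs_Re_le_cmod[of s] by auto
      then have "- \<rho> < \<rho> * Re s" using \<rho>0 mult_strict_left_mono[of "-1" "Re s" \<rho>] by simp
      then have "norm (f u) * exp (- \<rho>) < norm (f u) * exp (\<rho> * Re s)" using fu0 by simp
      moreover have "norm (f u) * exp (- \<rho>) = R" unfolding \<rho>_def using fu0 Rpos
        by (simp add: exp_diff)
      ultimately show False by simp
    qed
    have "h holomorphic_on ball 0 1" unfolding h_def by (intro holomorphic_intros)
    then obtain g where g: "g holomorphic_on ball 0 1" "g 0 = u" "\<And>s. s \<in> ball 0 1 \<Longrightarrow> f (g s) = h s"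
      using lift_hol[OF open_ball convex_imp_simply_connected[OF convex_ball], of h 0 1 0 u] nP
      unfolding h_def by auto
    have om: "x \<notin> g ` ball 0 1" if "f x \<in> P" for x using g(3) nP that by auto
    define s where "s = Ln (v / f u) / of_real \<rho>"
    have "norm (Ln (v / f u)) \<le> 8"
    proof -
      have "norm (v / f u) \<le> 2" "1/2 \<le> norm (v / f u)" using v fu0 by (auto simp: norm_divide field_simps)
      then have "ln (norm (v / f u)) \<le> ln 2" "ln (1/2) \<le> ln (norm (v / f u))"
        using v0 by (auto intro!: ln_mono simp del: ln_div)
      then have "\<bar>ln (norm (v / f u))\<bar> \<le> 1" using ln_2_less_1 by (auto simp: ln_div abs_le_iff)
      moreover have "norm (Ln (v / f u)) \<le> \<bar>ln (norm (v / f u))\<bar> + \<bar>Im (Ln (v / f u))\<bar>"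
        using cmod_le[of "Ln (v / f u)"] v0 by simp
      moreover have "\<bar>Im (Ln (v / f u))\<bar> \<le> pi" using Im_Ln_le_pi[of "v / f u"] mpi_less_Im_Ln[of "v / f u"] v0 by auto
      ultimately show ?thesis using pi_less_4 by linarith
    qed
    then have ns: "norm s \<le> 8 / \<rho>" unfolding s_def using \<rho>0 by (simp add: norm_divide divide_right_mono)
    also have "\<dots> \<le> 1/2" using \<rho>0 by (simp add: field_simps)
    finally have ns2: "norm s \<le> 1/2" .
    have "norm (g s - g 0) \<le> C * (1 + norm (g 0)) * norm (s - 0)"
      using C(2)[OF g(1), of 0 s 0] om ns2 by auto
    also have "\<dots> \<le> C * (1 + norm u) * (8 / \<rho>)"
      unfolding g(2) diff_zero using ns C(1) by (intro mult_left_mono) auto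
    also have "\<dots> \<le> C * (2 * norm u) * (8 / \<rho>)"
      using u C(1) \<rho>0 by (intro mult_right_mono mult_left_mono) auto
    also have "\<dots> \<le> norm u / 2"
    proof -
      have "32 * C * norm u \<le> \<rho> * norm u" using \<rho>0 by (intro mult_right_mono) auto
      then show ?thesis using \<rho>0 by (simp add: field_simps)
    qed
    finally have "norm (g s - u) \<le> norm u / 2" using g(2) by simp
    moreover have "f (g s) = v"
    proof -
      have "s \<in> ball 0 1" using ns2 by simp
      then have "f (g s) = f u * exp (of_real \<rho> * s)" using g(3) unfolding h_def by simp
      also have "of_real \<rho> * s = Ln (v / f u)" unfolding s_def using \<rho>0 by simp
      finally show ?thesis using v0 by simp
    qed
    ultimately show "\<exists>u'. norm (u' - u) \<le> norm u / 2 \<and> f u' = v" by blast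
  qed
qed

text \<open>The points u k do not form an orbit: only the moduli satisfy |u (k + 1)| = |f (u k)|.
  But by \<open>far_preimages\<close> each point of the disc Q (k + 1) has a preimage in Q k, so the
  nested compact sets N n of points that follow Q 0, ..., Q n are nonempty. A common point escapes
  since |u k| >= 2^k.\<close>

lemma escaping_set_nonempty: "escaping_set f \<noteq> {}"
proof -
  obtain T where T: "\<And>u v. T \<le> norm (f u) \<Longrightarrow> 1 \<le> norm u \<Longrightarrow> norm (f u) / 2 \<le> norm v \<Longrightarrow>
    norm v \<le> 2 * norm (f u) \<Longrightarrow> \<exists>u'. norm (u' - u) \<le> norm u / 2 \<and> f u' = v"
    using far_preimages by metis
  obtain B where B: "\<And>t. B \<le> t \<Longrightarrow> \<exists>z. norm z = t \<and> norm (f z) > 2 * t"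
    using entire_linear_growth_on_circles[OF holf, of 2] nonpoly by (meson not_le)
  define t0 where "t0 = max (max B T) 1"
  have "\<exists>u. \<forall>k. (t0 \<le> norm (u k) \<and> norm (f (u k)) > 2 * norm (u k)) \<and> norm (u (Suc k)) = norm (f (u k))"
  proof (rule dependent_nat_choice)
    have "B \<le> t0" unfolding t0_def by simp
    then obtain x where "norm x = t0" "2 * t0 < norm (f x)" using B by blast
    then show "\<exists>x. t0 \<le> norm x \<and> norm (f x) > 2 * norm x" by (intro exI[of _ x]) simp
    fix x :: complex and n :: nat assume x: "t0 \<le> norm x \<and> norm (f x) > 2 * norm x"
    then have *: "t0 \<le> norm (f x)" unfolding t0_def by auto
    then obtain y where "norm y = norm (f x)" "norm (f y) > 2 * norm (f x)" using B[of "norm (f x)"] unfolding t0_def by auto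
    then show "\<exists>y. (t0 \<le> norm y \<and> 2 * norm y < norm (f y)) \<and> norm y = norm (f x)"
      using * by (intro exI[of _ y]) simp
  qed
  then obtain u where u: "\<And>k. t0 \<le> norm (u k)" "\<And>k. norm (f (u k)) > 2 * norm (u k)"
    "\<And>k. norm (u (Suc k)) = norm (f (u k))" by blast
  have u1: "1 \<le> norm (u k)" "T \<le> norm (f (u k))" for k
    using u(1)[of k] u(1)[of "Suc k"] u(3)[of k] unfolding t0_def by auto
  have grow: "2 ^ k \<le> norm (u k)" for k
  proof (induction k)
    case (Suc k) then show ?case using u(2)[of k] u(3)[of k] by simp
  qed (use u1 in auto)
  define Q where "Q k = cball (u k) (norm (u k) / 2)" for k
  have Qn: "norm (u k) / 2 \<le> norm v" "norm v \<le> 2 * norm (u k)" if "v \<in> Q k" for k v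
    using that norm_triangle_ineq2[of "u k" v] norm_triangle_ineq2[of v "u k"] unfolding Q_def
    by (auto simp: dist_norm norm_minus_commute)
  have bwd: "\<exists>v'\<in>Q k. f v' = v" if "v \<in> Q (Suc k)" for k v
    using T[OF u1(2,1), of k v] Qn[OF that] u(3)[of k] unfolding Q_def by (auto simp: dist_norm norm_minus_commute)
  have reach: "\<exists>z. (f ^^ n) z = v \<and> (\<forall>j\<le>n. (f ^^ j) z \<in> Q j)" if "v \<in> Q n" for n v
    using that
  proof (induction n arbitrary: v)
    case 0 then show ?case by auto
  next
    case (Suc n)
    then obtain v' where v': "v' \<in> Q n" "f v' = v" using bwd by blast
    then obtain z where z: "(f ^^ n) z = v'" "\<forall>j\<le>n. (f ^^ j) z \<in> Q j" using Suc.IH by blast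
    have "(f ^^ Suc n) z = v" using z v' by simp
    moreover from this have "\<forall>j\<le>Suc n. (f ^^ j) z \<in> Q j" using z(2) Suc.prems by (auto simp: le_Suc_eq)
    ultimately show ?case by blast
  qed
  define N where "N n = {z. \<forall>j\<le>n. (f ^^ j) z \<in> Q j}" for n
  have "\<Inter> (range N) \<noteq> {}"
  proof (rule compact_nest)
    show "N n \<noteq> {}" for n using reach[of "u n" n] unfolding N_def Q_def by auto
    show "N n \<subseteq> N m" if "m \<le> n" for m n using that unfolding N_def by auto
    show "compact (N n)" for n
    proof -
      have "closed (\<Inter>j\<le>n. (f ^^ j) -` Q j)"
        by (intro closed_INT ballI continuous_closed_vimage)
           (use cont_funpow[of UNIV] in \<open>auto simp: Q_def continuous_on_eq_continuous_at\<close>)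
      moreover have "N n = (\<Inter>j\<le>n. (f ^^ j) -` Q j)" unfolding N_def by auto
      moreover have "N n \<subseteq> Q 0" unfolding N_def by auto
      ultimately show ?thesis unfolding Q_def
        by (metis bounded_subset bounded_cball compact_eq_bounded_closed)
    qed
  qed
  then obtain z where z: "\<And>n. z \<in> N n" by blast
  have "(f ^^ n) z \<in> Q n" for n using z[of n] unfolding N_def by auto
  then have ge: "2 ^ n / 2 \<le> norm ((f ^^ n) z)" for n
    using Qn(1)[of "(f ^^ n) z" n] grow[of n] by (meson divide_right_mono order_trans zero_le_numeral)
  have "filterlim (\<lambda>n. norm ((f ^^ n) z)) at_top sequentially"
  proof (rule filterlim_at_top_mono)
    show "filterlim (\<lambda>n::nat. 2 ^ n / 2 :: real) at_top sequentially" by real_asymp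
  qed (use ge in auto)
  then have "z \<in> escaping_set f" unfolding escaping_set_def
    by (simp add: filterlim_norm_at_top_imp_at_infinity)
  then show ?thesis by blast
qed

section \<open>The unbounded component of the complement of P\<close>

definition Om where "Om = connected_component_set (- P) (of_real R)"

lemma Om_open: "open Om"
  unfolding Om_def using closedP by (simp add: open_connected_component open_Compl)

lemma Om_connected: "connected Om"
  unfolding Om_def by simp

lemma Om_P: "Om \<inter> P = {}"
  unfolding Om_def using connected_component_subset by blast

lemma Om_far: "R \<le> norm z \<Longrightarrow> z \<in> Om"
proof -
  assume z: "R \<le> norm z"
  have "connected (- ball (0::complex) R)"
    by (rule connected_complement_bounded_convex) auto
  moreover have "- ball 0 R \<subseteq> - P" using Pball by auto
  moreover have "complex_of_real R \<in> - ball 0 R" "z \<in> - ball 0 R" using z Rpos by auto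
  ultimately show "z \<in> Om" unfolding Om_def using connected_component_maximal by blast
qed

lemma Om_ball: "x \<in> ball w r \<Longrightarrow> x \<in> Om \<Longrightarrow> ball w r \<inter> P = {} \<Longrightarrow> ball w r \<subseteq> Om"
  unfolding Om_def
  by (metis connected_ball connected_component_eq connected_component_maximal disjoint_eq_subset_Compl mem_Collect_eq)

end

section \<open>Limits of inverse branches of iterates\<close>

context postsingular_pair begin

lemma hurwitz_solve:
  fixes g :: "complex \<Rightarrow> complex" and y :: complex
  assumes "0 < \<epsilon>" "continuous_on (cball x \<epsilon>) g" "g holomorphic_on ball x \<epsilon>"
    "\<And>x'. dist x x' = \<epsilon> \<Longrightarrow> norm (g x - y) < norm (g x' - y)"
  obtains x' where "x' \<in> ball x \<epsilon>" "g x' = y"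
proof -
  obtain z where "z \<in> ball x \<epsilon>" "g z - y = 0"
  proof (rule holomorphic_contract_to_zero[of x \<epsilon> "\<lambda>z. g z - y"])
    show "continuous_on (cball x \<epsilon>) (\<lambda>z. g z - y)" by (intro continuous_intros assms)
    show "(\<lambda>z. g z - y) holomorphic_on ball x \<epsilon>" by (intro holomorphic_intros assms)
  qed (use assms in \<open>auto simp: dist_norm\<close>)
  then show thesis using that by auto
qed

text \<open>A nonconstant limit of injective branches is injective. For large k < l both branches
  are close to \<open>\<phi>\<close>, so \<open>\<psi> k x\<close> is also a value
  \<open>\<psi> l x'\<close> with x' near x; applying f^(n l) shows that f^(n l - n k) takes x to
  x'.\<close>

lemma return_times:
  assumes r: "0 < r"
    and n: "strict_mono n" and hol: "\<And>k. \<psi> k holomorphic_on ball w r"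
    and br: "\<And>k x. x \<in> ball w r \<Longrightarrow> (f ^^ n k) (\<psi> k x) = x"
    and hol\<psi>: "\<phi> holomorphic_on ball w r"
    and lim: "\<And>K. compact K \<Longrightarrow> K \<subseteq> ball w r \<Longrightarrow> uniform_limit K \<psi> \<phi> sequentially"
    and nc: "\<not> \<phi> constant_on ball w r"
  obtains m where "\<And>j. j \<le> m j" "uniform_limit (cball w (r/4)) (\<lambda>j. f ^^ m j) (\<lambda>x. x) sequentially"
proof -
  have inj: "inj_on \<phi> (ball w r)"
  proof (rule Hurwitz_injective[OF open_ball connected_ball hol hol\<psi> lim nc])
    show "inj_on (\<psi> k) (ball w r)" for k using br by (metis inj_on_inverseI)
  qed
  have step: "\<exists>K0. \<forall>k\<ge>K0. \<forall>l>k. \<forall>x\<in>cball w (r/4). dist ((f ^^ (n l - n k)) x) x < \<epsilon>" if \<epsilon>: "0 < \<epsilon>" "\<epsilon> < r/4" for \<epsilon>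
  proof -
    \<comment> \<open>Compactness of A turns the injectivity of \<open>\<phi>\<close> into a uniform
      separation \<open>\<mu>\<close> of the values at points exactly \<open>\<epsilon>\<close>
      apart.\<close>
    define A where "A = {(x, x'). x \<in> cball w (r/4) \<and> dist x x' = \<epsilon>}"
    have A_sub: "A \<subseteq> cball w (r/4) \<times> cball w (r/2)"
    proof
      fix p assume p: "p \<in> A"
      obtain x x' where "p = (x, x')" by force
      then have *: "dist w x \<le> r/4" "dist x x' = \<epsilon>" using p unfolding A_def by auto
      then have "dist w x' \<le> r/2" using dist_triangle[of w x' x] \<epsilon> by linarith
      then show "p \<in> cball w (r/4) \<times> cball w (r/2)" using * \<open>p = _\<close> by auto
    qed
    have "closed A"
    proof -
      have "A = (cball w (r/4) \<times> UNIV) \<inter> {p. dist (fst p) (snd p) = \<epsilon>}" unfolding A_def by auto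
      moreover have "closed {p::complex \<times> complex. dist (fst p) (snd p) = \<epsilon>}"
        by (intro closed_Collect_eq continuous_intros)
      ultimately show ?thesis by (auto intro: closed_Int closed_Times)
    qed
    then have "compact ((cball w (r/4) \<times> cball w (r/2)) \<inter> A)"
      by (intro compact_Int_closed compact_Times compact_cball)
    then have "compact A" using A_sub by (simp add: Int_absorb1)
    have "(w, w + of_real \<epsilon>) \<in> A" unfolding A_def using \<epsilon> r by (auto simp: dist_norm)
    then have "A \<noteq> {}" by blast
    have sub: "cball w (r/2) \<subseteq> ball w r" using r by auto
    have c\<phi>: "continuous_on (cball w (r/2)) \<phi>"
      using hol\<psi> sub holomorphic_on_imp_continuous_on continuous_on_subset by blast
    have "continuous_on A (\<lambda>p. norm (\<phi> (snd p) - \<phi> (fst p)))"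
      by (intro continuous_intros continuous_on_compose2[OF c\<phi>]) (use A_sub r in auto)
    then obtain p0 where p0: "p0 \<in> A" "\<And>p. p \<in> A \<Longrightarrow> norm (\<phi> (snd p0) - \<phi> (fst p0)) \<le> norm (\<phi> (snd p) - \<phi> (fst p))"
      using continuous_attains_inf[OF \<open>compact A\<close> \<open>A \<noteq> {}\<close>] by blast
    define \<mu> where "\<mu> = norm (\<phi> (snd p0) - \<phi> (fst p0))"
    have "\<mu> > 0"
    proof -
      have "fst p0 \<in> ball w r" "snd p0 \<in> ball w r" using p0(1) A_sub sub r by force+
      moreover have "fst p0 \<noteq> snd p0" using p0(1) \<epsilon> unfolding A_def by auto
      ultimately show ?thesis unfolding \<mu>_def using inj by (metis inj_onD right_minus_eq zero_less_norm_iff)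
    qed
    then have "\<forall>\<^sub>F k in sequentially. \<forall>x\<in>cball w (r/2). dist (\<psi> k x) (\<phi> x) < \<mu> / 5"
      by (intro uniform_limitD[OF lim[OF compact_cball sub]]) simp
    then obtain K0 where K0: "\<And>k x. K0 \<le> k \<Longrightarrow> x \<in> cball w (r/2) \<Longrightarrow> norm (\<psi> k x - \<phi> x) < \<mu> / 5"
      unfolding eventually_sequentially dist_norm by blast
    show ?thesis
    proof (intro exI[of _ K0] allI impI ballI)
      fix k l x assume k: "K0 \<le> k" "k < l" and x: "x \<in> cball w (r/4)"
      have x2: "x \<in> cball w (r/2)" using x r by auto
      have inb: "cball x \<epsilon> \<subseteq> cball w (r/2)"
      proof
        fix y assume "y \<in> cball x \<epsilon>"
        then show "y \<in> cball w (r/2)" using x \<epsilon> dist_triangle[of w y x] by auto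
      qed
      obtain x' where x': "x' \<in> ball x \<epsilon>" "\<psi> l x' = \<psi> k x"
      proof (rule hurwitz_solve[of \<epsilon> x "\<psi> l" "\<psi> k x", OF \<epsilon>(1)])
        show "continuous_on (cball x \<epsilon>) (\<psi> l)"
          using hol inb sub holomorphic_on_imp_continuous_on continuous_on_subset by (metis subset_trans)
        show "\<psi> l holomorphic_on ball x \<epsilon>"
          using hol inb sub holomorphic_on_subset ball_subset_cball by (metis subset_trans)
        \<comment> \<open>Each branch is within \<open>\<mu>\<close> / 5 of \<open>\<phi>\<close>,
          so the left side is below 2/5 of \<open>\<mu>\<close> and the right side above 3/5 of
          it.\<close>
        show "norm (\<psi> l x - \<psi> k x) < norm (\<psi> l x' - \<psi> k x)" if d: "dist x x' = \<epsilon>" for x'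
        proof -
          have "(x, x') \<in> A" using x d unfolding A_def by auto
          then have 1: "\<mu> \<le> norm (\<phi> x' - \<phi> x)" using p0(2) unfolding \<mu>_def by fastforce
          have "x' \<in> cball w (r/2)" using inb d by auto
          then have 2: "norm (\<psi> l x' - \<phi> x') < \<mu> / 5" "norm (\<psi> l x - \<phi> x) < \<mu> / 5" "norm (\<psi> k x - \<phi> x) < \<mu> / 5"
            using K0 k x2 by auto
          have "norm (\<psi> l x - \<psi> k x) \<le> norm (\<psi> l x - \<phi> x) + norm (\<psi> k x - \<phi> x)"
            using norm_triangle_ineq4[of "\<psi> l x - \<phi> x" "\<psi> k x - \<phi> x"] by simp
          moreover have "norm (\<phi> x' - \<phi> x) \<le> norm (\<psi> l x' - \<psi> k x) + norm (\<psi> l x' - \<phi> x') + norm (\<psi> k x - \<phi> x)"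
            using norm_triangle_ineq4[of "\<psi> l x' - \<psi> k x + (\<psi> k x - \<phi> x)" "\<psi> l x' - \<phi> x'"]
              norm_triangle_ineq[of "\<psi> l x' - \<psi> k x" "\<psi> k x - \<phi> x"] by simp
          ultimately show ?thesis using 1 2 \<open>\<mu> > 0\<close> by linarith
        qed
      qed blast
      have x'r: "x' \<in> ball w r" "x \<in> ball w r" using x'(1) inb sub x2 ball_subset_cball by blast+
      have "n l = (n l - n k) + n k" using strict_monoD[OF n k(2)] by simp
      then have "(f ^^ n l) (\<psi> k x) = (f ^^ (n l - n k)) ((f ^^ n k) (\<psi> k x))"
        by (metis funpow_add comp_apply)
      also have "\<dots> = (f ^^ (n l - n k)) x" using br x'r by simp
      finally have "(f ^^ (n l - n k)) x = x'" using br[OF x'r(1), of l] x'(2) by simp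
      then show "dist ((f ^^ (n l - n k)) x) x < \<epsilon>" using x'(1) by (simp add: dist_commute)
    qed
  qed
  have "\<exists>K0. \<forall>k\<ge>K0. \<forall>l>k. \<forall>x\<in>cball w (r/4). dist ((f ^^ (n l - n k)) x) x < r / (8 * (1 + real j))" for j
    by (rule step) (use r in \<open>auto simp: field_simps intro: add_pos_nonneg\<close>)
  then obtain K where K: "\<And>j k l x. K j \<le> k \<Longrightarrow> k < l \<Longrightarrow> x \<in> cball w (r/4) \<Longrightarrow>
      dist ((f ^^ (n l - n k)) x) x < r / (8 * (1 + real j))" by metis
  define m where "m j = n (K j + Suc j) - n (K j)" for j
  have "j \<le> m j" for j
  proof -
    have "n (k + i) \<ge> n k + i" for k i
    proof (induction i)
      case (Suc i) then show ?case using strict_monoD[OF n, of "k + i" "k + Suc i"] by simp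
    qed simp
    from this[of "K j" "Suc j"] show ?thesis unfolding m_def by simp
  qed
  moreover have "uniform_limit (cball w (r/4)) (\<lambda>j. f ^^ m j) (\<lambda>x. x) sequentially"
  proof (rule uniform_limitI)
    fix e :: real assume "e > 0"
    have "((\<lambda>j. r / (8 * (1 + real j))) \<longlonglongrightarrow> 0)" by real_asymp
    then have "\<forall>\<^sub>F j in sequentially. r / (8 * (1 + real j)) < e" using \<open>e > 0\<close> order_tendstoD(2) by blast
    then show "\<forall>\<^sub>F j in sequentially. \<forall>x\<in>cball w (r/4). dist ((f ^^ m j) x) x < e"
    proof eventually_elim
      case (elim j)
      have "dist ((f ^^ m j) x) x < r / (8 * (1 + real j))" if "x \<in> cball w (r/4)" for x
        unfolding m_def by (rule K[OF order_refl _ that]) simp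
      then show ?case using elim less_trans by blast
    qed
  qed
  ultimately show thesis using that by blast
qed

definition near_id where "near_id m x \<longleftrightarrow> (\<exists>\<delta>>0. uniform_limit (ball x \<delta>) (\<lambda>j. f ^^ m j) (\<lambda>x. x) sequentially)"

text \<open>Branches of f^(m j) on the disc about \<open>\<zeta>\<close> that undo f^(m j) near x
  are bounded by \<open>lift_lipschitz\<close>. Their limits are the identity near x, hence on the
  whole disc, and inverting them gives the convergence of the iterates. The size of the disc depends
  on the distance from \<open>\<zeta>\<close> to P and not on the neighbourhood supplied at x, so
  \<open>near_id\<close> is a closed condition in \<open>Om\<close>.\<close>

lemma near_id_extend:
  assumes m: "\<And>j::nat. j \<le> m j" and x: "near_id m x" and \<rho>: "ball \<zeta> \<rho> \<inter> P = {}" "0 < \<rho>" "dist \<zeta> x < \<rho> / 32"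
  shows "near_id m \<zeta>"
proof -
  obtain \<delta>0 where \<delta>0: "0 < \<delta>0" "uniform_limit (ball x \<delta>0) (\<lambda>j. f ^^ m j) (\<lambda>x. x) sequentially"
    using x unfolding near_id_def by blast
  \<comment> \<open>Three errors below \<open>\<rho>\<close> / 32 (from \<open>\<zeta>\<close> to x,
    from x to y, from y to its iterate) add up to less than \<open>\<rho>\<close> / 8, which after
    rescaling is the bound 1/8 on s0 in \<open>lift_lipschitz\<close>.\<close>
  define \<delta> where "\<delta> = min \<delta>0 (\<rho> / 32)"
  have \<delta>: "0 < \<delta>" "\<delta> \<le> \<rho> / 32" unfolding \<delta>_def using \<delta>0 \<rho> by auto
  have ul: "uniform_limit (ball x \<delta>) (\<lambda>j. f ^^ m j) (\<lambda>x. x) sequentially"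
    by (rule uniform_limit_on_subset[OF \<delta>0(2)]) (auto simp: \<delta>_def)
  have "\<forall>\<^sub>F j in sequentially. \<forall>y\<in>ball x \<delta>. dist ((f ^^ m j) y) y < \<rho> / 32"
    by (rule uniform_limitD[OF ul]) (use \<rho> in simp)
  moreover have "\<forall>\<^sub>F j in sequentially. 1 \<le> m j"
    using eventually_ge_at_top[of "1::nat"] by eventually_elim (use m order_trans in blast)
  ultimately have "\<forall>\<^sub>F j in sequentially. 1 \<le> m j \<and> (\<forall>y\<in>ball x \<delta>. dist \<zeta> ((f ^^ m j) y) < \<rho> / 8)"
  proof eventually_elim
    case (elim j)
    have "dist \<zeta> ((f ^^ m j) y) < \<rho> / 8" if "y \<in> ball x \<delta>" for y
    proof -
      have "dist ((f ^^ m j) y) y < \<rho> / 32" using elim that by blast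
      moreover have "dist x y < \<rho> / 32" using that \<delta>(2) by auto
      ultimately show ?thesis
        using \<rho>(2,3) dist_triangle[of \<zeta> "(f ^^ m j) y" y] dist_triangle[of \<zeta> y x] by (simp add: dist_commute)
    qed
    then show ?case using elim by auto
  qed
  then obtain J0 where J0: "\<And>j. J0 \<le> j \<Longrightarrow> 1 \<le> m j"
    "\<And>j y. J0 \<le> j \<Longrightarrow> y \<in> ball x \<delta> \<Longrightarrow> dist \<zeta> ((f ^^ m j) y) < \<rho> / 8"
    unfolding eventually_sequentially by blast
  have b8: "v \<in> ball \<zeta> \<rho>" if "dist \<zeta> v < \<rho> / 8" for v using that \<rho>(2) by simp
  have nP: "v \<notin> P" if "v \<in> ball \<zeta> \<rho>" for v using that \<rho>(1) by blast
  have xb: "x \<in> ball x \<delta>" using \<delta> by simp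
  have "\<exists>g. J0 \<le> j \<longrightarrow> g holomorphic_on ball \<zeta> \<rho> \<and> g ((f ^^ m j) x) = x \<and> (\<forall>y\<in>ball \<zeta> \<rho>. (f ^^ m j) (g y) = y)" for j
  proof (cases "J0 \<le> j")
    case True
    obtain g where "g holomorphic_on ball \<zeta> \<rho>" "g ((f ^^ m j) x) = x" "\<And>y. y \<in> ball \<zeta> \<rho> \<Longrightarrow> (f ^^ m j) (g y) = y"
      using iter_lift[OF open_ball convex_imp_simply_connected[OF convex_ball] holomorphic_on_ident nP b8[OF J0(2)[OF True xb]] refl]
      by metis
    then show ?thesis by blast
  qed auto
  then obtain \<phi> where \<phi>: "\<And>j. J0 \<le> j \<Longrightarrow> \<phi> j holomorphic_on ball \<zeta> \<rho>"
    "\<And>j. J0 \<le> j \<Longrightarrow> \<phi> j ((f ^^ m j) x) = x"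
    "\<And>j y. J0 \<le> j \<Longrightarrow> y \<in> ball \<zeta> \<rho> \<Longrightarrow> (f ^^ m j) (\<phi> j y) = y" by metis
  have \<phi>inv: "\<phi> j ((f ^^ m j) y) = y" if j: "J0 \<le> j" and y: "y \<in> ball x \<delta>" for j y
  proof (rule lift_unique[where f="f ^^ m j" and U="ball x \<delta>" and g="\<lambda>y. \<phi> j ((f ^^ m j) y)" and h="\<lambda>y. y" and ?x0.0=x and x=y, OF hol_funpow])
    show "continuous_on (ball x \<delta>) (\<lambda>y. \<phi> j ((f ^^ m j) y))"
      by (rule continuous_on_compose2[OF holomorphic_on_imp_continuous_on[OF \<phi>(1)[OF j]] cont_funpow])
         (use b8 J0(2)[OF j] in blast)
    show "(f ^^ m j) (\<phi> j ((f ^^ m j) y)) = (f ^^ m j) y" if "y \<in> ball x \<delta>" for y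
      using \<phi>(3)[OF j b8[OF J0(2)[OF j that]]] .
    show "deriv (f ^^ m j) (\<phi> j ((f ^^ m j) y)) \<noteq> 0" if "y \<in> ball x \<delta>" for y
      by (rule deriv_funpow_nz) (use \<phi>(3)[OF j b8[OF J0(2)[OF j that]]] nP[OF b8[OF J0(2)[OF j that]]] in simp)
  qed (use \<phi>(2)[OF j] y xb in auto)
  obtain C where C: "0 < C" "\<And>h s0 s s'. h holomorphic_on ball 0 1 \<Longrightarrow>
     (\<And>x. f x \<in> P \<Longrightarrow> x \<in> h ` ball 0 1 \<Longrightarrow> even_at h (ball 0 1) x) \<Longrightarrow>
     (\<And>x y. f x \<in> P \<Longrightarrow> f y \<in> P \<Longrightarrow> x \<in> h ` ball 0 1 \<Longrightarrow> y \<in> h ` ball 0 1 \<Longrightarrow> x = y) \<Longrightarrow>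
     norm s0 \<le> 1/8 \<Longrightarrow> norm s \<le> 1/2 \<Longrightarrow> norm s' \<le> 1/2 \<Longrightarrow>
     norm (h s) \<le> C * (1 + norm (h s0)) \<and> norm (deriv h s) \<le> C * (1 + norm (h s0)) \<and>
     norm (h s - h s') \<le> C * (1 + norm (h s0)) * norm (s - s')"
    by (rule lift_lipschitz) blast
  define B where "B = C * (1 + norm x)"
  have \<phi>B: "norm (\<phi> j y) \<le> B" if j: "J0 \<le> j" and y: "y \<in> ball \<zeta> (\<rho>/2)" for j y
  proof -
    define h where "h s = \<phi> j (\<zeta> + of_real \<rho> * s)" for s
    have inb: "\<zeta> + of_real \<rho> * s \<in> ball \<zeta> \<rho>" if "s \<in> ball 0 1" for s
      using that \<rho>(2) by (simp add: dist_norm norm_mult)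
    have holh: "h holomorphic_on ball 0 1" unfolding h_def
      by (rule holomorphic_on_compose_gen[OF _ \<phi>(1)[OF j], unfolded o_def])
         (use inb in \<open>auto intro!: holomorphic_intros\<close>)
    have "(f ^^ m j) (h s) \<notin> P" if "s \<in> ball 0 1" for s
      unfolding h_def using \<phi>(3)[OF j inb[OF that]] nP[OF inb[OF that]] by simp
    then have om: "v \<notin> h ` ball 0 1" if "f v \<in> P" for v
      using plain_lift_image[of "ball 0 1" "m j" h v] J0(1)[OF j] that by blast
    define s0 where "s0 = ((f ^^ m j) x - \<zeta>) / of_real \<rho>"
    define s where "s = (y - \<zeta>) / of_real \<rho>"
    have "norm s0 \<le> 1/8" unfolding s0_def using J0(2)[OF j xb] \<rho>(2)
      by (simp add: norm_divide dist_norm norm_minus_commute field_simps)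
    moreover have "norm s \<le> 1/2" unfolding s_def using y \<rho>(2)
      by (simp add: norm_divide dist_norm norm_minus_commute field_simps)
    ultimately have "norm (h s) \<le> C * (1 + norm (h s0))"
      using C(2)[OF holh, of s0 s s] om by blast
    moreover have "h s0 = x" "h s = \<phi> j y" unfolding h_def s0_def s_def using \<rho>(2) \<phi>(2)[OF j] by auto
    ultimately show ?thesis unfolding B_def by simp
  qed
  have sub: "ball x \<delta> \<subseteq> ball \<zeta> (\<rho>/4)"
  proof
    fix y assume "y \<in> ball x \<delta>"
    then show "y \<in> ball \<zeta> (\<rho>/4)" using \<rho>(2,3) \<delta>(2) dist_triangle[of \<zeta> y x] by auto
  qed
  \<comment> \<open>A subsequence that stays away from the identity would have a limit g by Montel's
    theorem; but g fixes the points near x, because there the branches undo iterates that tend to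
    the identity.\<close>
  have conv: "\<exists>J\<ge>J0. \<forall>j\<ge>J. \<forall>y\<in>cball \<zeta> (\<rho>/4). dist (\<phi> j y) y < \<epsilon>" if \<epsilon>: "0 < \<epsilon>" for \<epsilon>
  proof (rule ccontr)
    assume neg: "\<not> ?thesis"
    have "\<exists>j. J0 \<le> j \<and> i \<le> j \<and> (\<exists>y\<in>cball \<zeta> (\<rho>/4). \<epsilon> \<le> dist (\<phi> j y) y)" for i
      using neg[simplified, rule_format, of "max J0 i"] by (auto simp: not_less)
    then obtain r where r: "\<And>i. J0 \<le> r i" "\<And>i. i \<le> r i" "\<And>i. \<exists>y\<in>cball \<zeta> (\<rho>/4). \<epsilon> \<le> dist (\<phi> (r i) y) y" by metis
    define \<H> where "\<H> = {h. h holomorphic_on ball \<zeta> (\<rho>/2) \<and> (\<forall>y\<in>ball \<zeta> (\<rho>/2). norm (h y) \<le> B)}"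
    have sub2: "ball \<zeta> (\<rho>/2) \<subseteq> ball \<zeta> \<rho>" using \<rho>(2) by auto
    have rng: "range (\<lambda>i. \<phi> (r i)) \<subseteq> \<H>"
      unfolding \<H>_def using \<phi>(1)[OF r(1)] \<phi>B[OF r(1)] sub2 holomorphic_on_subset by blast
    obtain g r' where g: "g holomorphic_on ball \<zeta> (\<rho>/2)" "strict_mono (r' :: nat \<Rightarrow> nat)"
      "\<And>K. compact K \<Longrightarrow> K \<subseteq> ball \<zeta> (\<rho>/2) \<Longrightarrow> uniform_limit K ((\<lambda>i. \<phi> (r i)) \<circ> r') g sequentially"
    proof (rule Montel[of "ball \<zeta> (\<rho>/2)" \<H> "\<lambda>i. \<phi> (r i)"])
      show "\<exists>B. \<forall>h\<in>\<H>. \<forall>z\<in>K. norm (h z) \<le> B" if "compact K" "K \<subseteq> ball \<zeta> (\<rho>/2)" for K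
        using that(2) unfolding \<H>_def by blast
    qed (use rng in \<open>auto simp: \<H>_def\<close>)
    define q where "q i = r (r' i)" for i
    have qi: "i \<le> q i" "J0 \<le> q i" for i
      unfolding q_def using r(1,2) seq_suble[OF g(2), of i] order_trans by blast+
    have cb: "cball \<zeta> (\<rho>/4) \<subseteq> ball \<zeta> (\<rho>/2)" using \<rho>(2) by auto
    have ug: "uniform_limit (cball \<zeta> (\<rho>/4)) (\<lambda>i. \<phi> (q i)) g sequentially"
      using g(3)[OF compact_cball cb] unfolding q_def o_def .
    have qlim: "filterlim q at_top sequentially"
      by (rule filterlim_at_top_mono[OF filterlim_ident]) (use qi in auto)
    have gid: "g y = y" if y: "y \<in> ball x \<delta>" for y
    proof (rule ccontr)
      assume "g y \<noteq> y"
      define e where "e = dist (g y) y / 3"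
      have e: "e > 0" unfolding e_def using \<open>g y \<noteq> y\<close> by simp
      have lim_y: "(\<lambda>i. (f ^^ m (q i)) y) \<longlonglongrightarrow> y"
        by (rule filterlim_compose[OF tendsto_uniform_limitI[OF ul y] qlim])
      have "isCont g y"
        using holomorphic_on_imp_continuous_on[OF g(1)] y sub cb ball_subset_cball
        by (metis continuous_on_eq_continuous_at open_ball subsetD)
      then have "(\<lambda>i. g ((f ^^ m (q i)) y)) \<longlonglongrightarrow> g y"
        by (rule isCont_tendsto_compose[OF _ lim_y])
      then have 1: "\<forall>\<^sub>F i in sequentially. dist (g ((f ^^ m (q i)) y)) (g y) < e" using e tendstoD by blast
      have 2: "\<forall>\<^sub>F i in sequentially. \<forall>v\<in>cball \<zeta> (\<rho>/4). dist (\<phi> (q i) v) (g v) < e" by (rule uniform_limitD[OF ug e])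
      have "\<forall>\<^sub>F i::nat in sequentially. False" using 1 2
      proof eventually_elim
        case (elim i)
        have "dist \<zeta> ((f ^^ m (q i)) y) < \<rho> / 8" by (rule J0(2)[OF qi(2) y])
        then have "(f ^^ m (q i)) y \<in> cball \<zeta> (\<rho>/4)" using \<rho>(2) by simp
        then have "dist (\<phi> (q i) ((f ^^ m (q i)) y)) (g ((f ^^ m (q i)) y)) < e" using elim by blast
        then have "dist y (g ((f ^^ m (q i)) y)) < e" using \<phi>inv[OF qi(2) y] by simp
        then have "dist (g y) y < 2 * e" using elim(1) dist_triangle[of "g y" y "g ((f ^^ m (q i)) y)"]
          by (simp add: dist_commute)
        then show False unfolding e_def using \<open>g y \<noteq> y\<close> by simp
      qed
      then show False by simp
    qed
    have sub3: "ball x \<delta> \<subseteq> ball \<zeta> (\<rho>/2)" using sub cb ball_subset_cball by blast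
    have gid2: "g y = y" if "y \<in> ball \<zeta> (\<rho>/2)" for y
      by (rule analytic_continuation_open[of "ball x \<delta>" "ball \<zeta> (\<rho>/2)" g "\<lambda>y. y" y])
         (use sub3 g(1) gid that \<delta>(1) in \<open>simp_all del: mem_ball\<close>)
    have "\<forall>\<^sub>F i in sequentially. \<forall>v\<in>cball \<zeta> (\<rho>/4). dist (\<phi> (q i) v) (g v) < \<epsilon>" by (rule uniform_limitD[OF ug \<epsilon>])
    then obtain i where i: "\<forall>v\<in>cball \<zeta> (\<rho>/4). dist (\<phi> (q i) v) (g v) < \<epsilon>"
      unfolding eventually_sequentially by blast
    obtain v where v: "v \<in> cball \<zeta> (\<rho>/4)" "\<epsilon> \<le> dist (\<phi> (q i) v) v" using r(3)[of "r' i"] unfolding q_def by blast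
    have "g v = v" using gid2 v(1) cb by blast
    then show False using i v by fastforce
  qed
  have "uniform_limit (ball \<zeta> (\<rho>/8)) (\<lambda>j. f ^^ m j) (\<lambda>x. x) sequentially"
  proof (rule uniform_limitI)
    fix e :: real assume "e > 0"
    define \<epsilon> where "\<epsilon> = min e (\<rho>/8)"
    have \<epsilon>: "0 < \<epsilon>" unfolding \<epsilon>_def using \<open>e > 0\<close> \<rho>(2) by simp
    then obtain J where J: "J0 \<le> J" "\<And>j y. J \<le> j \<Longrightarrow> y \<in> cball \<zeta> (\<rho>/4) \<Longrightarrow> dist (\<phi> j y) y < \<epsilon>/3"
      using conv[of "\<epsilon>/3"] by auto
    have "dist ((f ^^ m j) y) y < e" if j: "J \<le> j" and y: "y \<in> ball \<zeta> (\<rho>/8)" for j y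
    proof -
      have j0: "J0 \<le> j" using J(1) j by simp
      have inb: "cball y \<epsilon> \<subseteq> cball \<zeta> (\<rho>/4)"
      proof
        fix v assume "v \<in> cball y \<epsilon>"
        then show "v \<in> cball \<zeta> (\<rho>/4)" using y dist_triangle[of \<zeta> v y] unfolding \<epsilon>_def by auto
      qed
      have cb: "cball \<zeta> (\<rho>/4) \<subseteq> ball \<zeta> \<rho>" using \<rho>(2) by auto
      obtain y' where y': "y' \<in> ball y \<epsilon>" "\<phi> j y' = y"
      proof (rule hurwitz_solve[of \<epsilon> y "\<phi> j" y, OF \<epsilon>])
        show "continuous_on (cball y \<epsilon>) (\<phi> j)"
          using \<phi>(1)[OF j0] inb cb holomorphic_on_imp_continuous_on continuous_on_subset by (metis subset_trans)
        show "\<phi> j holomorphic_on ball y \<epsilon>"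
          using \<phi>(1)[OF j0] inb cb holomorphic_on_subset ball_subset_cball by (metis subset_trans)
        show "norm (\<phi> j y - y) < norm (\<phi> j x' - y)" if d: "dist y x' = \<epsilon>" for x'
        proof -
          have "dist (\<phi> j y) y < \<epsilon>/3" "dist (\<phi> j x') x' < \<epsilon>/3"
            using J(2)[OF j] inb d \<epsilon> by (auto simp: subset_iff)
          then show ?thesis using d \<epsilon> dist_triangle[of y x' "\<phi> j x'"] unfolding dist_norm[symmetric] by (simp add: dist_commute)
        qed
      qed blast
      have "y' \<in> ball \<zeta> \<rho>" using y'(1) inb cb ball_subset_cball by blast
      then have "(f ^^ m j) y = y'" using \<phi>(3)[OF j0, of y'] y'(2) by simp
      then show ?thesis using y'(1) unfolding \<epsilon>_def by (simp add: dist_commute)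
    qed
    then show "\<forall>\<^sub>F j in sequentially. \<forall>x\<in>ball \<zeta> (\<rho>/8). dist ((f ^^ m j) x) x < e"
      unfolding eventually_sequentially by blast
  qed
  then show ?thesis unfolding near_id_def using \<rho>(2) by (intro exI[of _ "\<rho>/8"]) simp
qed

text \<open>A nonconstant limit yields iterates of \<open>f\<close> tending to the identity near \<open>w\<close>; this spreads over
  \<open>Om\<close>, which contains points that \<open>f\<close> maps into \<open>P\<close>.\<close>

lemma no_rotation:
  assumes w: "w \<in> Om" "0 < r" "ball w r \<inter> P = {}"
    and n: "strict_mono n" and hol: "\<And>k. \<psi> k holomorphic_on ball w r"
    and br: "\<And>k x. x \<in> ball w r \<Longrightarrow> (f ^^ n k) (\<psi> k x) = x"
    and hol\<psi>: "\<phi> holomorphic_on ball w r"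
    and lim: "\<And>K. compact K \<Longrightarrow> K \<subseteq> ball w r \<Longrightarrow> uniform_limit K \<psi> \<phi> sequentially"
  shows "\<phi> constant_on ball w r"
proof (rule ccontr)
  assume nc: "\<not> \<phi> constant_on ball w r"
  obtain m where m: "\<And>j. j \<le> m j" "uniform_limit (cball w (r/4)) (\<lambda>j. f ^^ m j) (\<lambda>x. x) sequentially"
    using return_times[OF w(2) n hol br hol\<psi> lim nc] by metis
  define O' where "O' = {x \<in> Om. near_id m x}"
  have wO: "w \<in> O'" unfolding O'_def near_id_def
    using w(1,2) by (auto intro!: exI[of _ "r/4"] uniform_limit_on_subset[OF m(2)])
  have "open O'"
  proof (rule openI)
    fix x assume x: "x \<in> O'"
    then obtain \<delta> where \<delta>: "\<delta> > 0" "uniform_limit (ball x \<delta>) (\<lambda>j. f ^^ m j) (\<lambda>x. x) sequentially"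
      unfolding O'_def near_id_def by blast
    obtain \<eta> where \<eta>: "\<eta> > 0" "ball x \<eta> \<subseteq> Om" using Om_open x unfolding O'_def open_contains_ball by auto
    have "y \<in> O'" if y: "y \<in> ball x (min \<eta> (\<delta>/2))" for y
    proof -
      have "ball y (\<delta>/2) \<subseteq> ball x \<delta>"
      proof
        fix v assume "v \<in> ball y (\<delta>/2)"
        then show "v \<in> ball x \<delta>" using y dist_triangle[of x v y] by auto
      qed
      then have "near_id m y" unfolding near_id_def using \<delta> uniform_limit_on_subset by (metis half_gt_zero)
      then show ?thesis using y \<eta>(2) unfolding O'_def by auto
    qed
    then show "\<exists>e>0. ball x e \<subseteq> O'"
      using \<delta>(1) \<eta>(1) by (intro exI[of _ "min \<eta> (\<delta>/2)"]) auto
  qed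
  moreover have "open (Om - O')"
  proof (rule openI)
    fix \<zeta> assume z: "\<zeta> \<in> Om - O'"
    then obtain \<rho> where \<rho>: "\<rho> > 0" "ball \<zeta> \<rho> \<inter> P = {}" using ball_off_P Om_P by blast
    have sub: "ball \<zeta> (\<rho>/32) \<subseteq> Om" using Om_ball[of \<zeta> \<zeta> \<rho>] \<rho> z by auto
    have "x \<notin> O'" if "x \<in> ball \<zeta> (\<rho>/32)" for x
      using near_id_extend[OF m(1) _ \<rho>(2,1), of x] that z unfolding O'_def by auto
    then show "\<exists>e>0. ball \<zeta> e \<subseteq> Om - O'"
      using \<rho>(1) sub by (intro exI[of _ "\<rho>/32"]) auto
  qed
  ultimately have "Om - O' = {}"
    using connectedD[OF Om_connected, of O' "Om - O'"] wO unfolding O'_def by blast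
  obtain t0 where t0: "\<And>t. t0 \<le> t \<Longrightarrow> \<exists>x. t \<le> norm x \<and> norm x \<le> 4 * t \<and> f x \<in> {a, b}"
    using annulus_preimage[OF ab] by metis
  \<comment> \<open>This x lies outside the disc while f x lies in P, so every later iterate of x is
    inside the disc and cannot return to x.\<close>
  obtain x where x: "max t0 (R + 1) \<le> norm x" "f x \<in> P" using t0[of "max t0 (R + 1)"] a b by auto
  have "x \<in> Om" using x(1) Om_far by simp
  then have "near_id m x" using \<open>Om - O' = {}\<close> unfolding O'_def by blast
  then have lim_x: "(\<lambda>j. (f ^^ m j) x) \<longlonglongrightarrow> x"
    unfolding near_id_def by (metis centre_in_ball tendsto_uniform_limitI)
  have "norm x \<le> R"
  proof (rule LIMSEQ_le_const2[OF tendsto_norm[OF lim_x]], intro exI[of _ 1] allI impI)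
    fix j :: nat assume "1 \<le> j"
    then have "1 \<le> m j" using m(1) order_trans by blast
    then have "(f ^^ m j) x = (f ^^ (m j - 1)) (f x)" by (metis Suc_pred' funpow_Suc_right comp_apply less_eq_Suc_le One_nat_def)
    then show "norm ((f ^^ m j) x) \<le> R" using funpow_P[OF x(2)] norm_P by (metis less_imp_le)
  qed
  then show False using x(1) by simp
qed

end

section \<open>Orbifold discs\<close>

lemma holomorphic_root:
  assumes "g holomorphic_on ball z r" "\<And>w. w \<in> ball z r \<Longrightarrow> g w \<noteq> 0" "0 < n"
  obtains q where "q holomorphic_on ball z r" "\<And>w. w \<in> ball z r \<Longrightarrow> q w ^ n = g w" "\<And>w. w \<in> ball z r \<Longrightarrow> q w \<noteq> 0"
proof -
  obtain l where l: "l holomorphic_on ball z r" "\<And>w. w \<in> ball z r \<Longrightarrow> g w = exp (l w)"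
    using contractible_imp_holomorphic_log[OF assms(1) convex_imp_contractible[OF convex_ball] assms(2)] by metis
  show thesis
  proof (rule that[of "\<lambda>w. exp (l w / of_nat n)"])
    show "(\<lambda>w. exp (l w / of_nat n)) holomorphic_on ball z r" using l(1) assms(3) by (intro holomorphic_intros) auto
    show "exp (l w / of_nat n) ^ n = g w" if "w \<in> ball z r" for w
      using l(2)[OF that] assms(3) by (simp add: exp_of_nat_mult[symmetric])
  qed auto
qed

text \<open>J stands for the Julia set. \<open>J_critical\<close> limits the critical points on an
  orbit that ends in J, \<open>J_asymptotic\<close> keeps lifts over points of J from running off to
  infinity, and \<open>trapped\<close> separates P - J from the points whose orbits leave the
  disc.\<close>

locale subhyperbolic_disc = postsingular_pair +
  fixes J :: "complex set" and d0 :: nat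
  assumes J_backward: "f x \<in> J \<Longrightarrow> x \<in> J"
    and J_asymptotic: "x \<in> J \<Longrightarrow> x \<notin> asymptotic_values f"
    and J_degree: "x \<in> J \<Longrightarrow> local_degree f x \<le> int d0"
    and J_critical: "x \<in> J \<Longrightarrow> 1 \<le> n \<Longrightarrow> (f ^^ n) x = x \<Longrightarrow> deriv f x \<noteq> 0"
    and finQ: "finite (P \<inter> J)" and closedF: "closed (P - J)"
    and trapped: "\<exists>N. open N \<and> P - J \<subseteq> N \<and> (\<forall>z\<in>N. \<forall>n. norm ((f ^^ n) z) < R)"
begin

section \<open>Local degrees along orbits and the orbifold index\<close>

definition ldeg :: "complex \<Rightarrow> nat" where "ldeg z = nat (local_degree f z)"

lemma f_nonconst: "\<exists>w. f w - x \<noteq> 0"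
proof (rule ccontr)
  assume "\<not> ?thesis"
  then have "\<forall>z. f z = poly [:x:] z" by simp
  then show False using nonpoly by blast
qed

lemma ldeg_factor:
  obtains r \<kappa> where "0 < r" "\<kappa> holomorphic_on ball z r" "1 \<le> ldeg z"
    "\<And>w. w \<in> ball z r \<Longrightarrow> f w - f z = (w - z) ^ ldeg z * \<kappa> w" "\<And>w. w \<in> ball z r \<Longrightarrow> \<kappa> w \<noteq> 0"
proof -
  have hol: "(\<lambda>w. f w - f z) holomorphic_on UNIV" using holf by (intro holomorphic_intros)
  have "(if f z - f z = 0 then 0 < zorder (\<lambda>w. f w - f z) z else zorder (\<lambda>w. f w - f z) z = 0) \<and>
    (\<exists>r>0. cball z r \<subseteq> UNIV \<and> zor_poly (\<lambda>w. f w - f z) z holomorphic_on cball z r \<and>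
    (\<forall>w\<in>cball z r. f w - f z = zor_poly (\<lambda>w. f w - f z) z w * (w - z) ^ nat (zorder (\<lambda>w. f w - f z) z) \<and>
       zor_poly (\<lambda>w. f w - f z) z w \<noteq> 0))"
    by (rule zorder_exist_zero[OF hol]) (use f_nonconst in auto)
  then obtain r where r: "0 < zorder (\<lambda>w. f w - f z) z" "r > 0" "zor_poly (\<lambda>w. f w - f z) z holomorphic_on cball z r"
    "\<And>w. w\<in>cball z r \<Longrightarrow> f w - f z = zor_poly (\<lambda>w. f w - f z) z w * (w - z) ^ nat (zorder (\<lambda>w. f w - f z) z)"
    "\<And>w. w\<in>cball z r \<Longrightarrow> zor_poly (\<lambda>w. f w - f z) z w \<noteq> 0" by auto
  show thesis
    by (rule that[of r "zor_poly (\<lambda>w. f w - f z) z"])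
       (use r ball_subset_cball holomorphic_on_subset in \<open>auto simp: ldeg_def local_degree_def mult.commute\<close>)
qed

lemma ldeg_pos: "1 \<le> ldeg z"
  using ldeg_factor[of z] by metis

lemma ldeg_critical: assumes "2 \<le> ldeg z" shows "deriv f z = 0" "f z \<in> P"
proof -
  obtain r \<kappa> where r: "0 < r" "\<kappa> holomorphic_on ball z r"
    "\<And>w. w \<in> ball z r \<Longrightarrow> f w - f z = (w - z) ^ ldeg z * \<kappa> w"
    using ldeg_factor[of z] by metis
  have k: "(\<kappa> has_field_derivative deriv \<kappa> z) (at z)" using r holomorphic_derivI by (metis centre_in_ball open_ball)
  have "((\<lambda>w. f z + (w - z) ^ ldeg z * \<kappa> w) has_field_derivative 0) (at z)"
  proof -
    have "((\<lambda>w. (w - z) ^ ldeg z) has_field_derivative of_nat (ldeg z) * (z - z) ^ (ldeg z - 1)) (at z)"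
      by (auto intro!: derivative_eq_intros)
    then have "((\<lambda>w. (w - z) ^ ldeg z * \<kappa> w) has_field_derivative
        (of_nat (ldeg z) * (z - z) ^ (ldeg z - 1)) * \<kappa> z + deriv \<kappa> z * (z - z) ^ ldeg z) (at z)"
      by (rule DERIV_mult[OF _ k])
    then have "((\<lambda>w. f z + (w - z) ^ ldeg z * \<kappa> w) has_field_derivative
        0 + ((of_nat (ldeg z) * (z - z) ^ (ldeg z - 1)) * \<kappa> z + deriv \<kappa> z * (z - z) ^ ldeg z)) (at z)"
      by (rule DERIV_add[OF DERIV_const])
    then show ?thesis using assms by (simp add: power_0_left)
  qed
  then have "(f has_field_derivative 0) (at z)"
  proof (rule has_field_derivative_transform_within_open[of _ _ _ "ball z r"])
    show "f z + (w - z) ^ ldeg z * \<kappa> w = f w" if "w \<in> ball z r" for w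
      unfolding r(3)[OF that, symmetric] by simp
  qed (use r(1) in auto)
  then show "deriv f z = 0" by (rule DERIV_imp_deriv)
  then show "f z \<in> P" using deriv_nz by blast
qed

text \<open>The local degree of f^n at y, by multiplicativity.\<close>

definition degprod :: "nat \<Rightarrow> complex \<Rightarrow> nat" where "degprod n y = (\<Prod>i<n. ldeg ((f ^^ i) y))"

lemma degprod_pos: "1 \<le> degprod n y"
  unfolding degprod_def by (rule prod_ge_1) (use ldeg_pos in auto)

lemma J_iter_backward: "(f ^^ n) y \<in> J \<Longrightarrow> i \<le> n \<Longrightarrow> (f ^^ i) y \<in> J"
proof (induction n arbitrary: i)
  case (Suc n)
  then show ?case using J_backward[of "(f ^^ n) y"] by (cases "i = Suc n") auto
qed simp

text \<open>The critical points on an orbit segment ending in J are distinct, since a repetition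
  would be a periodic critical point in J; and all but the first lie in P, being iterates of a
  critical value. So at most card (P \<inter> J) + 1 factors exceed 1.\<close>

lemma degprod_bound:
  assumes "(f ^^ n) y \<in> J"
  shows "degprod n y \<le> (max d0 1) ^ (card (P \<inter> J) + 1)"
proof -
  define C where "C = {i. i < n \<and> 2 \<le> ldeg ((f ^^ i) y)}"
  have finC: "finite C" unfolding C_def by auto
  have inJ: "(f ^^ i) y \<in> J" if "i \<in> C" for i using J_iter_backward[OF assms, of i] that unfolding C_def by simp
  have crit: "deriv f ((f ^^ i) y) = 0" "f ((f ^^ i) y) \<in> P" if "i \<in> C" for i
    using ldeg_critical that unfolding C_def by auto
  have inj: "(f ^^ i) y \<noteq> (f ^^ j) y" if "i \<in> C" "j \<in> C" "i < j" for i j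
  proof
    assume eq: "(f ^^ i) y = (f ^^ j) y"
    have "(f ^^ (j - i)) ((f ^^ i) y) = (f ^^ j) y" using that(3) by (metis comp_apply funpow_add less_imp_le le_add_diff_inverse2)
    then have "(f ^^ (j - i)) ((f ^^ i) y) = (f ^^ i) y" using eq by simp
    moreover have "1 \<le> j - i" using that(3) by linarith
    ultimately show False using J_critical[OF inJ[OF that(1)], of "j - i"] crit(1)[OF that(1)] by blast
  qed
  have "card C \<le> card (P \<inter> J) + 1"
  proof (cases "C = {}")
    case False
    define i0 where "i0 = Min C"
    have i0: "i0 \<in> C" "\<And>i. i \<in> C \<Longrightarrow> i0 \<le> i" unfolding i0_def using finC False by auto
    have "inj_on (\<lambda>i. (f ^^ i) y) C"
    proof (rule inj_onI)
      fix i j assume "i \<in> C" "j \<in> C" "(f ^^ i) y = (f ^^ j) y"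
      then show "i = j" using inj[of i j] inj[of j i] by (metis linorder_neqE_nat)
    qed
    moreover have "(\<lambda>i. (f ^^ i) y) ` C \<subseteq> insert ((f ^^ i0) y) (P \<inter> J)"
    proof
      fix v assume "v \<in> (\<lambda>i. (f ^^ i) y) ` C"
      then obtain i where i: "i \<in> C" "v = (f ^^ i) y" by blast
      show "v \<in> insert ((f ^^ i0) y) (P \<inter> J)"
      proof (cases "i = i0")
        case False
        then have lt: "i0 < i" using i0(2)[OF i(1)] by simp
        have "(f ^^ (i - Suc i0)) ((f ^^ Suc i0) y) = (f ^^ i) y"
          using lt by (metis comp_apply funpow_add Suc_leI le_add_diff_inverse2)
        then have "(f ^^ i) y \<in> P" using funpow_P[OF crit(2)[OF i0(1)], of "i - Suc i0"] by simp
        then show ?thesis using inJ i by simp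
      qed (use i in simp)
    qed
    ultimately have "card C \<le> card (insert ((f ^^ i0) y) (P \<inter> J))"
      using finQ by (metis card_image card_mono finite_insert)
    also have "\<dots> \<le> card (P \<inter> J) + 1" using finQ by (simp add: card_insert_if)
    finally show ?thesis .
  qed simp
  moreover have "degprod n y = (\<Prod>i\<in>C. ldeg ((f ^^ i) y))"
  proof -
    have "ldeg ((f ^^ i) y) = 1" if "i \<in> {..<n} - C" for i
      using that ldeg_pos[of "(f ^^ i) y"] unfolding C_def by auto
    then show ?thesis unfolding degprod_def by (intro prod.mono_neutral_right) (auto simp: C_def)
  qed
  moreover have "(\<Prod>i\<in>C. ldeg ((f ^^ i) y)) \<le> (\<Prod>i\<in>C. max d0 1)"
    by (rule prod_mono) (use J_degree[OF inJ] in \<open>auto simp: ldeg_def nat_le_iff le_max_iff_disj\<close>)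
  moreover have "(max d0 1) ^ card C \<le> (max d0 1) ^ (card (P \<inter> J) + 1)"
    by (rule power_increasing) (use calculation(1) in auto)
  ultimately show ?thesis by simp
qed

text \<open>The orbifold index \<open>\<mu>\<close>: a branched disc over \<open>x\<close> whose order is divisible by \<open>\<mu> x\<close> lifts
  under every iterate of \<open>f\<close>.\<close>

definition \<mu> :: "complex \<Rightarrow> nat" where "\<mu> x = Lcm {degprod n y |n y. (f ^^ n) y = x}"

text \<open>By \<open>degprod_bound\<close> the \<open>Lcm\<close> runs over a finite set of
  positive numbers; over an infinite set it would be 0.\<close>

lemma \<mu>_pos: assumes "x \<in> J" shows "0 < \<mu> x"
proof -
  define A where "A = {degprod n y |n y. (f ^^ n) y = x}"
  have "A \<subseteq> {..(max d0 1) ^ (card (P \<inter> J) + 1)}" unfolding A_def using degprod_bound assms by auto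
  then have "finite A" using finite_subset by blast
  moreover have "0 \<notin> A"
  proof
    assume "0 \<in> A"
    then obtain n y where "degprod n y = 0" unfolding A_def by auto
    then show False using degprod_pos[of n y] by simp
  qed
  ultimately have "Lcm A \<noteq> 0" using Lcm_0_iff_nat by blast
  then show ?thesis unfolding \<mu>_def A_def by simp
qed

text \<open>Prolonging an orbit segment that ends in y by one step multiplies its degree by
  \<open>ldeg y\<close>. This divisibility lets a disc branched over f y lift to one over y that is
  still of sufficient order.\<close>

lemma \<mu>_dvd: "ldeg y * \<mu> y dvd \<mu> (f y)"
proof -
  define A where "A = {degprod n z |n z. (f ^^ n) z = y}"
  have "degprod 0 y \<in> A" unfolding A_def by (auto intro: exI[of _ 0])
  then have "A \<noteq> {}" by blast
  then have "ldeg y * \<mu> y = Lcm ((*) (ldeg y) ` A)" unfolding \<mu>_def A_def[symmetric] by (simp add: Lcm_mult)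
  also have "\<dots> dvd \<mu> (f y)"
  proof (rule Lcm_least)
    fix c assume "c \<in> (*) (ldeg y) ` A"
    then obtain n z where c: "c = ldeg y * degprod n z" "(f ^^ n) z = y" unfolding A_def by auto
    then have "c = degprod (Suc n) z" unfolding degprod_def by simp
    moreover have "(f ^^ Suc n) z = f y" using c(2) by simp
    ultimately show "c dvd \<mu> (f y)" unfolding \<mu>_def by (intro dvd_Lcm) blast
  qed
  finally show ?thesis .
qed

text \<open>A disc branched at its centre, with k the order there. The factor 2 in
  \<open>2 * \<mu>\<close> makes h - h 0 a square, as \<open>even_at\<close> demands of lifts that
  hit f^-1(P).\<close>

definition orbidisc :: "(complex \<Rightarrow> complex) \<Rightarrow> bool" where
  "orbidisc h \<longleftrightarrow> h holomorphic_on ball 0 1 \<and> h 0 \<in> J \<and> (\<forall>s\<in>ball 0 1 - {0}. h s \<notin> P) \<and>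
     (\<exists>k g. g holomorphic_on ball 0 1 \<and> (\<forall>s\<in>ball 0 1. g s \<noteq> 0 \<and> h s - h 0 = s ^ k * g s) \<and>
        0 < k \<and> 2 * \<mu> (h 0) dvd k)"

text \<open>Composition with exp unwinds the puncture. Along the negative axis the lift accumulates
  at a preimage y of h 0, as h 0 is not asymptotic. On a small circle about y the difference f - h 0
  is bounded away from 0, so the connected image of a half-plane far to the left, on which f is
  close to h 0, cannot cross the circle.\<close>

lemma punctured_lift_limit:
  assumes h: "h holomorphic_on ball 0 1" "h 0 \<in> J"
    and e: "e holomorphic_on {\<tau>. Re \<tau> < 0}" "\<And>\<tau>. Re \<tau> < 0 \<Longrightarrow> f (e \<tau>) = h (exp \<tau>)"
  obtains y where "f y = h 0" "\<And>\<epsilon>. 0 < \<epsilon> \<Longrightarrow> \<exists>T<0. \<forall>\<tau>. Re \<tau> < T \<longrightarrow> e \<tau> \<in> ball y \<epsilon>"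
proof -
  define x where "x = h 0"
  have hc: "continuous_on (ball 0 1) h" using h(1) holomorphic_on_imp_continuous_on by blast
  have h0: "\<exists>T<0. \<forall>\<tau>. Re \<tau> < T \<longrightarrow> norm (h (exp \<tau>) - x) < m" if m: "m > 0" for m
  proof -
    have "isCont h 0" using hc by (simp add: continuous_on_eq_continuous_at)
    then obtain \<delta> where \<delta>: "\<delta> > 0" "\<And>s. dist s 0 < \<delta> \<Longrightarrow> dist (h s) x < m"
      using m unfolding continuous_at_eps_delta x_def by blast
    define T where "T = min (-1) (ln \<delta>)"
    have "norm (h (exp \<tau>) - x) < m" if "Re \<tau> < T" for \<tau>
    proof -
      have "exp (Re \<tau>) < exp (ln \<delta>)" using that unfolding T_def by simp
      then have "dist (exp \<tau>) 0 < \<delta>" using \<delta>(1) by simp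
      then show ?thesis using \<delta>(2) by (simp add: dist_norm)
    qed
    then show ?thesis by (intro exI[of _ T]) (auto simp: T_def)
  qed
  define \<gamma> where "\<gamma> t = e (- 1 - of_real t)" for t :: real
  have g1: "continuous_on {0..} \<gamma>" unfolding \<gamma>_def
    by (rule continuous_on_compose2[OF holomorphic_on_imp_continuous_on[OF e(1)]])
       (auto intro!: continuous_intros)
  have g2: "((\<lambda>t. f (\<gamma> t)) \<longlongrightarrow> x) at_top"
  proof (rule tendstoI)
    fix m :: real assume "m > 0"
    then obtain T where T: "T < 0" "\<And>\<tau>. Re \<tau> < T \<Longrightarrow> norm (h (exp \<tau>) - x) < m" using h0 by blast
    show "\<forall>\<^sub>F t in at_top. dist (f (\<gamma> t)) x < m"
      using eventually_gt_at_top[of "max 0 (- T)"]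
    proof eventually_elim
      case (elim t)
      then have "Re (- 1 - of_real t) < T" "Re (- 1 - complex_of_real t) < 0" by auto
      then show ?case using T(2)[of "- 1 - of_real t"] e(2)[of "- 1 - of_real t"] unfolding \<gamma>_def by (simp add: dist_norm)
    qed
  qed
  obtain y where y: "f y = x" "\<And>\<epsilon> t0. 0 < \<epsilon> \<Longrightarrow> \<exists>t\<ge>t0. dist (\<gamma> t) y < \<epsilon>"
    using curve_accumulates[OF contf g1 g2] J_asymptotic h(2) unfolding x_def by metis
  have "\<exists>T<0. \<forall>\<tau>. Re \<tau> < T \<longrightarrow> e \<tau> \<in> ball y \<epsilon>" if \<epsilon>: "0 < \<epsilon>" for \<epsilon>
  proof -
    obtain r \<kappa> where r: "0 < r" "\<And>w. w \<in> ball y r \<Longrightarrow> f w - f y = (w - y) ^ ldeg y * \<kappa> w"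
      "\<And>w. w \<in> ball y r \<Longrightarrow> \<kappa> w \<noteq> 0" using ldeg_factor[of y] by metis
    define \<rho> where "\<rho> = min (r/2) \<epsilon>"
    have \<rho>: "0 < \<rho>" "\<rho> < r" "\<rho> \<le> \<epsilon>" unfolding \<rho>_def using r(1) \<epsilon> by auto
    have nz: "f w - x \<noteq> 0" if "w \<in> sphere y \<rho>" for w
    proof -
      have "w \<in> ball y r" "w \<noteq> y" using that \<rho> by auto
      then show ?thesis using r(2,3)[of w] y(1) by auto
    qed
    have "sphere y \<rho> \<noteq> {}" using \<rho>(1) by simp
    moreover have "continuous_on (sphere y \<rho>) (\<lambda>w. norm (f w - x))" by (intro continuous_intros contf)
    ultimately obtain w0 where w0: "w0 \<in> sphere y \<rho>" "\<And>w. w \<in> sphere y \<rho> \<Longrightarrow> norm (f w0 - x) \<le> norm (f w - x)"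
      using continuous_attains_inf[OF compact_sphere, of y \<rho> "\<lambda>w. norm (f w - x)"] by blast
    then obtain T where T: "T < 0" "\<And>\<tau>. Re \<tau> < T \<Longrightarrow> norm (h (exp \<tau>) - x) < norm (f w0 - x)"
      using h0[of "norm (f w0 - x)"] nz[OF w0(1)] by auto
    define S where "S = {\<tau>. Re \<tau> < T}"
    have "connected (e ` S)"
      unfolding S_def
      by (intro connected_continuous_image convex_connected convex_halfspace_Re_lt
           continuous_on_subset[OF holomorphic_on_imp_continuous_on[OF e(1)]]) (use T(1) in auto)
    moreover have "e ` S \<inter> sphere y \<rho> = {}"
    proof (rule ccontr)
      assume "\<not> ?thesis"
      then obtain \<tau> where "\<tau> \<in> S" "e \<tau> \<in> sphere y \<rho>" by blast
      then have \<tau>: "Re \<tau> < T" "e \<tau> \<in> sphere y \<rho>" unfolding S_def by simp_all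
      then have "norm (f w0 - x) \<le> norm (f (e \<tau>) - x)" using w0 by blast
      then show False using T(2)[OF \<tau>(1)] e(2)[of \<tau>] \<tau>(1) T(1) by simp
    qed
    moreover have "e ` S \<inter> ball y \<rho> \<noteq> {}"
    proof -
      obtain t where "t \<ge> - T" "dist (\<gamma> t) y < \<rho>" using y(2)[OF \<rho>(1)] by blast
      then have "e (- 1 - of_real t) \<in> ball y \<rho>" "- 1 - of_real t \<in> S" unfolding \<gamma>_def S_def by (auto simp: dist_commute)
      then show ?thesis by blast
    qed
    ultimately have "e ` S \<subseteq> ball y \<rho>"
      using connected_Int_frontier[of "e ` S" "ball y \<rho>"] \<rho>(1) by (auto simp: frontier_ball)
    then show ?thesis using T(1) \<rho>(3) unfolding S_def by (intro exI[of _ T]) (auto simp: subset_iff)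
  qed
  then show thesis using that y(1) unfolding x_def by blast
qed

end

context subhyperbolic_disc begin

text \<open>Lift h o exp to the left half-plane, with limit y at the puncture. Near y, f - f y is
  the d-th power of a coordinate \<open>\<phi>\<close>; on the disc, h - h 0 is the d-th power of a
  function p, because d divides k. The quotient of \<open>\<phi>\<close> along the lift by p is a
  d-th root of unity, hence constant. So the lift has period 2 pi i and descends to the disc, with
  order k / d at the centre.\<close>

lemma orbidisc_lift:
  assumes orb: "orbidisc h" and s1: "s1 \<in> ball 0 1" "s1 \<noteq> 0" and z: "f z = h s1"
  obtains g where "orbidisc g" "g s1 = z" "\<And>s. s \<in> ball 0 1 \<Longrightarrow> f (g s) = h s"
proof -
  have h: "h holomorphic_on ball 0 1" "h 0 \<in> J" "\<And>s. s \<in> ball 0 1 \<Longrightarrow> s \<noteq> 0 \<Longrightarrow> h s \<notin> P"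
    using orb unfolding orbidisc_def by auto
  obtain k g where kg: "g holomorphic_on ball 0 1" "\<And>s. s\<in>ball 0 1 \<Longrightarrow> g s \<noteq> 0"
     "\<And>s. s\<in>ball 0 1 \<Longrightarrow> h s - h 0 = s ^ k * g s" "0 < k" "2 * \<mu> (h 0) dvd k"
    using orb unfolding orbidisc_def by auto
  define H where "H = {\<tau>. Re \<tau> < 0}"
  have H: "open H" "convex H" unfolding H_def by (simp_all add: open_halfspace_Re_lt convex_halfspace_Re_lt)
  have expH: "exp \<tau> \<in> ball 0 1" if "\<tau> \<in> H" for \<tau> using that unfolding H_def by simp
  have hexp: "(\<lambda>\<tau>. h (exp \<tau>)) holomorphic_on H"
    by (rule holomorphic_on_compose_gen[OF _ h(1), unfolded o_def]) (use expH in \<open>auto intro!: holomorphic_intros\<close>)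
  have LnH: "Ln s \<in> H" if "s \<in> ball 0 1" "s \<noteq> 0" for s unfolding H_def using that by simp
  obtain e where e: "e holomorphic_on H" "e (Ln s1) = z" "\<And>\<tau>. \<tau> \<in> H \<Longrightarrow> f (e \<tau>) = h (exp \<tau>)"
    by (rule lift_hol[OF H(1) convex_imp_simply_connected[OF H(2)] hexp _ LnH[OF s1]])
       (use h(3) expH s1 z in auto)
  obtain y where y: "f y = h 0" "\<And>\<epsilon>. 0 < \<epsilon> \<Longrightarrow> \<exists>T<0. \<forall>\<tau>. Re \<tau> < T \<longrightarrow> e \<tau> \<in> ball y \<epsilon>"
    using punctured_lift_limit[OF h(1,2), of e] e unfolding H_def by auto
  define d where "d = ldeg y"
  obtain r \<kappa> where r: "0 < r" "\<kappa> holomorphic_on ball y r" "1 \<le> d"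
    "\<And>w. w \<in> ball y r \<Longrightarrow> f w - f y = (w - y) ^ d * \<kappa> w" "\<And>w. w \<in> ball y r \<Longrightarrow> \<kappa> w \<noteq> 0"
    unfolding d_def by (rule ldeg_factor[of y]) blast
  obtain q where q: "q holomorphic_on ball y r" "\<And>w. w \<in> ball y r \<Longrightarrow> q w ^ d = \<kappa> w" "\<And>w. w \<in> ball y r \<Longrightarrow> q w \<noteq> 0"
    by (rule holomorphic_root[OF r(2,5), of d]) (use r(3) in auto)
  define \<phi> where "\<phi> w = (w - y) * q w" for w
  have hol\<phi>: "\<phi> holomorphic_on ball y r" unfolding \<phi>_def by (intro holomorphic_intros q)
  have "(\<phi> has_field_derivative q y) (at y)"
  proof -
    have "(q has_field_derivative deriv q y) (at y)" using q(1) r(1) holomorphic_derivI by (metis centre_in_ball open_ball)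
    then show ?thesis unfolding \<phi>_def by (auto intro!: derivative_eq_intros)
  qed
  then have "deriv \<phi> y \<noteq> 0" using q(3)[of y] r(1) by (simp add: DERIV_imp_deriv)
  then obtain r1 where r1: "r1 > 0" "ball y r1 \<subseteq> ball y r" "inj_on \<phi> (ball y r1)"
    using has_complex_derivative_locally_injective[OF hol\<phi> _ open_ball, of y] r(1) by auto
  obtain T where T: "T < 0" "\<And>\<tau>. Re \<tau> < T \<Longrightarrow> e \<tau> \<in> ball y r1" using y(2)[OF r1(1)] by blast
  have "d * \<mu> y dvd \<mu> (h 0)" using \<mu>_dvd[of y] y(1) unfolding d_def by simp
  then have dk: "2 * (d * \<mu> y) dvd k" using kg(5) by (meson dvd_trans mult_dvd_mono dvd_refl)
  \<comment> \<open>k' = k / d will be the order of the lifted disc; its divisibility by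
    \<open>2 * \<mu> y\<close> comes from \<open>\<mu>_dvd\<close>.\<close>
  then obtain k' where k': "k = d * k'" by (metis dvd_mult_left dvd_mult_right dvdE mult.commute)
  have k'0: "0 < k'" using kg(4) k' by simp
  have k'd: "2 * \<mu> y dvd k'"
  proof -
    have "d * (2 * \<mu> y) dvd d * k'" using dk k' by (simp add: mult.left_commute)
    then show ?thesis using r(3) by simp
  qed
  obtain p0 where p0: "p0 holomorphic_on ball 0 1" "\<And>s. s \<in> ball 0 1 \<Longrightarrow> p0 s ^ d = g s" "\<And>s. s \<in> ball 0 1 \<Longrightarrow> p0 s \<noteq> 0"
    by (rule holomorphic_root[OF kg(1,2), of d]) (use r(3) in auto)
  define p where "p s = s ^ k' * p0 s" for s
  have pd: "p s ^ d = h s - h 0" if "s \<in> ball 0 1" for s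
    unfolding p_def power_mult_distrib p0(2)[OF that] kg(3)[OF that] k' by (simp add: power_mult[symmetric] mult.commute)
  have pnz: "p s \<noteq> 0" if "s \<in> ball 0 1" "s \<noteq> 0" for s unfolding p_def using p0(3) that by simp
  define S where "S = {\<tau>. Re \<tau> < T}"
  have SH: "S \<subseteq> H" unfolding S_def H_def using T(1) by auto
  have econt: "continuous_on H e" using e(1) holomorphic_on_imp_continuous_on by blast
  have eS: "e \<tau> \<in> ball y r1" "e \<tau> \<in> ball y r" if "\<tau> \<in> S" for \<tau> using T(2) r1(2) that unfolding S_def by blast+
  have "\<exists>c. \<forall>\<tau>\<in>S. \<phi> (e \<tau>) / p (exp \<tau>) = c"
  proof -
    have "continuous_on S (\<lambda>\<tau>. \<phi> (e \<tau>) / p (exp \<tau>))"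
    proof (intro continuous_on_divide)
      show "continuous_on S (\<lambda>\<tau>. \<phi> (e \<tau>))"
        by (rule continuous_on_compose2[OF holomorphic_on_imp_continuous_on[OF hol\<phi>] continuous_on_subset[OF econt SH]])
           (use eS in blast)
      have "continuous_on (ball 0 1) p" unfolding p_def
        by (intro continuous_intros holomorphic_on_imp_continuous_on[OF p0(1)])
      then show "continuous_on S (\<lambda>\<tau>. p (exp \<tau>))"
        by (rule continuous_on_compose2) (use expH SH in \<open>auto intro!: continuous_intros simp del: mem_ball\<close>)
      show "\<forall>\<tau>\<in>S. p (exp \<tau>) \<noteq> 0" using pnz expH SH by auto
    qed
    moreover have "(\<lambda>\<tau>. \<phi> (e \<tau>) / p (exp \<tau>)) ` S \<subseteq> {w. w ^ d = 1}"
    proof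
      fix v assume "v \<in> (\<lambda>\<tau>. \<phi> (e \<tau>) / p (exp \<tau>)) ` S"
      then obtain \<tau> where \<tau>: "\<tau> \<in> S" "v = \<phi> (e \<tau>) / p (exp \<tau>)" by blast
      have "\<phi> (e \<tau>) ^ d = f (e \<tau>) - f y"
        unfolding \<phi>_def power_mult_distrib q(2)[OF eS(2)[OF \<tau>(1)]] r(4)[OF eS(2)[OF \<tau>(1)]] ..
      also have "\<dots> = p (exp \<tau>) ^ d" using e(3) \<tau>(1) SH y(1) pd[OF expH] by auto
      finally show "v \<in> {w. w ^ d = 1}" using \<tau> pnz[OF expH, of \<tau>] SH by (auto simp: power_divide)
    qed
    then have "finite ((\<lambda>\<tau>. \<phi> (e \<tau>) / p (exp \<tau>)) ` S)"
      using finite_nth_roots[of d 1] r(3) finite_subset by auto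
    moreover have "connected S" unfolding S_def by (intro convex_connected convex_halfspace_Re_lt)
    ultimately have "(\<lambda>\<tau>. \<phi> (e \<tau>) / p (exp \<tau>)) constant_on S" by (intro continuous_finite_range_constant)
    then show ?thesis unfolding constant_on_def by blast
  qed
  then obtain c where c: "\<And>\<tau>. \<tau> \<in> S \<Longrightarrow> \<phi> (e \<tau>) / p (exp \<tau>) = c" by blast
  have \<phi>e: "\<phi> (e \<tau>) = c * p (exp \<tau>)" if "\<tau> \<in> S" for \<tau>
    using c[OF that] pnz[OF expH, of \<tau>] that SH by (auto simp: field_simps)
  define \<tau>0 where "\<tau>0 = complex_of_real (T - 1)"
  have \<tau>0: "\<tau>0 \<in> S" unfolding \<tau>0_def S_def by simp
  have ey: "e \<tau> \<noteq> y" if "\<tau> \<in> H" for \<tau>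
  proof
    assume "e \<tau> = y"
    then have "h (exp \<tau>) - h 0 = 0" using e(3)[OF that] y(1) by simp
    then show False using kg(2,3)[OF expH[OF that]] by simp
  qed
  have c0: "c \<noteq> 0"
    using c[OF \<tau>0] ey[of \<tau>0] q(3)[OF eS(2)[OF \<tau>0]] pnz[OF expH, of \<tau>0] \<tau>0 SH unfolding \<phi>_def by auto
  \<comment> \<open>By \<open>lift_unique\<close> it is enough to compare the lift with its
    translate at \<open>\<tau>0\<close>; there both values lie in a disc where \<open>\<phi>\<close>
    is injective, and \<open>\<phi>\<close> agrees on them.\<close>
  have per1: "e (\<tau> + of_real (2 * pi) * \<i>) = e \<tau>" if "\<tau> \<in> H" for \<tau>
  proof (rule lift_unique[where f=f and U=H and g="\<lambda>\<tau>. e (\<tau> + of_real (2 * pi) * \<i>)" and h=e and ?x0.0=\<tau>0 and x=\<tau>, OF holf convex_connected[OF H(2)]])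
    have sh: "\<tau> + of_real (2 * pi) * \<i> \<in> H" if "\<tau> \<in> H" for \<tau> using that unfolding H_def by simp
    have ex: "exp (\<tau> + of_real (2 * pi) * \<i>) = exp \<tau>" for \<tau>
      by (metis exp_plus_2pin mult.commute of_int_1 mult_1 mult.assoc of_real_mult of_real_numeral)
    show "continuous_on H (\<lambda>\<tau>. e (\<tau> + of_real (2 * pi) * \<i>))"
      by (rule continuous_on_compose2[OF econt]) (use sh in \<open>auto intro!: continuous_intros\<close>)
    show "f (e (\<tau> + of_real (2 * pi) * \<i>)) = f (e \<tau>)" if "\<tau> \<in> H" for \<tau>
      using e(3)[OF sh[OF that]] e(3)[OF that] ex by simp
    show "deriv f (e (\<tau> + of_real (2 * pi) * \<i>)) \<noteq> 0" if "\<tau> \<in> H" for \<tau>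
      by (rule deriv_nz) (use e(3)[OF sh[OF that]] h(3)[OF expH[OF sh[OF that]]] in simp)
    have "\<tau>0 + of_real (2 * pi) * \<i> \<in> S" using \<tau>0 unfolding S_def by simp
    then have "\<phi> (e (\<tau>0 + of_real (2 * pi) * \<i>)) = \<phi> (e \<tau>0)" "e (\<tau>0 + of_real (2 * pi) * \<i>) \<in> ball y r1"
      using \<phi>e \<tau>0 ex eS by auto
    then show "e (\<tau>0 + of_real (2 * pi) * \<i>) = e \<tau>0" using inj_onD[OF r1(3)] eS(1)[OF \<tau>0] by blast
  qed (use that \<tau>0 SH econt in auto)
  have per: "e (\<tau> + of_real (2 * pi * of_int m) * \<i>) = e \<tau>" if "\<tau> \<in> H" for \<tau> m
  proof -
    have nat: "e (\<tau> + of_real (2 * pi * of_nat n) * \<i>) = e \<tau>" if "\<tau> \<in> H" for \<tau> n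
      using that
    proof (induction n arbitrary: \<tau>)
      case (Suc n)
      have "\<tau> + of_real (2 * pi) * \<i> \<in> H" using Suc.prems unfolding H_def by simp
      from Suc.IH[OF this] show ?case using per1[OF Suc.prems] by (simp add: algebra_simps)
    qed simp
    show ?thesis
    proof (cases "0 \<le> m")
      case True
      then show ?thesis using nat[OF that, of "nat m"] by simp
    next
      case False
      define \<sigma> where "\<sigma> = \<tau> + of_real (2 * pi * of_int m) * \<i>"
      have "\<sigma> \<in> H" using that unfolding \<sigma>_def H_def by simp
      from nat[OF this, of "nat (- m)"] show ?thesis using False unfolding \<sigma>_def by simp
    qed
  qed
  \<comment> \<open>\<open>Ln\<close> jumps by 2 pi i across the negative axis, which is a period of
    e. So G is holomorphic off the origin, as the local logarithms L below show.\<close>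
  define G where "G s = (if s = 0 then y else e (Ln s))" for s
  have Gexp: "G (exp \<tau>) = e \<tau>" if "\<tau> \<in> H" for \<tau>
  proof -
    have "exp (Ln (exp \<tau>)) = exp \<tau>" by simp
    then obtain m where "Ln (exp \<tau>) = \<tau> + of_real (real_of_int (2 * m) * pi) * \<i>" unfolding exp_eq by blast
    then have "Ln (exp \<tau>) = \<tau> + of_real (2 * pi * of_int m) * \<i>" by (simp add: mult_ac)
    then show ?thesis using per[OF that] unfolding G_def by simp
  qed
  have fG: "f (G s) = h s" if "s \<in> ball 0 1" for s
    using e(3)[OF LnH[OF that]] y(1) unfolding G_def by auto
  have G0: "\<exists>\<delta>>0. \<forall>s. norm s < \<delta> \<longrightarrow> G s \<in> ball y \<epsilon>" if \<epsilon>: "0 < \<epsilon>" for \<epsilon>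
  proof -
    obtain T' where T': "T' < 0" "\<And>\<tau>. Re \<tau> < T' \<Longrightarrow> e \<tau> \<in> ball y \<epsilon>" using y(2)[OF \<epsilon>] by blast
    have "G s \<in> ball y \<epsilon>" if "norm s < exp T'" for s
    proof (cases "s = 0")
      case False
      then have "ln (norm s) < ln (exp T')" using that by (subst ln_less_cancel_iff) auto
      then have "Re (Ln s) < T'" using False by simp
      then show ?thesis using T'(2) False unfolding G_def by simp
    qed (use \<open>0 < \<epsilon>\<close> in \<open>simp add: G_def\<close>)
    then show ?thesis by (intro exI[of _ "exp T'"]) simp
  qed
  have op: "open (ball (0::complex) 1 - {0})" by (rule open_Diff) auto
  have Gpunct: "G holomorphic_on ball 0 1 - {0}"
    unfolding holomorphic_on_open[OF op]
  proof (intro ballI)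
    fix s0 assume s0: "s0 \<in> ball (0::complex) 1 - {0}"
    define B where "B = ball s0 (norm s0) \<inter> ball 0 1"
    define L where "L s = Ln (s / s0) + Ln s0" for s
    have B: "open B" "s0 \<in> B" unfolding B_def using s0 by auto
    have sB: "s / s0 \<notin> \<real>\<^sub>\<le>\<^sub>0" "s \<noteq> 0" if "s \<in> B" for s
    proof -
      have "norm (s0 - s) < norm s0" using that unfolding B_def by (simp add: dist_norm)
      then have "norm (1 - s / s0) < 1" using s0 by (simp add: field_simps flip: norm_divide)
          (metis diff_divide_distrib divide_self norm_divide divide_less_eq_1_pos norm_eq_zero zero_less_norm_iff)
      then have "Re (s / s0) > 0" using abs_Re_le_cmod[of "1 - s / s0"] by simp
      then show "s / s0 \<notin> \<real>\<^sub>\<le>\<^sub>0" by (auto simp: complex_nonpos_Reals_iff)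
      then show "s \<noteq> 0" by auto
    qed
    have expL: "exp (L s) = s" if "s \<in> B" for s
      unfolding L_def exp_add using sB[OF that] s0 by simp
    have LH: "L s \<in> H" if "s \<in> B" for s
    proof -
      have "exp (Re (L s)) = norm s" using expL[OF that] by (metis norm_exp_eq_Re)
      also have "\<dots> < exp 0" using that unfolding B_def by simp
      finally show ?thesis unfolding H_def by simp
    qed
    have "L holomorphic_on B" unfolding L_def using sB s0 by (intro holomorphic_intros) auto
    then have "(e \<circ> L) holomorphic_on B" using holomorphic_on_compose_gen[OF _ e(1)] LH by blast
    then have "G holomorphic_on B"
      by (rule holomorphic_transform) (use Gexp[OF LH] expL in \<open>simp add: o_def\<close>)
    then show "\<exists>f'. (G has_field_derivative f') (at s0)" using holomorphic_on_open[OF B(1)] B(2) by blast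
  qed
  have Gcont: "continuous_on (ball 0 1) G"
  proof (rule continuous_at_imp_continuous_on, intro ballI)
    fix s assume s: "s \<in> ball (0::complex) 1"
    show "isCont G s"
    proof (cases "s = 0")
      case True
      show ?thesis unfolding True continuous_at_eps_delta
        using G0 unfolding G_def by (auto simp: dist_commute)
    next
      case False
      then have "s \<in> ball 0 1 - {0}" using s by blast
      then show ?thesis using holomorphic_on_imp_continuous_on[OF Gpunct] continuous_on_eq_continuous_at[OF op] by blast
    qed
  qed
  have holG: "G holomorphic_on ball 0 1"
    by (rule no_isolated_singularity[OF Gcont Gpunct]) auto
  have G0y: "G 0 = y" unfolding G_def by simp
  have Gne: "G s \<noteq> y" if "s \<in> ball 0 1" "s \<noteq> 0" for s
    using ey[OF LnH[OF that]] that unfolding G_def by simp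
  \<comment> \<open>The value at 0 is the limit of (G s - y) / s^k', read off from (G s - y) * q (G
    s) = c * s^k' * p0 s.\<close>
  define K where "K s = (if s = 0 then c * p0 0 / q y else (G s - y) / s ^ k')" for s
  have Keq: "G s - G 0 = s ^ k' * K s" if "s \<in> ball 0 1" for s
    unfolding K_def G0y using k'0 by (simp add: G0y)
  have Knz: "K s \<noteq> 0" if "s \<in> ball 0 1" for s
    unfolding K_def using c0 p0(3)[OF that] q(3)[of y] r(1) Gne[OF that] by auto
  obtain \<delta> where \<delta>: "\<delta> > 0" "\<And>s. norm s < \<delta> \<Longrightarrow> G s \<in> ball y r" using G0[OF r(1)] by blast
  define \<delta>' where "\<delta>' = min (min \<delta> 1) (exp T)"
  have \<delta>': "\<delta>' > 0" "\<delta>' \<le> 1" "\<delta>' \<le> \<delta>" unfolding \<delta>'_def using \<delta>(1) by auto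
  have Kq: "K s = c * p0 s / q (G s)" if "s \<in> ball 0 \<delta>'" for s
  proof (cases "s = 0")
    case False
    have sb: "s \<in> ball 0 1" "norm s < exp T" "G s \<in> ball y r" using that \<delta>(2) unfolding \<delta>'_def by auto
    have "ln (norm s) < ln (exp T)" using False sb(2) by (subst ln_less_cancel_iff) auto
    then have LS: "Ln s \<in> S" unfolding S_def using False by simp
    have "(G s - y) * q (G s) = c * p s" using \<phi>e[OF LS] False unfolding \<phi>_def G_def by simp
    then have "(G s - y) * q (G s) = c * p0 s * s ^ k'" unfolding p_def by (simp add: mult_ac)
    then show ?thesis using False q(3)[OF sb(3)] unfolding K_def by (simp add: field_simps)
  qed (simp add: K_def G0y)
  have holK: "K holomorphic_on ball 0 1"
  proof -
    have "(\<lambda>s. c * p0 s / q (G s)) holomorphic_on ball 0 \<delta>'"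
    proof (intro holomorphic_intros)
      show "p0 holomorphic_on ball 0 \<delta>'" using p0(1) \<delta>' holomorphic_on_subset subset_ball by blast
      show "(\<lambda>s. q (G s)) holomorphic_on ball 0 \<delta>'"
        by (rule holomorphic_on_compose_gen[OF _ q(1), unfolded o_def])
           (use holomorphic_on_subset[OF holG subset_ball[OF \<delta>'(2)]] \<delta>(2) \<delta>'(3) in auto)
      show "q (G s) \<noteq> 0" if "s \<in> ball 0 \<delta>'" for s using q(3) \<delta>(2) \<delta>'(3) that by simp
    qed
    then have 1: "K holomorphic_on ball 0 \<delta>'" by (rule holomorphic_transform) (simp add: Kq)
    have "(\<lambda>s. (G s - y) / s ^ k') holomorphic_on ball 0 1 - {0}" by (intro holomorphic_intros Gpunct) auto
    then have 2: "K holomorphic_on ball 0 1 - {0}" by (rule holomorphic_transform) (simp add: K_def)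
    have "K holomorphic_on ball 0 \<delta>' \<union> (ball 0 1 - {0})"
      by (rule holomorphic_on_Un[OF 1 2 open_ball op])
    moreover have "ball 0 \<delta>' \<union> (ball 0 1 - {0}) = ball (0::complex) 1" using \<delta>' by auto
    ultimately show ?thesis by simp
  qed
  show thesis
  proof (rule that[of G])
    show "orbidisc G" unfolding orbidisc_def
    proof (intro conjI)
      show "G 0 \<in> J" using J_backward[of y] y(1) h(2) G0y by simp
      show "\<forall>s\<in>ball 0 1 - {0}. G s \<notin> P" using fG h(3) invP by (metis Diff_iff image_subset_iff insertCI)
      show "\<exists>k g. g holomorphic_on ball 0 1 \<and> (\<forall>s\<in>ball 0 1. g s \<noteq> 0 \<and> G s - G 0 = s ^ k * g s) \<and>
        0 < k \<and> 2 * \<mu> (G 0) dvd k"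
        using holK Knz Keq k'0 k'd unfolding G0y by blast
    qed (rule holG)
    show "G s1 = z" using e(2) s1(2) unfolding G_def by simp
  qed (rule fG)
qed

lemma orbidisc_iter_lift:
  assumes "orbidisc h" and s1: "s1 \<in> ball 0 1" "s1 \<noteq> 0" and "(f ^^ n) z = h s1"
  obtains g where "orbidisc g" "g s1 = z" "\<And>s. s \<in> ball 0 1 \<Longrightarrow> (f ^^ n) (g s) = h s"
  using assms(1,4)
proof (induction n arbitrary: h thesis)
  case 0
  then show ?case by auto
next
  case (Suc n)
  obtain h1 where h1: "orbidisc h1" "h1 s1 = (f ^^ n) z" "\<And>s. s \<in> ball 0 1 \<Longrightarrow> f (h1 s) = h s"
    using orbidisc_lift[OF Suc.prems(2) s1, of "(f ^^ n) z"] Suc.prems(3) by auto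
  obtain g where g: "orbidisc g" "g s1 = z" "\<And>s. s \<in> ball 0 1 \<Longrightarrow> (f ^^ n) (g s) = h1 s"
    using Suc.IH[OF _ h1(1)] h1(2) by metis
  show ?case by (rule Suc.prems(1)[OF g(1,2)]) (use g(3) h1(3) in auto)
qed

end

section \<open>The orbifold metric\<close>

text \<open>The constant 3 is at least exp 1, so the logarithm in the density at infinity is at
  least 1 everywhere.\<close>

lemma ln3_ge: "1 \<le> ln (3 + (x::real)\<^sup>2)"
proof -
  have "exp 1 \<le> (3::real)" by (rule exp_le)
  then have "exp 1 \<le> 3 + x\<^sup>2" using zero_le_power2[of x] by linarith
  then show ?thesis by (subst ln_ge_iff) (auto simp: add_pos_nonneg)
qed

context subhyperbolic_disc begin

text \<open>The set of points at which the contraction estimates hold. It contains all far points,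
  is backward invariant and misses P, so inverse orbits stay where the density is positive.\<close>

definition G where "G = {z. \<exists>n. R \<le> norm ((f ^^ n) z)}"

lemma G_far: "R \<le> norm z \<Longrightarrow> z \<in> G"
  unfolding G_def by (auto intro: exI[of _ 0])

lemma G_iter: "(f ^^ n) z \<in> G \<Longrightarrow> z \<in> G"
proof -
  assume "(f ^^ n) z \<in> G"
  then obtain m where "R \<le> norm ((f ^^ m) ((f ^^ n) z))" unfolding G_def by blast
  then have "R \<le> norm ((f ^^ (m + n)) z)" by (simp add: funpow_add)
  then show ?thesis unfolding G_def by blast
qed

lemma G_P: "G \<inter> P = {}"
proof -
  have "x \<notin> P" if "x \<in> G" for x
  proof
    assume "x \<in> P"
    then have "norm ((f ^^ n) x) < R" for n by (intro norm_P funpow_P)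
    then show False using that unfolding G_def by (auto simp: not_le[symmetric])
  qed
  then show ?thesis by blast
qed

lemma P_max: obtains B where "B < R" "\<And>x. x \<in> P \<Longrightarrow> norm x \<le> B"
proof -
  have "compact P" using closedP Pball by (meson bounded_ball bounded_subset compact_eq_bounded_closed)
  moreover have "P \<noteq> {}" using a by blast
  ultimately obtain x where "x \<in> P" "\<And>y. y \<in> P \<Longrightarrow> norm y \<le> norm x"
    using continuous_attains_sup[of P norm] by (auto intro: continuous_on_norm_id)
  then show thesis using that norm_P by blast
qed

text \<open>On another component of the complement of P, which is bounded, the maximum principle
  applies to f^n: the frontier lies in P, which f^n maps into P, so |f^n| stays below R.\<close>

lemma G_Om: "G \<subseteq> Om"
proof
  fix z assume z: "z \<in> G"
  show "z \<in> Om"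
  proof (rule ccontr)
    assume nz: "z \<notin> Om"
    define H where "H = connected_component_set (- P) z"
    have zP: "z \<in> - P" using z G_P by blast
    have zH: "z \<in> H" unfolding H_def using zP by simp
    have Hc: "H \<in> components (- P)" unfolding H_def using zP by (simp add: componentsI)
    have small: "norm w < R" if "w \<in> H" for w
    proof (rule ccontr)
      assume "\<not> norm w < R"
      then have "w \<in> Om" using Om_far by simp
      then show False using that zH nz unfolding Om_def H_def
        by (metis connected_component_eq mem_Collect_eq)
    qed
    then have "H \<subseteq> ball 0 R" by auto
    then have bH: "bounded H" using bounded_ball bounded_subset by blast
    have fr: "frontier H \<subseteq> P" by (rule frontier_of_components_closed_complement[OF closedP Hc])
    obtain B where B: "B < R" "\<And>x. x \<in> P \<Longrightarrow> norm x \<le> B" using P_max by metis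
    have "norm ((f ^^ n) z) \<le> B" for n
      by (rule maximum_modulus_frontier[OF hol_funpow cont_funpow bH _ zH])
         (use fr funpow_P B(2) in blast)
    moreover obtain n where "R \<le> norm ((f ^^ n) z)" using z unfolding G_def by blast
    ultimately have "R \<le> B" using order_trans by blast
    then show False using B(1) by simp
  qed
qed

definition \<nu> where "\<nu> q = 2 * \<mu> q"

lemma \<nu>_ge: "q \<in> P \<inter> J \<Longrightarrow> 2 \<le> \<nu> q"
  unfolding \<nu>_def using \<mu>_pos[of q] by simp

section \<open>Cone neighbourhoods and the density omega\<close>

lemma ex_radius: "\<exists>r>0. r \<le> 1 \<and> (\<forall>q\<in>P \<inter> J. ball q r \<inter> P = {q} \<and> ball q r \<subseteq> ball 0 R)"
proof -
  have one: "\<exists>r>0. ball q r \<inter> P = {q} \<and> ball q r \<subseteq> ball 0 R" if q: "q \<in> P \<inter> J" for q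
  proof -
    have "P - {q} = (P - J) \<union> (P \<inter> J - {q})" using q by blast
    then have "closed (P - {q})" using closedF finQ by (simp add: closed_Un finite_imp_closed)
    then have "open (- (P - {q}) \<inter> ball 0 R)" by (intro open_Int open_ball open_Compl)
    moreover have "q \<in> - (P - {q}) \<inter> ball 0 R" using q Pball by auto
    ultimately obtain r where "r > 0" "ball q r \<subseteq> - (P - {q}) \<inter> ball 0 R"
      unfolding open_contains_ball by blast
    then show ?thesis using q by (intro exI[of _ r]) auto
  qed
  then obtain r where r: "\<And>q. q \<in> P \<inter> J \<Longrightarrow> r q > 0 \<and> ball q (r q) \<inter> P = {q} \<and> ball q (r q) \<subseteq> ball 0 R" by metis
  define r0 where "r0 = Min (insert 1 (r ` (P \<inter> J)))"
  have fin: "finite (insert 1 (r ` (P \<inter> J)))" using finQ by simp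
  have r0: "r0 > 0" "r0 \<le> 1" "\<And>q. q \<in> P \<inter> J \<Longrightarrow> r0 \<le> r q"
    unfolding r0_def using fin r by (auto simp: Min_gr_iff intro: Min_le)
  have "ball q r0 \<inter> P = {q} \<and> ball q r0 \<subseteq> ball 0 R" if q: "q \<in> P \<inter> J" for q
  proof -
    have "ball q r0 \<subseteq> ball q (r q)" using r0(3)[OF q] by (rule subset_ball)
    moreover have "q \<in> ball q r0" using r0(1) by simp
    ultimately show ?thesis using r[OF q] q by blast
  qed
  then show ?thesis using r0 by blast
qed

definition r0 where "r0 = (SOME r. 0 < r \<and> r \<le> 1 \<and> (\<forall>q\<in>P \<inter> J. ball q r \<inter> P = {q} \<and> ball q r \<subseteq> ball 0 R))"

lemma r0: "0 < r0" "r0 \<le> 1" "q \<in> P \<inter> J \<Longrightarrow> ball q r0 \<inter> P = {q}" "q \<in> P \<inter> J \<Longrightarrow> ball q r0 \<subseteq> ball 0 R"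
  using someI_ex[OF ex_radius] unfolding r0_def by blast+

text \<open>The power map \<open>root_disc q\<close> sends |s| < 1/8 onto the ball about q of radius
  \<open>r0 * (1/8) ^ \<nu> q\<close>. This \<open>\<delta>\<close> is smaller than all these radii
  at once, as the sum of the orders bounds each of them.\<close>

definition \<delta> where "\<delta> = r0 / 2 * (1/8) ^ (\<Sum>q\<in>P \<inter> J. \<nu> q)"

lemma \<delta>: "0 < \<delta>" "\<delta> \<le> r0 / 2" "q \<in> P \<inter> J \<Longrightarrow> \<delta> < r0 * (1/8) ^ \<nu> q"
proof -
  show "0 < \<delta>" unfolding \<delta>_def using r0 by simp
  have "(1/8 :: real) ^ (\<Sum>q\<in>P \<inter> J. \<nu> q) \<le> 1" by (rule power_le_one) auto
  then show "\<delta> \<le> r0 / 2" unfolding \<delta>_def using r0 by (simp add: mult_left_le)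
  assume q: "q \<in> P \<inter> J"
  have "\<nu> q \<le> (\<Sum>q\<in>P \<inter> J. \<nu> q)" using finQ q by (intro member_le_sum) auto
  then have "(1/8 :: real) ^ (\<Sum>q\<in>P \<inter> J. \<nu> q) \<le> (1/8) ^ \<nu> q" by (intro power_decreasing) auto
  then have "r0 / 2 * (1/8) ^ (\<Sum>q\<in>P \<inter> J. \<nu> q) \<le> r0 / 2 * (1/8) ^ \<nu> q" using r0(1) by (intro mult_left_mono) auto
  also have "\<dots> < r0 * (1/8) ^ \<nu> q" using r0(1) by (intro mult_strict_right_mono) auto
  finally show "\<delta> < r0 * (1/8) ^ \<nu> q" unfolding \<delta>_def .
qed

definition near where "near q z \<longleftrightarrow> q \<in> P \<inter> J \<and> dist q z < \<delta>"

lemma near_unique: "near q z \<Longrightarrow> near q' z \<Longrightarrow> q = q'"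
proof -
  assume n: "near q z" "near q' z"
  then have "dist q q' < r0" using dist_triangle[of q q' z] \<delta>(2) unfolding near_def by (simp add: dist_commute)
  then have "q' \<in> ball q r0 \<inter> P" using n unfolding near_def by simp
  moreover have "q \<in> P \<inter> J" using n(1) unfolding near_def by blast
  ultimately have "q' \<in> {q}" using r0(3)[of q] by blast
  then show "q = q'" by simp
qed

lemma near_norm: "near q z \<Longrightarrow> norm z < R"
  using r0(4)[of q] \<delta>(2) r0(1) unfolding near_def by (auto simp: subset_iff)

text \<open>An explicit metric \<open>|dz| / \<omega> z\<close> comparable to the hyperbolic metric of the orbifold
  \<open>(\<complex> - (P - J), \<nu>)\<close>: cone points of order \<open>\<nu> q\<close> and a puncture at infinity.\<close>

definition \<omega> where
  "\<omega> z = (if \<exists>q. near q z then norm (z - (THE q. near q z)) powr (1 - 1 / real (\<nu> (THE q. near q z)))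
          else (1 + norm z) * ln (3 + (norm z)\<^sup>2))"

lemma \<omega>_near: assumes "near q z" shows "\<omega> z = norm (z - q) powr (1 - 1 / real (\<nu> q))"
proof -
  have "(THE q. near q z) = q" using assms near_unique by blast
  then show ?thesis unfolding \<omega>_def using assms by auto
qed

lemma \<omega>_far: "(\<And>q. \<not> near q z) \<Longrightarrow> \<omega> z = (1 + norm z) * ln (3 + (norm z)\<^sup>2)"
  unfolding \<omega>_def by simp

lemma \<omega>_le: "\<omega> z \<le> (1 + norm z) * ln (3 + (norm z)\<^sup>2)"
proof (cases "\<exists>q. near q z")
  case True
  then obtain q where q: "near q z" by blast
  have "norm (z - q) \<le> 1" using q \<delta>(2) r0(2) unfolding near_def by (simp add: dist_norm norm_minus_commute)
  then have "norm (z - q) powr (1 - 1 / real (\<nu> q)) \<le> 1 powr (1 - 1 / real (\<nu> q))"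
    using \<nu>_ge[of q] q unfolding near_def by (intro powr_mono2) auto
  then have "\<omega> z \<le> 1 * 1" using \<omega>_near[OF q] by simp
  also have "\<dots> \<le> (1 + norm z) * ln (3 + (norm z)\<^sup>2)" by (rule mult_mono) (use ln3_ge in auto)
  finally show ?thesis .
qed (simp add: \<omega>_far)

lemma \<omega>_ge: assumes "\<And>q. \<not> near q z" shows "1 + norm z \<le> \<omega> z" "1 \<le> \<omega> z" "(1 + norm z) * ln (3 + (norm z)\<^sup>2) \<le> \<omega> z"
proof -
  have "(1 + norm z) * 1 \<le> (1 + norm z) * ln (3 + (norm z)\<^sup>2)" by (rule mult_left_mono[OF ln3_ge]) auto
  then show "1 + norm z \<le> \<omega> z" using \<omega>_far[OF assms] by simp
  then show "1 \<le> \<omega> z" using norm_ge_zero[of z] by linarith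
  show "(1 + norm z) * ln (3 + (norm z)\<^sup>2) \<le> \<omega> z" using \<omega>_far[OF assms] by simp
qed

lemma \<omega>_pos: "z \<notin> P \<Longrightarrow> 0 < \<omega> z"
proof (cases "\<exists>q. near q z")
  case True
  assume "z \<notin> P"
  obtain q where q: "near q z" using True by blast
  then have "z \<noteq> q" using \<open>z \<notin> P\<close> unfolding near_def by blast
  then show ?thesis using \<omega>_near[OF q] by simp
next
  case False
  then show ?thesis using \<omega>_ge(2)[of z] by fastforce
qed

text \<open>Two kinds of parametrised discs around \<open>\<eta> s0\<close>: discs off P, and
  branched discs, where the branch point s0 = 0 is excluded. The bound 1/8 is the one in
  \<open>lift_lipschitz\<close>.\<close>

definition chart :: "(complex \<Rightarrow> complex) \<Rightarrow> complex \<Rightarrow> bool" where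
  "chart \<eta> s0 \<longleftrightarrow> norm s0 \<le> 1/8 \<and> \<eta> holomorphic_on ball 0 1 \<and>
     ((\<forall>s\<in>ball 0 1. \<eta> s \<notin> P) \<or> (orbidisc \<eta> \<and> s0 \<noteq> 0))"

definition root_disc where "root_disc q s = q + of_real r0 * s ^ \<nu> q"

lemma orbidisc_root_disc:
  assumes q: "q \<in> P \<inter> J" shows "orbidisc (root_disc q)"
  unfolding orbidisc_def
proof (intro conjI)
  have \<nu>: "2 \<le> \<nu> q" by (rule \<nu>_ge[OF q])
  then have q0: "root_disc q 0 = q" unfolding root_disc_def by (simp add: power_0_left)
  show "root_disc q holomorphic_on ball 0 1" unfolding root_disc_def by (intro holomorphic_intros)
  show "root_disc q 0 \<in> J" using q0 q by simp
  show "\<forall>s\<in>ball 0 1 - {0}. root_disc q s \<notin> P"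
  proof
    fix s assume s: "s \<in> ball (0::complex) 1 - {0}"
    have "norm s ^ \<nu> q < 1" using s \<nu> by (intro power_less_one_iff[THEN iffD2]) auto
    then have "r0 * norm s ^ \<nu> q < r0" using r0(1) by simp
    then have "root_disc q s \<in> ball q r0" unfolding root_disc_def using r0(1) by (simp add: dist_norm norm_mult norm_power)
    moreover have "root_disc q s \<noteq> q" unfolding root_disc_def using s r0(1) by simp
    ultimately show "root_disc q s \<notin> P" using r0(3)[OF q] by blast
  qed
  show "\<exists>k g. g holomorphic_on ball 0 1 \<and> (\<forall>s\<in>ball 0 1. g s \<noteq> 0 \<and> root_disc q s - root_disc q 0 = s ^ k * g s) \<and>
        0 < k \<and> 2 * \<mu> (root_disc q 0) dvd k"
    unfolding q0
    using \<nu> r0(1) by (intro exI[of _ "\<nu> q"] exI[of _ "\<lambda>_. of_real r0"]) (auto simp: root_disc_def \<nu>_def)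
qed

lemma root_disc_point:
  assumes q: "q \<in> P \<inter> J" and w: "dist q w < \<delta>" "w \<noteq> q"
  obtains s where "root_disc q s = w" "norm s < 1/8" "s \<noteq> 0" "norm (w - q) = r0 * norm s ^ \<nu> q"
proof -
  define s where "s = exp (Ln ((w - q) / of_real r0) / of_nat (\<nu> q))"
  have \<nu>: "2 \<le> \<nu> q" by (rule \<nu>_ge[OF q])
  have "s ^ \<nu> q = exp (of_nat (\<nu> q) * (Ln ((w - q) / of_real r0) / of_nat (\<nu> q)))"
    unfolding s_def by (rule exp_of_nat_mult[symmetric])
  also have "\<dots> = (w - q) / of_real r0" using \<nu> w(2) r0(1) by simp
  finally have sp: "s ^ \<nu> q = (w - q) / of_real r0" .
  then have 1: "root_disc q s = w" unfolding root_disc_def using r0(1) by simp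
  have "norm s ^ \<nu> q = norm (w - q) / r0" using sp r0(1) by (metis norm_power norm_divide norm_of_real abs_of_pos)
  then have 2: "norm (w - q) = r0 * norm s ^ \<nu> q" using r0(1) by simp
  have "norm (w - q) < r0 * (1/8) ^ \<nu> q" using w(1) \<delta>(3)[OF q] by (simp add: dist_norm norm_minus_commute)
  then have "r0 * norm s ^ \<nu> q < r0 * (1/8) ^ \<nu> q" unfolding 2 .
  then have "norm s ^ \<nu> q < (1/8) ^ \<nu> q" using r0(1) mult_less_cancel_left_pos by blast
  then have "norm s < 1/8" by (rule power_less_imp_less_base) simp
  then show thesis using that 1 2 unfolding s_def by auto
qed

text \<open>The power map of order \<open>\<nu> q\<close> carries the Euclidean metric, up to a
  constant factor on the Euclidean circles about q, to |dw| / |w - q|^(1 - 1/nu); this is the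
  density near q.\<close>

lemma root_disc_deriv:
  assumes q: "q \<in> P \<inter> J" and s: "norm (w - q) = r0 * norm s ^ \<nu> q" "s \<noteq> 0" "near q w"
  shows "\<omega> w \<le> norm (deriv (root_disc q) s) / r0"
proof -
  have \<nu>: "2 \<le> \<nu> q" by (rule \<nu>_ge[OF q])
  have "(root_disc q has_field_derivative of_real r0 * (of_nat (\<nu> q) * s ^ (\<nu> q - 1))) (at s)"
    unfolding root_disc_def by (auto intro!: derivative_eq_intros)
  then have "norm (deriv (root_disc q) s) = r0 * (real (\<nu> q) * norm s ^ (\<nu> q - 1))"
    using r0(1) by (simp add: DERIV_imp_deriv norm_mult norm_power)
  moreover have "norm s ^ (\<nu> q - 1) \<le> real (\<nu> q) * norm s ^ (\<nu> q - 1)"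
    using \<nu> by (intro mult_le_cancel_right1[THEN iffD2]) auto
  ultimately have 1: "norm s ^ (\<nu> q - 1) \<le> norm (deriv (root_disc q) s) / r0" using r0(1) by (simp add: field_simps)
  have "\<omega> w = (r0 * norm s ^ \<nu> q) powr (1 - 1 / real (\<nu> q))" using \<omega>_near[OF s(3)] s(1) by simp
  also have "\<dots> \<le> (norm s ^ \<nu> q) powr (1 - 1 / real (\<nu> q))"
    using r0 \<nu> by (intro powr_mono2 mult_left_le_one_le) auto
  also have "\<dots> = norm s powr (real (\<nu> q) * (1 - 1 / real (\<nu> q)))"
    using s(2) by (simp add: powr_powr flip: powr_realpow)
  also have "real (\<nu> q) * (1 - 1 / real (\<nu> q)) = real (\<nu> q - 1)" using \<nu> by (simp add: right_diff_distrib of_nat_diff)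
  also have "norm s powr real (\<nu> q - 1) = norm s ^ (\<nu> q - 1)" using s(2) by (simp add: powr_realpow)
  finally show ?thesis using 1 by linarith
qed

text \<open>Near a cone point the power map serves. On the compact rest of the disc of radius R1
  round discs of fixed radius do, since N keeps G away from P - J. Farther out it is w * exp (Lambda
  s), whose values stay outside radius R and whose derivative is of order |w| ln |w|.\<close>

lemma ex_chart:
  obtains c where "0 < c" "\<And>w. w \<in> G \<Longrightarrow> \<exists>\<eta> s0. chart \<eta> s0 \<and> \<eta> s0 = w \<and> c * \<omega> w \<le> norm (deriv \<eta> s0)"
proof -
  obtain N where N: "open N" "P - J \<subseteq> N" "\<And>z n. z \<in> N \<Longrightarrow> norm ((f ^^ n) z) < R" using trapped by blast
  have NG: "N \<inter> G = {}" using N(3) unfolding G_def by (auto simp: not_le[symmetric])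
  \<comment> \<open>Beyond R1 one has ln R <= ln |w| / 2, so Lambda is at least half of ln |w|; and
    R1 >= 9 gives 3 + |w|^2 <= |w|^3.\<close>
  define R1 where "R1 = (R + 3)\<^sup>2"
  have R1: "R < R1" "9 \<le> R1" unfolding R1_def using Rpos by (auto simp: power2_eq_square algebra_simps add_pos_pos)
  define K where "K = cball 0 R1 - N - (\<Union>q\<in>P \<inter> J. ball q \<delta>)"
  have "compact K" unfolding K_def using N(1) by (intro compact_diff compact_cball open_UN ballI) auto
  moreover have "K \<inter> P = {}" unfolding K_def using N(2) \<delta>(1) by fastforce
  ultimately obtain \<rho> where \<rho>: "\<rho> > 0" "\<And>x y. x \<in> K \<Longrightarrow> y \<in> P \<Longrightarrow> \<rho> \<le> dist x y"
    using separate_compact_closed[OF _ closedP] by metis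
  define W where "W = (1 + R1) * ln (3 + R1\<^sup>2)"
  have W: "W > 0" unfolding W_def using R1 ln3_ge[of R1] by (intro mult_pos_pos) auto
  \<comment> \<open>One term for each region; in the outer one \<open>\<omega> w\<close> is at most
    2 |w| * 6 Lambda, and 12/16 < 1.\<close>
  define c where "c = min r0 (min (\<rho> / W) (1 / 16))"
  have c: "0 < c" "c \<le> r0" "c \<le> \<rho> / W" unfolding c_def using r0(1) \<rho>(1) W by auto
  have c16: "c \<le> 1/16" unfolding c_def min.assoc[symmetric] by (rule min.cobounded2)
  have "\<exists>\<eta> s0. chart \<eta> s0 \<and> \<eta> s0 = w \<and> c * \<omega> w \<le> norm (deriv \<eta> s0)" if w: "w \<in> G" for w
  proof -
    have wP: "w \<notin> P" using w G_P by blast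
    have w0: "0 < \<omega> w" by (rule \<omega>_pos[OF wP])
    consider q where "near q w" | "\<And>q. \<not> near q w" "norm w \<le> R1" | "\<And>q. \<not> near q w" "R1 < norm w" by fastforce
    then show ?thesis
    proof cases
      case (1 q)
      then have q: "q \<in> P \<inter> J" "dist q w < \<delta>" "w \<noteq> q" using wP unfolding near_def by auto
      obtain s where s: "root_disc q s = w" "norm s < 1/8" "s \<noteq> 0" "norm (w - q) = r0 * norm s ^ \<nu> q"
        using root_disc_point[OF q] by metis
      have "chart (root_disc q) s"
        unfolding chart_def using s orbidisc_root_disc[OF q(1)] unfolding orbidisc_def by auto
      moreover have "c * \<omega> w \<le> norm (deriv (root_disc q) s)"
      proof -
        have "c * \<omega> w \<le> r0 * (norm (deriv (root_disc q) s) / r0)"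
          by (rule mult_mono) (use c root_disc_deriv[OF q(1) s(4,3) 1] w0 r0 in auto)
        then show ?thesis using r0(1) by simp
      qed
      ultimately show ?thesis using s(1) by blast
    next
      case 2
      have "w \<in> K" unfolding K_def using 2 w NG by (auto simp: near_def)
      then have dis: "ball w \<rho> \<inter> P = {}" using \<rho>(2) by fastforce
      define \<eta> where "\<eta> s = w + of_real \<rho> * s" for s
      have "\<eta> s \<in> ball w \<rho>" if "s \<in> ball 0 1" for s
        unfolding \<eta>_def using that \<rho>(1) by (simp add: dist_norm norm_mult)
      then have "\<forall>s\<in>ball 0 1. \<eta> s \<notin> P" using dis by blast
      moreover have "\<eta> holomorphic_on ball 0 1" unfolding \<eta>_def by (intro holomorphic_intros)
      ultimately have "chart \<eta> 0" unfolding chart_def by simp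
      moreover have "c * \<omega> w \<le> norm (deriv \<eta> 0)"
      proof -
        have "\<omega> w \<le> (1 + norm w) * ln (3 + (norm w)\<^sup>2)" by (rule \<omega>_le)
        also have "\<dots> \<le> W" unfolding W_def
          by (rule mult_mono) (use 2(2) R1 ln3_ge[of "norm w"] in \<open>auto intro!: ln_mono power_mono simp: add_pos_nonneg\<close>)
        finally have "c * \<omega> w \<le> \<rho> / W * W" using c w0 W \<rho>(1) by (intro mult_mono) auto
        moreover have "(\<eta> has_field_derivative of_real \<rho>) (at 0)" unfolding \<eta>_def by (auto intro!: derivative_eq_intros)
        ultimately show ?thesis using W \<rho>(1) by (simp add: DERIV_imp_deriv)
      qed
      ultimately show ?thesis by (intro exI[of _ \<eta>] exI[of _ 0]) (simp add: \<eta>_def)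
    next
      case 3
      define \<Lambda> where "\<Lambda> = ln (norm w) - ln R"
      have nw: "0 < norm w" "3 < norm w" using 3 R1 by auto
      have "R < norm w" using 3(2) R1(1) by linarith
      then have "ln R < ln (norm w)" using Rpos nw(1) by (subst ln_less_cancel_iff) auto
      then have \<Lambda>: "\<Lambda> > 0" unfolding \<Lambda>_def by simp
      define \<eta> where "\<eta> s = w * exp (of_real \<Lambda> * s)" for s
      have "\<eta> s \<notin> P" if "s \<in> ball 0 1" for s
      proof
        assume "\<eta> s \<in> P"
        then have "norm (\<eta> s) < R" by (rule norm_P)
        moreover have "norm (\<eta> s) = norm w * exp (\<Lambda> * Re s)" unfolding \<eta>_def by (simp add: norm_mult)
        moreover have "- 1 < Re s" using that abs_Re_le_cmod[of s] by auto
        then have "- \<Lambda> < \<Lambda> * Re s" using \<Lambda> mult_strict_left_mono[of "-1" "Re s" \<Lambda>] by simp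
        then have "norm w * exp (- \<Lambda>) < norm w * exp (\<Lambda> * Re s)" using nw by simp
        moreover have "norm w * exp (- \<Lambda>) = R" unfolding \<Lambda>_def using nw Rpos by (simp add: exp_diff)
        ultimately show False by simp
      qed
      moreover have "\<eta> holomorphic_on ball 0 1" unfolding \<eta>_def by (intro holomorphic_intros)
      ultimately have "chart \<eta> 0" unfolding chart_def by simp
      moreover have "c * \<omega> w \<le> norm (deriv \<eta> 0)"
      proof -
        have "(\<eta> has_field_derivative w * of_real \<Lambda>) (at 0)" unfolding \<eta>_def by (auto intro!: derivative_eq_intros)
        then have d: "norm (deriv \<eta> 0) = norm w * \<Lambda>" using \<Lambda> by (simp add: DERIV_imp_deriv norm_mult)
        have "ln R \<le> ln (R + 3)" using Rpos by (subst ln_le_cancel_iff) auto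
        moreover have "2 * ln (R + 3) \<le> ln (norm w)"
        proof -
          have "2 * ln (R + 3) = ln R1" unfolding R1_def using Rpos by (simp add: ln_realpow)
          also have "\<dots> \<le> ln (norm w)" using 3 R1 by (subst ln_le_cancel_iff) auto
          finally show ?thesis .
        qed
        ultimately have "2 * ln R \<le> ln (norm w)" by argo
        then have \<Lambda>2: "ln (norm w) \<le> 2 * \<Lambda>" unfolding \<Lambda>_def by argo
        have "3 + (norm w)\<^sup>2 \<le> norm w ^ 3"
        proof -
          have "9 \<le> norm w" using 3 R1 by simp
          then have "9 * (norm w)\<^sup>2 \<le> norm w * (norm w)\<^sup>2" by (rule mult_right_mono) simp
          then have "9 * (norm w)\<^sup>2 \<le> norm w ^ 3" by (simp add: power2_eq_square power3_eq_cube)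
          moreover have "1 \<le> (norm w)\<^sup>2" using nw by (intro one_le_power) simp
          ultimately show ?thesis by linarith
        qed
        then have "ln (3 + (norm w)\<^sup>2) \<le> ln (norm w ^ 3)" by (intro ln_mono) (auto simp: add_pos_nonneg)
        also have "\<dots> = 3 * ln (norm w)" using nw by (simp add: ln_realpow)
        finally have l3: "ln (3 + (norm w)\<^sup>2) \<le> 6 * \<Lambda>" using \<Lambda>2 by linarith
        have "\<omega> w \<le> (1 + norm w) * ln (3 + (norm w)\<^sup>2)" by (rule \<omega>_le)
        also have "\<dots> \<le> (2 * norm w) * (6 * \<Lambda>)"
          by (rule mult_mono[OF _ l3]) (use nw ln3_ge[of "norm w"] in linarith)+
        finally have "\<omega> w \<le> 12 * (norm w * \<Lambda>)" by (simp add: mult_ac)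
        then have "c * \<omega> w \<le> 1/16 * (12 * (norm w * \<Lambda>))" using c c16 w0 by (intro mult_mono) auto
        also have "\<dots> \<le> norm w * \<Lambda>" using nw \<Lambda> by simp
        finally show ?thesis unfolding d .
      qed
      ultimately show ?thesis by (intro exI[of _ \<eta>] exI[of _ 0]) (simp add: \<eta>_def)
    qed
  qed
  then show thesis using that c(1) by blast
qed

text \<open>A chart meets P at most at its centre, so a lift under f^n with n >= 1 meets f^-1(P) at
  most at its own centre h 0, and there with order divisible by \<open>\<nu> (h 0)\<close>. A root
  of h - q exists for this reason if q = h 0, and because q is omitted on the disc
  otherwise.\<close>

lemma chart_lift:
  assumes ch: "chart \<eta> s0" and n: "1 \<le> n" and z: "(f ^^ n) z = \<eta> s0"
  obtains h where "h holomorphic_on ball 0 1" "h s0 = z" "\<And>s. s \<in> ball 0 1 \<Longrightarrow> (f ^^ n) (h s) = \<eta> s"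
    "\<And>x. f x \<in> P \<Longrightarrow> x \<in> h ` ball 0 1 \<Longrightarrow> even_at h (ball 0 1) x"
    "\<And>x y. f x \<in> P \<Longrightarrow> f y \<in> P \<Longrightarrow> x \<in> h ` ball 0 1 \<Longrightarrow> y \<in> h ` ball 0 1 \<Longrightarrow> x = y"
    "\<And>q. q \<in> P \<inter> J \<Longrightarrow> \<exists>u. u holomorphic_on ball 0 1 \<and> (\<forall>s\<in>ball 0 1. h s - q = u s ^ \<nu> q)"
proof -
  have s0: "s0 \<in> ball 0 1" using ch unfolding chart_def by auto
  have iterP: "(f ^^ n) x \<in> P" if "f x \<in> P" for x
    using funpow_P[OF that, of "n - 1"] n by (metis Suc_pred' funpow_Suc_right comp_apply less_eq_Suc_le One_nat_def)
  have root: "\<exists>u. u holomorphic_on ball 0 1 \<and> (\<forall>s\<in>ball 0 1. h s - q = u s ^ \<nu> q)"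
    if "h holomorphic_on ball 0 1" "q \<in> P \<inter> J" "q \<notin> h ` ball 0 1" for h q
  proof -
    have 1: "(\<lambda>s. h s - q) holomorphic_on ball 0 1" using that(1) by (intro holomorphic_intros)
    have 2: "h s - q \<noteq> 0" if "s \<in> ball 0 1" for s using \<open>q \<notin> h ` ball 0 1\<close> that by auto
    have 3: "0 < \<nu> q" using \<nu>_ge[OF that(2)] by simp
    obtain u where u: "u holomorphic_on ball 0 1" "\<And>s. s \<in> ball 0 1 \<Longrightarrow> u s ^ \<nu> q = h s - q" "\<And>s. s \<in> ball 0 1 \<Longrightarrow> u s \<noteq> 0"
      using holomorphic_root[OF 1 2 3] by metis
    then show ?thesis by (intro exI[of _ u]) simp
  qed
  show thesis
  proof (cases "\<forall>s\<in>ball 0 1. \<eta> s \<notin> P")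
    case True
    have hol\<eta>: "\<eta> holomorphic_on ball 0 1" using ch unfolding chart_def by blast
    obtain h where h: "h holomorphic_on ball 0 1" "h s0 = z" "\<And>s. s \<in> ball 0 1 \<Longrightarrow> (f ^^ n) (h s) = \<eta> s"
      by (rule iter_lift[OF open_ball convex_imp_simply_connected[OF convex_ball] hol\<eta> _ s0]) (use True z in auto)
    have om: "x \<notin> h ` ball 0 1" if "f x \<in> P" for x
      using iterP[OF that] h(3) True by auto
    show thesis
      by (rule that[OF h]) (use om root[OF h(1)] invP in blast)+
  next
    case False
    then have orb: "orbidisc \<eta>" and "s0 \<noteq> 0" using ch unfolding chart_def by auto
    obtain h where h: "orbidisc h" "h s0 = z" "\<And>s. s \<in> ball 0 1 \<Longrightarrow> (f ^^ n) (h s) = \<eta> s"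
      using orbidisc_iter_lift[OF orb s0 \<open>s0 \<noteq> 0\<close> z] by metis
    have hol: "h holomorphic_on ball 0 1" using h(1) unfolding orbidisc_def by blast
    obtain k g where kg: "g holomorphic_on ball 0 1" "\<And>s. s\<in>ball 0 1 \<Longrightarrow> g s \<noteq> 0"
       "\<And>s. s\<in>ball 0 1 \<Longrightarrow> h s - h 0 = s ^ k * g s" "0 < k" "2 * \<mu> (h 0) dvd k"
      using h(1) unfolding orbidisc_def by auto
    have hit: "s = 0" if "s \<in> ball 0 1" "f (h s) \<in> P" for s
    proof (rule ccontr)
      assume "s \<noteq> 0"
      then have "\<eta> s \<notin> P" using orb that(1) unfolding orbidisc_def by auto
      then show False using iterP[OF that(2)] h(3)[OF that(1)] by simp
    qed
    have x0: "x = h 0" if "f x \<in> P" "x \<in> h ` ball 0 1" for x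
    proof -
      obtain s where "s \<in> ball 0 1" "x = h s" using \<open>x \<in> h ` ball 0 1\<close> by blast
      then show ?thesis using hit[of s] \<open>f x \<in> P\<close> by simp
    qed
    have pow_root: "\<exists>u. u holomorphic_on ball 0 1 \<and> (\<forall>s\<in>ball 0 1. h s - h 0 = u s ^ m)" if m: "m dvd k" for m
    proof -
      obtain j where j: "k = m * j" using m by (elim dvdE)
      then have m0: "0 < m" using kg(4) by (cases "m = 0") auto
      obtain u where u: "u holomorphic_on ball 0 1" "\<And>s. s \<in> ball 0 1 \<Longrightarrow> u s ^ m = g s" "\<And>s. s \<in> ball 0 1 \<Longrightarrow> u s \<noteq> 0"
        using holomorphic_root[OF kg(1,2) m0] by metis
      have "(\<lambda>s. s ^ j * u s) holomorphic_on ball 0 1" by (intro holomorphic_intros u)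
      moreover have "h s - h 0 = (s ^ j * u s) ^ m" if "s \<in> ball 0 1" for s
        using kg(3)[OF that] u(2)[OF that] unfolding j by (simp add: power_mult_distrib power_mult[symmetric] mult.commute)
      ultimately show ?thesis by (intro exI[of _ "\<lambda>s. s ^ j * u s"]) simp
    qed
    show thesis
    proof (rule that[OF hol h(2,3)])
      show "even_at h (ball 0 1) x" if "f x \<in> P" "x \<in> h ` ball 0 1" for x
        using pow_root[OF dvd_mult_left[OF kg(5)]] unfolding even_at_def x0[OF that] by simp
      show "x = y" if "f x \<in> P" "f y \<in> P" "x \<in> h ` ball 0 1" "y \<in> h ` ball 0 1" for x y
        using x0[OF that(1,3)] x0[OF that(2,4)] by simp
      show "\<exists>u. u holomorphic_on ball 0 1 \<and> (\<forall>s\<in>ball 0 1. h s - q = u s ^ \<nu> q)" if q: "q \<in> P \<inter> J" for q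
      proof (cases "q \<in> h ` ball 0 1")
        case True
        then have "q = h 0" using x0 q invP by blast
        then show ?thesis using pow_root[of "\<nu> q"] kg(5) unfolding \<nu>_def by simp
      qed (use root[OF hol q] in blast)
    qed
  qed
qed

lemma chart_lift_deriv:
  assumes "chart \<eta> s0" "h holomorphic_on ball 0 1" "h s0 = z" "\<And>s. s \<in> ball 0 1 \<Longrightarrow> (f ^^ n) (h s) = \<eta> s"
  shows "norm (deriv \<eta> s0) = norm (deriv (f ^^ n) z) * norm (deriv h s0)"
proof -
  have s0: "s0 \<in> ball 0 1" using assms(1) unfolding chart_def by auto
  have "((f ^^ n) \<circ> h has_field_derivative deriv (f ^^ n) (h s0) * deriv h s0) (at s0)"
    by (rule DERIV_chain[OF holomorphic_derivI[OF hol_funpow open_UNIV UNIV_I] holomorphic_derivI[OF assms(2) open_ball s0]])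
  then have "(\<eta> has_field_derivative deriv (f ^^ n) (h s0) * deriv h s0) (at s0)"
    by (rule has_field_derivative_transform_within_open[OF _ open_ball s0]) (use assms(4) in simp)
  then show ?thesis using assms(3) by (simp add: DERIV_imp_deriv norm_mult)
qed

text \<open>The contraction factor, in the metric |dz| / \<open>\<omega> z\<close>, of the inverse
  branch of f^n that takes f^n z to z.\<close>

definition ratio where "ratio n z = \<omega> ((f ^^ n) z) / (norm (deriv (f ^^ n) z) * \<omega> z)"

lemma deriv_funpow_add: "deriv (f ^^ (m + n)) z = deriv (f ^^ m) ((f ^^ n) z) * deriv (f ^^ n) z"
proof -
  have "deriv ((f ^^ m) \<circ> (f ^^ n)) z = deriv (f ^^ m) ((f ^^ n) z) * deriv (f ^^ n) z"
    by (rule deriv_chain)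
       (use hol_funpow in \<open>auto intro!: holomorphic_on_imp_differentiable_at[OF _ open_UNIV]\<close>)
  then show ?thesis by (simp add: funpow_add)
qed

lemma ratio_add:
  assumes "(f ^^ (m + n)) z \<notin> P"
  shows "ratio (m + n) z = ratio m ((f ^^ n) z) * ratio n z"
proof -
  have "(f ^^ n) z \<notin> P" using iter_not_P[OF assms, of n] by simp
  then have "\<omega> ((f ^^ n) z) > 0" by (rule \<omega>_pos)
  then show ?thesis unfolding ratio_def deriv_funpow_add by (simp add: funpow_add norm_mult)
qed

lemma ratio_nonneg: "(f ^^ n) z \<notin> P \<Longrightarrow> 0 \<le> ratio n z"
  unfolding ratio_def using \<omega>_pos[of z] \<omega>_pos[of "(f ^^ n) z"] iter_not_P[of n z 0] by simp

end

context subhyperbolic_disc begin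

lemma Cauchy_deriv:
  assumes "u holomorphic_on ball 0 1" "norm s0 \<le> 1/8" "\<And>s. norm s \<le> 1/4 \<Longrightarrow> norm (u s - c) \<le> B"
  shows "norm (deriv u s0) \<le> 8 * (B :: real)"
proof -
  have sub: "cball s0 (1/8) \<subseteq> cball (0::complex) (1/4)" "cball (0::complex) (1/4) \<subseteq> ball 0 1"
    using assms(2) by (auto simp: dist_norm) (smt (verit) norm_minus_commute norm_triangle_sub)
  have hol: "(\<lambda>s. u s - c) holomorphic_on ball 0 1" using assms(1) by (intro holomorphic_intros)
  have "norm ((deriv ^^ 1) (\<lambda>s. u s - c) s0) \<le> fact 1 * B / (1/8) ^ 1"
  proof (rule Cauchy_inequality)
    show "(\<lambda>s. u s - c) holomorphic_on ball s0 (1/8)"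
      using hol sub ball_subset_cball holomorphic_on_subset by (metis subset_trans)
    show "continuous_on (cball s0 (1/8)) (\<lambda>s. u s - c)"
      using hol sub holomorphic_on_imp_continuous_on continuous_on_subset by (metis subset_trans)
    show "norm (u x - c) \<le> B" if "norm (s0 - x) = 1/8" for x
      using assms(3)[of x] sub(1) that by (auto simp: subset_iff dist_norm)
  qed simp
  moreover have "deriv (\<lambda>s. u s - c) s0 = deriv u s0"
  proof -
    have "s0 \<in> ball 0 1" using assms(2) by auto
    then have "(u has_field_derivative deriv u s0) (at s0)" using assms(1) holomorphic_derivI by blast
    then have "((\<lambda>s. u s - c) has_field_derivative deriv u s0 - 0) (at s0)" by (rule DERIV_diff[OF _ DERIV_const])
    then show ?thesis by (simp add: DERIV_imp_deriv)
  qed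
  ultimately show ?thesis by simp
qed

text \<open>Differentiating h - q = u^nu gives nu * |u|^(nu - 1) * |u'|, and |u|^(nu - 1) at s0 is
  exactly \<open>\<omega> z\<close>. Relative to the density nothing degenerates at the cone
  point.\<close>

lemma near_root_deriv:
  assumes n: "near q z" and h: "h holomorphic_on ball 0 1" "h s0 = z" "norm s0 \<le> 1/8"
    and u: "u holomorphic_on ball 0 1" "\<And>s. s \<in> ball 0 1 \<Longrightarrow> h s - q = u s ^ \<nu> q"
    and B: "0 \<le> B" "\<And>s. norm s \<le> 1/4 \<Longrightarrow> norm (u s) \<le> B"
  shows "norm (deriv h s0) \<le> real (\<nu> q) * 8 * B * \<omega> z"
proof -
  have \<nu>: "2 \<le> \<nu> q" using n \<nu>_ge unfolding near_def by blast
  have s0: "s0 \<in> ball 0 1" using h(3) by auto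
  have du: "norm (deriv u s0) \<le> 8 * B"
    using Cauchy_deriv[OF u(1) h(3), of 0 B] B(2) by simp
  have "(u has_field_derivative deriv u s0) (at s0)" using u(1) s0 holomorphic_derivI by blast
  then have "((\<lambda>s. q + u s ^ \<nu> q) has_field_derivative of_nat (\<nu> q) * u s0 ^ (\<nu> q - 1) * deriv u s0) (at s0)"
    by (auto intro!: derivative_eq_intros)
  then have "(h has_field_derivative of_nat (\<nu> q) * u s0 ^ (\<nu> q - 1) * deriv u s0) (at s0)"
    by (rule has_field_derivative_transform_within_open[OF _ open_ball s0]) (simp add: u(2)[symmetric])
  then have "norm (deriv h s0) = real (\<nu> q) * norm (u s0) ^ (\<nu> q - 1) * norm (deriv u s0)"
    by (simp add: DERIV_imp_deriv norm_mult norm_power)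
  also have "norm (u s0) ^ (\<nu> q - 1) = \<omega> z"
  proof (cases "u s0 = 0")
    case True
    then have "z = q" using u(2)[OF s0] h(2) \<nu> by (simp add: power_0_left)
    then show ?thesis using \<omega>_near[OF n] True \<nu> by (simp add: power_0_left)
  next
    case False
    have "norm (z - q) = norm (u s0) ^ \<nu> q" using u(2)[OF s0] h(2) by (simp add: norm_power)
    then have "\<omega> z = norm (u s0) powr (real (\<nu> q) * (1 - 1 / real (\<nu> q)))"
      using \<omega>_near[OF n] False by (simp add: powr_powr flip: powr_realpow)
    also have "real (\<nu> q) * (1 - 1 / real (\<nu> q)) = real (\<nu> q - 1)" using \<nu> by (simp add: right_diff_distrib of_nat_diff)
    also have "norm (u s0) powr real (\<nu> q - 1) = norm (u s0) ^ (\<nu> q - 1)" using False by (simp add: powr_realpow)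
    finally show ?thesis by simp
  qed
  also have "real (\<nu> q) * \<omega> z * norm (deriv u s0) \<le> real (\<nu> q) * \<omega> z * (8 * B)"
    using du \<omega>_near[OF n] by (intro mult_left_mono) auto
  finally show ?thesis by (simp add: mult_ac)
qed

text \<open>Lifts of charts have derivative at most C * (1 + |z|), whereas \<open>\<omega> z\<close>
  has an additional logarithm away from the cone points. The second bound keeps this logarithm: it
  makes the ratio small near infinity and takes the place of compactness in
  \<open>ratio_small\<close>.\<close>

lemma ratio_bound:
  obtains C where "0 < C" "\<And>n z. 1 \<le> n \<Longrightarrow> (f ^^ n) z \<in> G \<Longrightarrow> ratio n z \<le> C"
    "\<And>n z. 1 \<le> n \<Longrightarrow> (f ^^ n) z \<in> G \<Longrightarrow> (\<And>q. \<not> near q z) \<Longrightarrow> ratio n z * ln (3 + (norm z)\<^sup>2) \<le> C"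
proof -
  obtain C where C: "0 < C" "\<And>h s0 s s'. h holomorphic_on ball 0 1 \<Longrightarrow>
     (\<And>x. f x \<in> P \<Longrightarrow> x \<in> h ` ball 0 1 \<Longrightarrow> even_at h (ball 0 1) x) \<Longrightarrow>
     (\<And>x y. f x \<in> P \<Longrightarrow> f y \<in> P \<Longrightarrow> x \<in> h ` ball 0 1 \<Longrightarrow> y \<in> h ` ball 0 1 \<Longrightarrow> x = y) \<Longrightarrow>
     norm s0 \<le> 1/8 \<Longrightarrow> norm s \<le> 1/2 \<Longrightarrow> norm s' \<le> 1/2 \<Longrightarrow>
     norm (h s) \<le> C * (1 + norm (h s0)) \<and> norm (deriv h s) \<le> C * (1 + norm (h s0)) \<and>
     norm (h s - h s') \<le> C * (1 + norm (h s0)) * norm (s - s')"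
    by (rule lift_lipschitz) blast
  obtain c where c: "0 < c" "\<And>w. w \<in> G \<Longrightarrow> \<exists>\<eta> s0. chart \<eta> s0 \<and> \<eta> s0 = w \<and> c * \<omega> w \<le> norm (deriv \<eta> s0)"
    by (rule ex_chart) blast
  \<comment> \<open>A bound for the root u of h - q: either |u| <= 1, or |u| <= |u|^nu <= |h| + |q|,
    where |z| and |q| are below R.\<close>
  define U where "U = 1 + C * (1 + R) + R"
  have U1: "1 \<le> U" unfolding U_def using C(1) Rpos by (simp add: add_nonneg_nonneg)
  define M where "M = (\<Sum>q\<in>P \<inter> J. real (\<nu> q) * 8 * U) + C"
  have M: "C \<le> M" "\<And>q. q \<in> P \<inter> J \<Longrightarrow> real (\<nu> q) * 8 * U \<le> M"
  proof -
    show "C \<le> M" unfolding M_def using U1 by (simp add: sum_nonneg)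
    fix q assume "q \<in> P \<inter> J"
    then have "real (\<nu> q) * 8 * U \<le> (\<Sum>q\<in>P \<inter> J. real (\<nu> q) * 8 * U)"
      using finQ U1 by (intro member_le_sum) auto
    then show "real (\<nu> q) * 8 * U \<le> M" unfolding M_def using C(1) by simp
  qed
  have key: "(\<forall>q. \<not> near q z \<longrightarrow> True) \<and> ratio n z \<le> M / c \<and> ((\<forall>q. \<not> near q z) \<longrightarrow> ratio n z * ln (3 + (norm z)\<^sup>2) \<le> M / c)"
    if n: "1 \<le> n" and w: "(f ^^ n) z \<in> G" for n z
  proof -
    define w' where "w' = (f ^^ n) z"
    have wP: "w' \<notin> P" "z \<notin> P" using w G_P G_iter[OF w] unfolding w'_def by blast+
    have \<omega>0: "0 < \<omega> w'" "0 < \<omega> z" using wP \<omega>_pos by blast+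
    obtain \<eta> s0 where \<eta>: "chart \<eta> s0" "\<eta> s0 = w'" "c * \<omega> w' \<le> norm (deriv \<eta> s0)"
      using c(2) w unfolding w'_def by blast
    have eqz: "(f ^^ n) z = \<eta> s0" using \<eta>(2) unfolding w'_def by simp
    obtain h where h: "h holomorphic_on ball 0 1" "h s0 = z" "\<And>s. s \<in> ball 0 1 \<Longrightarrow> (f ^^ n) (h s) = \<eta> s"
      "\<And>x. f x \<in> P \<Longrightarrow> x \<in> h ` ball 0 1 \<Longrightarrow> even_at h (ball 0 1) x"
      "\<And>x y. f x \<in> P \<Longrightarrow> f y \<in> P \<Longrightarrow> x \<in> h ` ball 0 1 \<Longrightarrow> y \<in> h ` ball 0 1 \<Longrightarrow> x = y"
      "\<And>q. q \<in> P \<inter> J \<Longrightarrow> \<exists>u. u holomorphic_on ball 0 1 \<and> (\<forall>s\<in>ball 0 1. h s - q = u s ^ \<nu> q)"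
      by (rule chart_lift[OF \<eta>(1) n eqz]) (rule that, assumption+)
    have s0: "norm s0 \<le> 1/8" using \<eta>(1) unfolding chart_def by blast
    have D: "norm (deriv (f ^^ n) z) > 0" using deriv_funpow_nz[of n z] wP(1) unfolding w'_def by simp
    have "c * \<omega> w' \<le> norm (deriv (f ^^ n) z) * norm (deriv h s0)"
      using \<eta>(3) chart_lift_deriv[OF \<eta>(1) h(1,2,3)] by simp
    then have "c * (\<omega> w' / norm (deriv (f ^^ n) z)) \<le> norm (deriv h s0)" using D by (simp add: field_simps)
    then have "\<omega> w' / norm (deriv (f ^^ n) z) \<le> norm (deriv h s0) / c" using c(1) by (simp add: field_simps)
    then have rat: "ratio n z \<le> norm (deriv h s0) / c / \<omega> z"
      unfolding ratio_def w'_def[symmetric] using \<omega>0 by (simp add: divide_right_mono flip: divide_divide_eq_left)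
    have hb: "norm (h s) \<le> C * (1 + norm z)" "norm (deriv h s) \<le> C * (1 + norm z)" if "norm s \<le> 1/2" for s
      using C(2)[OF h(1,4,5) s0 that that] h(2) by auto
    show ?thesis
    proof (cases "\<exists>q. near q z")
      case True
      then obtain q where q: "near q z" by blast
      then have qQ: "q \<in> P \<inter> J" unfolding near_def by blast
      obtain u where u: "u holomorphic_on ball 0 1" "\<And>s. s \<in> ball 0 1 \<Longrightarrow> h s - q = u s ^ \<nu> q" using h(6)[OF qQ] by blast
      have "norm (u s) \<le> U" if "norm s \<le> 1/4" for s
      proof (cases "norm (u s) \<le> 1")
        case False
        have "norm (u s) ^ 1 \<le> norm (u s) ^ \<nu> q" using False \<nu>_ge[OF qQ] by (intro power_increasing) auto
        also have "\<dots> = norm (h s - q)" using u(2)[of s] that by (simp add: norm_power)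
        also have "\<dots> \<le> norm (h s) + norm q" by (rule norm_triangle_ineq4)
        also have "\<dots> \<le> C * (1 + norm z) + norm q" using hb(1)[of s] that by simp
        also have "\<dots> \<le> C * (1 + R) + R"
          using near_norm[OF q] C(1) norm_P[of q] qQ by (intro add_mono mult_left_mono) auto
        finally show ?thesis unfolding U_def by simp
      qed (use U1 in simp)
      then have "norm (deriv h s0) \<le> real (\<nu> q) * 8 * U * \<omega> z"
        using U1 by (intro near_root_deriv[OF q h(1,2) s0 u]) auto
      also have "\<dots> \<le> M * \<omega> z" using M(2)[OF qQ] \<omega>0 by (intro mult_right_mono) auto
      finally have "norm (deriv h s0) / c / \<omega> z \<le> M / c" using c(1) \<omega>0 by (simp add: field_simps)
      then show ?thesis using rat True by auto
    next
      case False
      then have nn: "\<And>q. \<not> near q z" by blast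
      have "norm (deriv h s0) \<le> C * (1 + norm z)" using hb(2) s0 by simp
      also have "\<dots> \<le> M * (1 + norm z)" using M(1) by (intro mult_right_mono) auto
      finally have d: "norm (deriv h s0) \<le> M * (1 + norm z)" .
      define l where "l = ln (3 + (norm z)\<^sup>2)"
      have l: "1 \<le> l" unfolding l_def by (rule ln3_ge)
      have "ratio n z * l \<le> norm (deriv h s0) / c / \<omega> z * l" using rat l by (intro mult_right_mono) auto
      also have "\<dots> = norm (deriv h s0) / (1 + norm z) / c"
      proof -
        have gen: "X / c / (m * l) * l = X / m / c" if "0 < m" for X m :: real
          using that l c(1) by (simp add: field_simps)
        have "\<omega> z = (1 + norm z) * l" using \<omega>_far[OF nn] unfolding l_def .
        then show ?thesis using gen[of "1 + norm z" "norm (deriv h s0)"] by (simp add: add_pos_nonneg)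
      qed
      also have "\<dots> \<le> M / c"
        using d c(1) norm_ge_zero[of z] by (intro divide_right_mono) (auto simp: field_simps add_pos_nonneg)
      finally have 1: "ratio n z * l \<le> M / c" .
      have "0 \<le> ratio n z" using ratio_nonneg wP unfolding w'_def by blast
      then have "ratio n z * 1 \<le> ratio n z * l" using l by (intro mult_left_mono) auto
      then show ?thesis using 1 unfolding l_def by auto
    qed
  qed
  show thesis
    by (rule that[of "M / c"]) (use key M(1) C(1) c(1) in auto)
qed

lemma bounded_not_log: "bounded {z. ln (3 + (norm (z::complex))\<^sup>2) \<le> L}"
proof (rule boundedI)
  fix z :: complex assume "z \<in> {z. ln (3 + (norm z)\<^sup>2) \<le> L}"
  then have "exp (ln (3 + (norm z)\<^sup>2)) \<le> exp L" by simp
  then have "3 + (norm z)\<^sup>2 \<le> exp L" by (simp add: add_pos_nonneg)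
  moreover have "2 * norm z \<le> 1 + (norm z)\<^sup>2" using sum_squares_bound[of "norm z" 1] by simp
  ultimately show "norm z \<le> exp L" using norm_ge_zero[of z] by linarith
qed

text \<open>Smallness relative to \<open>\<omega>\<close> must survive when the points z k approach
  a cone point q. With oscillation 2 eta^2 of the lift, the case |z - q| >= eta is settled by
  \<open>\<omega> z\<close> >= eta, and the case |z - q| < eta by passing to the root of h - q,
  which is then small.\<close>

lemma small_deriv:
  assumes "\<And>k. h k holomorphic_on ball 0 1" "\<And>k. norm (s k) \<le> 1/8" "\<And>k. h k (s k) = z k"
    and ul: "uniform_limit (cball 0 (1/4)) h (\<lambda>_. c0) sequentially"
    and root: "\<And>k q. q \<in> P \<inter> J \<Longrightarrow> \<exists>u. u holomorphic_on ball 0 1 \<and> (\<forall>s\<in>ball 0 1. h k s - q = u s ^ \<nu> q)"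
    and zP: "\<And>k. z k \<notin> P" and e: "0 < e"
  shows "\<forall>\<^sub>F k in sequentially. norm (deriv (h k) (s k)) \<le> e * \<omega> (z k)"
proof -
  \<comment> \<open>A common upper bound for the cone orders. Since 4 * \<open>\<eta>\<close> <= 1/2
    below, its power with exponent 1 / M dominates those with exponent 1 /
    \<open>\<nu> q\<close>.\<close>
  define M where "M = (\<Sum>q\<in>P \<inter> J. \<nu> q) + 2"
  have M: "\<nu> q \<le> M" if "q \<in> P \<inter> J" for q
    unfolding M_def using finQ that member_le_sum[of q "P \<inter> J" \<nu>] by simp
  have M0: "0 < M" unfolding M_def by simp
  have lim0: "((\<lambda>\<eta>::real. c * \<eta>) \<longlongrightarrow> 0) (at_right 0)" for c
    by (intro tendsto_mult_right_zero tendsto_ident_at)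
  have "((\<lambda>\<eta>::real. (4 * \<eta>) powr (1 / real M)) \<longlongrightarrow> 0) (at_right 0)"
  proof (rule tendsto_zero_powrI[OF lim0 tendsto_const])
    show "\<forall>\<^sub>F \<eta>::real in at_right 0. 0 \<le> 4 * \<eta>"
      using eventually_at_right_less[of "0::real"] by eventually_elim simp
  qed (use M0 in simp)
  then have "((\<lambda>\<eta>::real. 16 * \<eta> + real M * 8 * (4 * \<eta>) powr (1 / real M)) \<longlongrightarrow> 0) (at_right 0)"
    by (intro tendsto_add_zero lim0 tendsto_mult_right_zero)
  then have "\<forall>\<^sub>F \<eta> in at_right 0. 16 * \<eta> + real M * 8 * (4 * \<eta>) powr (1 / real M) < e"
    using e by (rule order_tendstoD(2))
  then obtain b where b: "b > 0" "\<And>\<eta>::real. 0 < \<eta> \<Longrightarrow> \<eta> < b \<Longrightarrow> 16 * \<eta> + real M * 8 * (4 * \<eta>) powr (1 / real M) < e"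
    unfolding eventually_at_right_field by blast
  define \<eta> where "\<eta> = min (b / 2) (1/8)"
  have \<eta>: "0 < \<eta>" "\<eta> < b" "\<eta> \<le> 1/8" unfolding \<eta>_def using b(1) by auto
  have small: "16 * \<eta> + real M * 8 * (4 * \<eta>) powr (1 / real M) < e" by (rule b(2)[OF \<eta>(1,2)])
  have "\<forall>\<^sub>F k in sequentially. \<forall>s\<in>cball 0 (1/4). dist (h k s) c0 < \<eta>\<^sup>2"
    by (rule uniform_limitD[OF ul]) (use \<eta> in simp)
  then show ?thesis
  proof eventually_elim
    case (elim k)
    have sk: "s k \<in> cball 0 (1/4)" using assms(2)[of k] by simp
    have osc: "norm (h k x - z k) \<le> 2 * \<eta>\<^sup>2" if "norm x \<le> 1/4" for x
    proof -
      have "dist (h k x) c0 < \<eta>\<^sup>2" "dist (h k (s k)) c0 < \<eta>\<^sup>2" using elim that sk by auto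
      then show ?thesis using dist_triangle2[of "h k x" "z k" c0] assms(3)[of k] by (simp add: dist_norm)
    qed
    have d: "norm (deriv (h k) (s k)) \<le> 8 * (2 * \<eta>\<^sup>2)"
      by (rule Cauchy_deriv[OF assms(1,2) osc])
    have \<omega>0: "0 < \<omega> (z k)" by (rule \<omega>_pos[OF zP])
    have e16: "16 * \<eta> \<le> e" using small by (smt (verit) powr_ge_zero mult_nonneg_nonneg of_nat_0_le_iff)
    show ?case
    proof (cases "\<exists>q. near q (z k)")
      case False
      then have "1 \<le> \<omega> (z k)" using \<omega>_ge(2) by blast
      have "8 * (2 * \<eta>\<^sup>2) \<le> 16 * \<eta>" using \<eta> by (simp add: power2_eq_square)
      then have "norm (deriv (h k) (s k)) \<le> e * 1" using d e16 by linarith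
      also have "\<dots> \<le> e * \<omega> (z k)" using \<open>1 \<le> \<omega> (z k)\<close> e by (intro mult_left_mono) auto
      finally show ?thesis .
    next
      case True
      then obtain q where q: "near q (z k)" by blast
      then have qQ: "q \<in> P \<inter> J" unfolding near_def by blast
      have \<nu>: "2 \<le> \<nu> q" by (rule \<nu>_ge[OF qQ])
      show ?thesis
      proof (cases "\<eta> \<le> norm (z k - q)")
        case True
        have "norm (z k - q) \<le> 1" using q \<delta>(2) r0(2) unfolding near_def by (simp add: dist_norm norm_minus_commute)
        then have "norm (z k - q) powr 1 \<le> norm (z k - q) powr (1 - 1 / real (\<nu> q))"
          using True \<eta>(1) \<nu> by (intro powr_mono') auto
        then have "\<eta> \<le> \<omega> (z k)" using \<omega>_near[OF q] True \<eta>(1) by simp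
        then have "16 * \<eta> * \<eta> \<le> e * \<omega> (z k)" using e16 \<eta>(1) e by (intro mult_mono) auto
        then show ?thesis using d by (simp add: power2_eq_square)
      next
        case False
        obtain u where u: "u holomorphic_on ball 0 1" "\<And>s. s \<in> ball 0 1 \<Longrightarrow> h k s - q = u s ^ \<nu> q" using root[OF qQ] by blast
        define B where "B = (4 * \<eta>) powr (1 / real M)"
        have "norm (u x) \<le> B" if x: "norm x \<le> 1/4" for x
        proof -
          have "norm (u x) ^ \<nu> q = norm (h k x - q)" using u(2)[of x] x by (simp add: norm_power)
          also have "\<dots> \<le> norm (h k x - z k) + norm (z k - q)" using norm_triangle_ineq[of "h k x - z k" "z k - q"] by simp
          also have "\<dots> \<le> 2 * \<eta>\<^sup>2 + \<eta>" using osc[OF x] False by simp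
          also have "\<dots> \<le> 4 * \<eta>" using \<eta> by (simp add: power2_eq_square)
          finally have le: "norm (u x) ^ \<nu> q \<le> 4 * \<eta>" .
          show ?thesis
          proof (cases "u x = 0")
            case False
            have "norm (u x) = (norm (u x) ^ \<nu> q) powr (1 / real (\<nu> q))" using False \<nu> by (simp add: powr_powr flip: powr_realpow)
            also have "\<dots> \<le> (4 * \<eta>) powr (1 / real (\<nu> q))" using le \<nu> by (intro powr_mono2) auto
            also have "\<dots> \<le> (4 * \<eta>) powr (1 / real M)"
              using M[OF qQ] \<nu> \<eta> by (intro powr_mono') (auto simp: field_simps)
            finally show ?thesis unfolding B_def .
          qed (simp add: B_def)
        qed
        then have "norm (deriv (h k) (s k)) \<le> real (\<nu> q) * 8 * B * \<omega> (z k)"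
          by (intro near_root_deriv[OF q assms(1,3,2) u]) (auto simp: B_def)
        also have "\<dots> \<le> e * \<omega> (z k)"
        proof (rule mult_right_mono)
          have "real (\<nu> q) * 8 * B \<le> real M * 8 * B" using M[OF qQ] by (intro mult_right_mono) (auto simp: B_def)
          then show "real (\<nu> q) * 8 * B \<le> e" using small \<eta>(1) unfolding B_def by linarith
        qed (use \<omega>0 in simp)
        finally show ?thesis .
      qed
    qed
  qed
qed

text \<open>A Montel limit of the lifts, composed with a local inverse of \<open>\<eta>\<close> at
  1/4, is a limit of true inverse branches of f^(n k). It is constant by \<open>no_rotation\<close>,
  and the identity theorem extends this to the disc. The point 1/4 avoids 0, where
  \<open>\<eta>\<close> may be branched.\<close>

lemma lifts_shrink:
  assumes \<eta>: "\<eta> holomorphic_on ball 0 1" "\<And>s. s \<in> ball 0 1 \<Longrightarrow> s \<noteq> 0 \<Longrightarrow> \<eta> s \<notin> P" "\<eta> s1 \<in> Om" "s1 \<in> ball 0 1" "s1 \<noteq> 0"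
    and d: "deriv \<eta> (1/4) \<noteq> 0"
    and n: "strict_mono (n::nat \<Rightarrow> nat)" and h: "\<And>k. h k holomorphic_on ball 0 1"
    "\<And>k s. s \<in> ball 0 1 \<Longrightarrow> (f ^^ n k) (h k s) = \<eta> s"
    and bd: "\<And>k s. norm s \<le> 1/2 \<Longrightarrow> norm (h k s) \<le> B"
  obtains r c0 where "strict_mono (r::nat \<Rightarrow> nat)" "uniform_limit (cball 0 (1/4)) (h \<circ> r) (\<lambda>_. c0) sequentially"
proof -
  define S where "S = ball (0::complex) (1/2)"
  have S: "open S" "connected S" "S \<subseteq> ball 0 1" unfolding S_def by auto
  define \<H> where "\<H> = {g. g holomorphic_on S \<and> (\<forall>s\<in>S. norm (g s) \<le> B)}"
  have rng: "range h \<subseteq> \<H>" unfolding \<H>_def using h(1) bd S holomorphic_on_subset unfolding S_def by fastforce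
  obtain g r where g: "g holomorphic_on S" "strict_mono (r :: nat \<Rightarrow> nat)"
    "\<And>K. compact K \<Longrightarrow> K \<subseteq> S \<Longrightarrow> uniform_limit K (h \<circ> r) g sequentially"
  proof (rule Montel[of S \<H> h])
    show "\<exists>B. \<forall>h\<in>\<H>. \<forall>z\<in>K. norm (h z) \<le> B" if "compact K" "K \<subseteq> S" for K
      using that(2) unfolding \<H>_def by blast
  qed (use rng S in \<open>auto simp: \<H>_def\<close>)
  define t where "t = (1/4 :: complex)"
  have t: "t \<in> S - {0}" "t \<in> ball 0 1" "t \<noteq> 0" unfolding t_def S_def by auto
  have opS: "open (S - {0})" using S(1) by (rule open_Diff) auto
  have hol\<eta>: "\<eta> holomorphic_on S - {0}" using \<eta>(1) S(3) holomorphic_on_subset by blast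
  obtain r1 where r1: "r1 > 0" "ball t r1 \<subseteq> S - {0}" "inj_on \<eta> (ball t r1)"
    using has_complex_derivative_locally_injective[OF hol\<eta> t(1) opS] d unfolding t_def by metis
  have hol': "\<eta> holomorphic_on ball t r1" using hol\<eta> r1(2) holomorphic_on_subset by blast
  obtain \<kappa> where \<kappa>: "\<kappa> holomorphic_on \<eta> ` ball t r1" "\<And>s. s \<in> ball t r1 \<Longrightarrow> \<kappa> (\<eta> s) = s"
    using holomorphic_has_inverse[OF hol' open_ball r1(3)] by metis
  have "open (\<eta> ` ball t r1)" by (rule open_mapping_thm3[OF hol' open_ball r1(3)])
  moreover have "\<eta> t \<in> \<eta> ` ball t r1" using r1(1) by auto
  ultimately obtain \<rho> where \<rho>: "\<rho> > 0" "ball (\<eta> t) \<rho> \<subseteq> \<eta> ` ball t r1" unfolding open_contains_ball by blast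
  define W where "W = ball (\<eta> t) \<rho>"
  have \<kappa>W: "\<kappa> w \<in> ball t r1" "\<eta> (\<kappa> w) = w" if w: "w \<in> W" for w
  proof -
    obtain s where "s \<in> ball t r1" "w = \<eta> s" using \<rho>(2) w unfolding W_def by blast
    then show "\<kappa> w \<in> ball t r1" "\<eta> (\<kappa> w) = w" using \<kappa>(2) by auto
  qed
  have hol\<kappa>: "\<kappa> holomorphic_on W" using \<kappa>(1) \<rho>(2) holomorphic_on_subset unfolding W_def by blast
  have \<kappa>S: "\<kappa> w \<in> S" "\<kappa> w \<in> ball 0 1" "\<kappa> w \<noteq> 0" if "w \<in> W" for w using \<kappa>W(1)[OF that] r1(2) S(3) by blast+
  have WP: "W \<inter> P = {}" using \<kappa>S \<kappa>W(2) \<eta>(2) by force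
  have tOm: "\<eta> t \<in> Om"
  proof -
    have "connected (ball (0::complex) 1 - {0})" by (rule connected_punctured_ball) auto
    then have "connected (\<eta> ` (ball 0 1 - {0}))"
      by (intro connected_continuous_image holomorphic_on_imp_continuous_on holomorphic_on_subset[OF \<eta>(1)]) auto
    moreover have "\<eta> ` (ball 0 1 - {0}) \<subseteq> - P" using \<eta>(2) by auto
    moreover have "\<eta> s1 \<in> \<eta> ` (ball 0 1 - {0})" "\<eta> t \<in> \<eta> ` (ball 0 1 - {0})" using \<eta>(4,5) t by auto
    ultimately show ?thesis using \<eta>(3) unfolding Om_def
      by (metis connected_component_eq connected_component_maximal mem_Collect_eq subsetD)
  qed
  have comp: "(\<lambda>w. g (\<kappa> w)) holomorphic_on W" "(\<lambda>w. h k (\<kappa> w)) holomorphic_on W" for k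
    using holomorphic_on_compose_gen[OF hol\<kappa> g(1)] holomorphic_on_compose_gen[OF hol\<kappa> h(1)] \<kappa>S by (auto simp: o_def image_subset_iff simp del: mem_ball)
  have "(\<lambda>w. g (\<kappa> w)) constant_on W"
    unfolding W_def
  proof (rule no_rotation[OF tOm \<rho>(1), where n="n \<circ> r" and \<psi>="\<lambda>k w. h (r k) (\<kappa> w)"])
    show "ball (\<eta> t) \<rho> \<inter> P = {}" using WP unfolding W_def .
    show "strict_mono (n \<circ> r)" using n g(2) by (rule strict_mono_o)
    show "(\<lambda>w. h (r k) (\<kappa> w)) holomorphic_on ball (\<eta> t) \<rho>" for k using comp unfolding W_def by blast
    show "(f ^^ (n \<circ> r) k) (h (r k) (\<kappa> x)) = x" if "x \<in> ball (\<eta> t) \<rho>" for k x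
      using h(2)[OF \<kappa>S(2)] \<kappa>W(2) that unfolding W_def by simp
    show "(\<lambda>w. g (\<kappa> w)) holomorphic_on ball (\<eta> t) \<rho>" using comp unfolding W_def by blast
    show "uniform_limit K (\<lambda>k w. h (r k) (\<kappa> w)) (\<lambda>w. g (\<kappa> w)) sequentially" if K: "compact K" "K \<subseteq> ball (\<eta> t) \<rho>" for K
    proof -
      have KW: "K \<subseteq> W" using K(2) unfolding W_def .
      have "compact (\<kappa> ` K)"
        using K(1) KW hol\<kappa> by (intro compact_continuous_image holomorphic_on_imp_continuous_on holomorphic_on_subset[OF hol\<kappa>])
      moreover have "\<kappa> ` K \<subseteq> S" using KW \<kappa>S by blast
      ultimately have "uniform_limit (\<kappa> ` K) (h \<circ> r) g sequentially" by (rule g(3))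
      then show ?thesis unfolding uniform_limit_iff by simp
    qed
  qed
  then obtain c0 where c0: "\<And>w. w \<in> W \<Longrightarrow> g (\<kappa> w) = c0" unfolding constant_on_def by blast
  have inj: "inj_on \<kappa> W" using \<kappa>W(2) by (metis inj_on_inverseI)
  have "open (\<kappa> ` W)" by (rule open_mapping_thm3[OF hol\<kappa> _ inj]) (simp add: W_def)
  moreover have "\<kappa> ` W \<noteq> {}" using \<rho>(1) unfolding W_def by simp
  moreover have "\<kappa> ` W \<subseteq> S" using \<kappa>S by blast
  ultimately have gc: "g s = c0" if "s \<in> S" for s
    by (rule analytic_continuation_open[OF _ S(1) _ S(2) _ g(1), of "\<kappa> ` W" "\<lambda>_. c0"]) (use c0 that in auto)
  have cb: "cball (0::complex) (1/4) \<subseteq> S" unfolding S_def by auto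
  have "uniform_limit (cball 0 (1/4)) (h \<circ> r) g sequentially" by (rule g(3)[OF compact_cball cb])
  then have "uniform_limit (cball 0 (1/4)) (h \<circ> r) (\<lambda>_. c0) sequentially"
    by (rule uniform_limit_cong'[THEN iffD1, rotated 2]) (use gc cb in auto)
  then show thesis using that g(2) by blast
qed

end

section \<open>Exponential contraction\<close>

context subhyperbolic_disc begin

text \<open>Suppose ratios above e persist as n grows. The logarithmic gain at infinity forces the
  points z k, and the points y k one step before w k, into a bounded set; so the w k accumulate at
  some w', and one chart near w' serves for infinitely many k. Its lifts shrink to a constant by
  \<open>lifts_shrink\<close>, and \<open>small_deriv\<close> contradicts the lower bound e.\<close>

lemma ratio_small:
  assumes e: "0 < e"
  obtains n0 where "\<And>n z. n0 \<le> n \<Longrightarrow> (f ^^ n) z \<in> G \<Longrightarrow> ratio n z \<le> e"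
proof (rule ccontr)
  assume neg: "\<not> thesis"
  have ex: "\<exists>n z. m \<le> n \<and> (f ^^ n) z \<in> G \<and> e < ratio n z" for m :: nat
    using neg that[of m] by (meson not_le)
  obtain C where C: "0 < C" "\<And>n z. 1 \<le> n \<Longrightarrow> (f ^^ n) z \<in> G \<Longrightarrow> ratio n z \<le> C"
    "\<And>n z. 1 \<le> n \<Longrightarrow> (f ^^ n) z \<in> G \<Longrightarrow> (\<And>q. \<not> near q z) \<Longrightarrow> ratio n z * ln (3 + (norm z)\<^sup>2) \<le> C"
    by (rule ratio_bound) blast
  obtain C' where C': "0 < C'" "\<And>h s0 s s'. h holomorphic_on ball 0 1 \<Longrightarrow>
     (\<And>x. f x \<in> P \<Longrightarrow> x \<in> h ` ball 0 1 \<Longrightarrow> even_at h (ball 0 1) x) \<Longrightarrow>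
     (\<And>x y. f x \<in> P \<Longrightarrow> f y \<in> P \<Longrightarrow> x \<in> h ` ball 0 1 \<Longrightarrow> y \<in> h ` ball 0 1 \<Longrightarrow> x = y) \<Longrightarrow>
     norm s0 \<le> 1/8 \<Longrightarrow> norm s \<le> 1/2 \<Longrightarrow> norm s' \<le> 1/2 \<Longrightarrow>
     norm (h s) \<le> C' * (1 + norm (h s0)) \<and> norm (deriv h s) \<le> C' * (1 + norm (h s0)) \<and>
     norm (h s - h s') \<le> C' * (1 + norm (h s0)) * norm (s - s')"
    by (rule lift_lipschitz) blast
  have "\<exists>p. \<forall>k. (2 \<le> fst (p k) \<and> (f ^^ fst (p k)) (snd (p k)) \<in> G \<and> e < ratio (fst (p k)) (snd (p k))) \<and> fst (p k) < fst (p (Suc k))"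
  proof (rule dependent_nat_choice)
    obtain n z where "2 \<le> n" "(f ^^ n) z \<in> G" "e < ratio n z" using ex[of 2] by blast
    then show "\<exists>x. 2 \<le> fst x \<and> (f ^^ fst x) (snd x) \<in> G \<and> e < ratio (fst x) (snd x)" by (intro exI[of _ "(n, z)"]) simp
    fix x :: "nat \<times> complex" and k :: nat
    assume x: "2 \<le> fst x \<and> (f ^^ fst x) (snd x) \<in> G \<and> e < ratio (fst x) (snd x)"
    obtain n z where "Suc (fst x) \<le> n" "(f ^^ n) z \<in> G" "e < ratio n z" using ex[of "Suc (fst x)"] by blast
    then show "\<exists>y. (2 \<le> fst y \<and> (f ^^ fst y) (snd y) \<in> G \<and> e < ratio (fst y) (snd y)) \<and> fst x < fst y"
      using x by (intro exI[of _ "(n, z)"]) simp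
  qed
  then obtain p where p: "\<And>k. 2 \<le> fst (p k)" "\<And>k. (f ^^ fst (p k)) (snd (p k)) \<in> G"
    "\<And>k. e < ratio (fst (p k)) (snd (p k))" "\<And>k. fst (p k) < fst (p (Suc k))" by blast
  define n where "n k = fst (p k)" for k
  define z where "z k = snd (p k)" for k
  define w where "w k = (f ^^ n k) (z k)" for k
  have n2: "2 \<le> n k" and wG: "w k \<in> G" and rat: "e < ratio (n k) (z k)" for k
    unfolding n_def z_def w_def using p by auto
  have nmono: "strict_mono n" unfolding n_def by (rule strict_monoI_Suc) (use p(4) in simp)
  have zP: "z k \<notin> P" and wP: "w k \<notin> P" for k using wG[of k] G_iter[of "n k" "z k"] G_P unfolding w_def by blast+
  \<comment> \<open>Contains every x at which some ratio exceeds e / max 1 C; dividing by max 1 C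
    leaves room for splitting the ratio at y k.\<close>
  define Bad where "Bad = ball 0 R \<union> {z. ln (3 + (norm (z::complex))\<^sup>2) \<le> C * max 1 C / e}"
  have bBad: "bounded Bad" unfolding Bad_def by (intro bounded_Un[THEN iffD2] conjI bounded_ball bounded_not_log)
  have inBad: "x \<in> Bad" if "1 \<le> m" "(f ^^ m) x \<in> G" "e / max 1 C < ratio m x" for m x
  proof (cases "\<exists>q. near q x")
    case True
    then show ?thesis using near_norm unfolding Bad_def by auto
  next
    case False
    then have "ratio m x * ln (3 + (norm x)\<^sup>2) \<le> C" using C(3) that by blast
    moreover have "e / max 1 C * ln (3 + (norm x)\<^sup>2) \<le> ratio m x * ln (3 + (norm x)\<^sup>2)"
      using that(3) ln3_ge[of "norm x"] by (intro mult_right_mono) auto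
    ultimately have "e / max 1 C * ln (3 + (norm x)\<^sup>2) \<le> C" by linarith
    then have "ln (3 + (norm x)\<^sup>2) \<le> C * max 1 C / e" using e by (simp add: field_simps)
    then show ?thesis unfolding Bad_def by simp
  qed
  have zB: "z k \<in> Bad" for k
  proof (rule inBad[of "n k"])
    have "e / max 1 C \<le> e / 1" using e by (intro divide_left_mono) auto
    then show "e / max 1 C < ratio (n k) (z k)" using rat[of k] by simp
  qed (use n2[of k] wG[of k] in \<open>auto simp: w_def\<close>)
  \<comment> \<open>Boundedness of w k is obtained through y k: the ratio at z k is that of a single
    step at y k times a factor at most C, so the single step cannot contract much.\<close>
  define y where "y k = (f ^^ (n k - 1)) (z k)" for k
  have fy: "f (y k) = w k" for k
  proof -
    have "n k = Suc (n k - 1)" using n2[of k] by simp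
    then have "w k = (f ^^ Suc (n k - 1)) (z k)" unfolding w_def by simp
    then show ?thesis unfolding y_def by simp
  qed
  have yB: "y k \<in> Bad" for k
  proof (rule inBad[of 1])
    show "(f ^^ 1) (y k) \<in> G" using fy wG by simp
    have yG: "y k \<in> G" using G_iter[of 1 "y k"] fy wG by simp
    have "ratio (1 + (n k - 1)) (z k) = ratio 1 (y k) * ratio (n k - 1) (z k)"
      unfolding y_def by (rule ratio_add) (use n2[of k] wP[of k] in \<open>simp add: w_def\<close>)
    then have "e < ratio 1 (y k) * ratio (n k - 1) (z k)" using rat[of k] n2[of k] by simp
    also have "\<dots> \<le> ratio 1 (y k) * max 1 C"
    proof (rule mult_left_mono)
      have "ratio (n k - 1) (z k) \<le> C" by (rule C(2)) (use n2[of k] yG in \<open>auto simp: y_def\<close>)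
      then show "ratio (n k - 1) (z k) \<le> max 1 C" by simp
      show "0 \<le> ratio 1 (y k)" by (rule ratio_nonneg) (use fy wP in simp)
    qed
    finally show "e / max 1 C < ratio 1 (y k)" using C(1) by (simp add: field_simps max_def split: if_splits)
  qed simp
  have cK: "compact (f ` closure Bad)"
    using bBad by (intro compact_continuous_image contf) (simp add: compact_closure)
  have wK: "w k \<in> f ` closure Bad" for k
  proof -
    have "y k \<in> closure Bad" using yB[of k] closure_subset by (rule subsetD[rotated])
    then show ?thesis unfolding fy[of k, symmetric] by (rule imageI)
  qed
  have "\<exists>l\<in>f ` closure Bad. \<exists>r. strict_mono r \<and> (w \<circ> r) \<longlonglongrightarrow> l"
    by (rule cK[unfolded compact_def, THEN spec[of _ w], THEN mp]) (intro allI wK)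
  then obtain w' r where r: "strict_mono r" "(w \<circ> r) \<longlonglongrightarrow> w'" by blast
  obtain Z where Z: "\<And>k. norm (z k) \<le> Z" using bBad zB unfolding bounded_iff by blast
  obtain N where N: "open N" "P - J \<subseteq> N" "\<And>z n. z \<in> N \<Longrightarrow> norm ((f ^^ n) z) < R" using trapped by blast
  have "w' \<notin> N"
  proof
    assume "w' \<in> N"
    then have "\<forall>\<^sub>F k in sequentially. (w \<circ> r) k \<in> N" using r(2) N(1) topological_tendstoD by blast
    then obtain k where "w (r k) \<in> N" unfolding eventually_sequentially by auto
    then show False using wG[of "r k"] N(3) unfolding G_def by (auto simp: not_le[symmetric])
  qed
  then have w'PQ: "w' \<notin> P \<or> w' \<in> P \<inter> J" using N(2) by blast
  have w_in: "\<forall>\<^sub>F k in sequentially. dist w' (w (r k)) < x" if "0 < x" for x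
    using r(2) that unfolding tendsto_iff by (simp add: dist_commute)
  \<comment> \<open>The charts of \<open>ex_chart\<close> vary with k, whereas
    \<open>lifts_shrink\<close> needs a fixed parametrisation; so a chart is placed at the limit w'
    and the w k become its values.\<close>
  have "\<exists>\<eta> A. \<eta> holomorphic_on ball 0 1 \<and> (\<forall>s\<in>ball 0 1 - {0}. \<eta> s \<notin> P) \<and> deriv \<eta> (1/4) \<noteq> 0 \<and> 0 < A \<and>
     (\<forall>\<^sub>F k in sequentially. \<exists>s. chart \<eta> s \<and> \<eta> s = w (r k) \<and> \<omega> (w (r k)) \<le> A * norm (deriv \<eta> s))"
  proof (cases "w' \<in> P \<inter> J")
    case True
    have nq: "2 \<le> \<nu> w'" by (rule \<nu>_ge[OF True])
    have "(root_disc w' has_field_derivative of_real r0 * (of_nat (\<nu> w') * (1/4) ^ (\<nu> w' - 1))) (at (1/4))"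
      unfolding root_disc_def by (auto intro!: derivative_eq_intros)
    then have d4: "deriv (root_disc w') (1/4) \<noteq> 0" using r0(1) nq by (simp add: DERIV_imp_deriv)
    have orb: "orbidisc (root_disc w')" by (rule orbidisc_root_disc[OF True])
    then have hol: "root_disc w' holomorphic_on ball 0 1" "\<forall>s\<in>ball 0 1 - {0}. root_disc w' s \<notin> P"
      unfolding orbidisc_def by blast+
    have "\<forall>\<^sub>F k in sequentially. \<exists>s. chart (root_disc w') s \<and> root_disc w' s = w (r k) \<and>
        \<omega> (w (r k)) \<le> (1 / r0) * norm (deriv (root_disc w') s)"
      using w_in[OF \<delta>(1)]
    proof eventually_elim
      case (elim k)
      have "w (r k) \<noteq> w'" using wP[of "r k"] True by auto
      then obtain s where s: "root_disc w' s = w (r k)" "norm s < 1/8" "s \<noteq> 0" "norm (w (r k) - w') = r0 * norm s ^ \<nu> w'"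
        using root_disc_point[OF True elim] by metis
      have "\<omega> (w (r k)) \<le> norm (deriv (root_disc w') s) / r0"
        by (rule root_disc_deriv[OF True s(4,3)]) (use True elim in \<open>simp add: near_def\<close>)
      moreover have "chart (root_disc w') s" unfolding chart_def using s orb hol by simp
      ultimately show ?case using s(1) by (intro exI[of _ s]) simp
    qed
    then show ?thesis using d4 hol r0(1) by (intro exI[of _ "root_disc w'"] exI[of _ "1 / r0"]) simp
  next
    case False
    then have "w' \<notin> P" using w'PQ by blast
    then obtain \<rho> where \<rho>: "\<rho> > 0" "ball w' \<rho> \<inter> P = {}" using ball_off_P by blast
    define \<eta> where "\<eta> s = w' + of_real \<rho> * s" for s
    have d\<eta>: "deriv \<eta> s = of_real \<rho>" for s
    proof -
      have "(\<eta> has_field_derivative of_real \<rho>) (at s)" unfolding \<eta>_def by (auto intro!: derivative_eq_intros)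
      then show ?thesis by (rule DERIV_imp_deriv)
    qed
    have hol\<eta>: "\<eta> holomorphic_on ball 0 1" unfolding \<eta>_def by (intro holomorphic_intros)
    have "\<eta> s \<in> ball w' \<rho>" if "s \<in> ball 0 1" for s unfolding \<eta>_def using that \<rho>(1) by (simp add: dist_norm norm_mult)
    then have nP: "\<forall>s\<in>ball 0 1. \<eta> s \<notin> P" using \<rho>(2) by blast
    define L where "L = (1 + (norm w' + \<rho>)) * ln (3 + (norm w' + \<rho>)\<^sup>2)"
    have L0: "0 < L" unfolding L_def using \<rho>(1) ln3_ge[of "norm w' + \<rho>"] by (intro mult_pos_pos) (auto intro: add_pos_nonneg)
    have "\<forall>\<^sub>F k in sequentially. \<exists>s. chart \<eta> s \<and> \<eta> s = w (r k) \<and> \<omega> (w (r k)) \<le> (L / \<rho>) * norm (deriv \<eta> s)"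
      using w_in[of "\<rho> / 8"] \<rho>(1)
    proof -
      have "0 < \<rho> / 8" using \<rho>(1) by simp
      from w_in[OF this] show ?thesis
      proof eventually_elim
        case (elim k)
        define s where "s = (w (r k) - w') / of_real \<rho>"
        have s: "norm s \<le> 1/8" "\<eta> s = w (r k)"
          unfolding \<eta>_def s_def using elim \<rho>(1) by (auto simp: norm_divide dist_norm norm_minus_commute field_simps)
        have nle: "norm (w (r k)) \<le> norm w' + \<rho>"
          using elim \<rho>(1) norm_triangle_ineq2[of "w (r k)" w'] by (simp add: dist_norm norm_minus_commute)
        have "\<omega> (w (r k)) \<le> (1 + norm (w (r k))) * ln (3 + (norm (w (r k)))\<^sup>2)" by (rule \<omega>_le)
        also have "\<dots> \<le> L" unfolding L_def
          by (rule mult_mono) (use nle ln3_ge[of "norm (w (r k))"] \<rho>(1) in \<open>auto intro!: ln_mono power_mono simp: add_pos_nonneg\<close>)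
        finally have "\<omega> (w (r k)) \<le> (L / \<rho>) * norm (deriv \<eta> s)" unfolding d\<eta> using \<rho>(1) by simp
        moreover have "chart \<eta> s" unfolding chart_def using s(1) hol\<eta> nP by simp
        ultimately show ?case using s(2) by blast
      qed
    qed
    then show ?thesis using d\<eta>[of "1/4"] hol\<eta> nP \<rho>(1) L0 by (intro exI[of _ \<eta>] exI[of _ "L / \<rho>"]) auto
  qed
  then obtain \<eta> A where \<eta>: "\<eta> holomorphic_on ball 0 1" "\<And>s. s \<in> ball 0 1 \<Longrightarrow> s \<noteq> 0 \<Longrightarrow> \<eta> s \<notin> P" "deriv \<eta> (1/4) \<noteq> 0" "0 < A"
     and ev: "\<forall>\<^sub>F k in sequentially. \<exists>s. chart \<eta> s \<and> \<eta> s = w (r k) \<and> \<omega> (w (r k)) \<le> A * norm (deriv \<eta> s)" by blast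
  obtain K0 where K0: "\<And>k. K0 \<le> k \<Longrightarrow> \<exists>s. chart \<eta> s \<and> \<eta> s = w (r k) \<and> \<omega> (w (r k)) \<le> A * norm (deriv \<eta> s)"
    using ev unfolding eventually_sequentially by blast
  define q where "q i = r (K0 + i)" for i
  have qmono: "strict_mono q" unfolding q_def by (intro strict_monoI strict_monoD[OF r(1)]) simp
  have "\<forall>i. \<exists>s. chart \<eta> s \<and> \<eta> s = w (q i) \<and> \<omega> (w (q i)) \<le> A * norm (deriv \<eta> s)" using K0 unfolding q_def by simp
  then obtain \<sigma> where \<sigma>: "\<And>i. chart \<eta> (\<sigma> i)" "\<And>i. \<eta> (\<sigma> i) = w (q i)" "\<And>i. \<omega> (w (q i)) \<le> A * norm (deriv \<eta> (\<sigma> i))" by metis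
  have "\<exists>h. h holomorphic_on ball 0 1 \<and> h (\<sigma> i) = z (q i) \<and> (\<forall>s\<in>ball 0 1. (f ^^ n (q i)) (h s) = \<eta> s) \<and>
    (\<forall>x. f x \<in> P \<longrightarrow> x \<in> h ` ball 0 1 \<longrightarrow> even_at h (ball 0 1) x) \<and>
    (\<forall>x y. f x \<in> P \<longrightarrow> f y \<in> P \<longrightarrow> x \<in> h ` ball 0 1 \<longrightarrow> y \<in> h ` ball 0 1 \<longrightarrow> x = y) \<and>
    (\<forall>q\<in>P \<inter> J. \<exists>u. u holomorphic_on ball 0 1 \<and> (\<forall>s\<in>ball 0 1. h s - q = u s ^ \<nu> q))" for i
  proof -
    have 1: "1 \<le> n (q i)" using n2[of "q i"] by simp
    have 2: "(f ^^ n (q i)) (z (q i)) = \<eta> (\<sigma> i)" unfolding \<sigma>(2) w_def ..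
    obtain h where h: "h holomorphic_on ball 0 1" "h (\<sigma> i) = z (q i)" "\<And>s. s \<in> ball 0 1 \<Longrightarrow> (f ^^ n (q i)) (h s) = \<eta> s"
      "\<And>x. f x \<in> P \<Longrightarrow> x \<in> h ` ball 0 1 \<Longrightarrow> even_at h (ball 0 1) x"
      "\<And>x y. f x \<in> P \<Longrightarrow> f y \<in> P \<Longrightarrow> x \<in> h ` ball 0 1 \<Longrightarrow> y \<in> h ` ball 0 1 \<Longrightarrow> x = y"
      "\<And>q. q \<in> P \<inter> J \<Longrightarrow> \<exists>u. u holomorphic_on ball 0 1 \<and> (\<forall>s\<in>ball 0 1. h s - q = u s ^ \<nu> q)"
      by (rule chart_lift[OF \<sigma>(1)[of i] 1 2]) (rule that, assumption+)
    show ?thesis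
      by (rule exI[of _ h], intro conjI allI impI ballI) (rule h; assumption)+
  qed
  then have "\<exists>h. \<forall>i. h i holomorphic_on ball 0 1 \<and> h i (\<sigma> i) = z (q i) \<and> (\<forall>s\<in>ball 0 1. (f ^^ n (q i)) (h i s) = \<eta> s) \<and>
    (\<forall>x. f x \<in> P \<longrightarrow> x \<in> h i ` ball 0 1 \<longrightarrow> even_at (h i) (ball 0 1) x) \<and>
    (\<forall>x y. f x \<in> P \<longrightarrow> f y \<in> P \<longrightarrow> x \<in> h i ` ball 0 1 \<longrightarrow> y \<in> h i ` ball 0 1 \<longrightarrow> x = y) \<and>
    (\<forall>q\<in>P \<inter> J. \<exists>u. u holomorphic_on ball 0 1 \<and> (\<forall>s\<in>ball 0 1. h i s - q = u s ^ \<nu> q))"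
    by (intro choice allI)
  then obtain h where h0: "\<forall>i. h i holomorphic_on ball 0 1 \<and> h i (\<sigma> i) = z (q i) \<and> (\<forall>s\<in>ball 0 1. (f ^^ n (q i)) (h i s) = \<eta> s) \<and>
    (\<forall>x. f x \<in> P \<longrightarrow> x \<in> h i ` ball 0 1 \<longrightarrow> even_at (h i) (ball 0 1) x) \<and>
    (\<forall>x y. f x \<in> P \<longrightarrow> f y \<in> P \<longrightarrow> x \<in> h i ` ball 0 1 \<longrightarrow> y \<in> h i ` ball 0 1 \<longrightarrow> x = y) \<and>
    (\<forall>q\<in>P \<inter> J. \<exists>u. u holomorphic_on ball 0 1 \<and> (\<forall>s\<in>ball 0 1. h i s - q = u s ^ \<nu> q))"
    by (rule exE)
  note hi = h0[rule_format]
  have h: "h i holomorphic_on ball 0 1" "h i (\<sigma> i) = z (q i)"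
    "s \<in> ball 0 1 \<Longrightarrow> (f ^^ n (q i)) (h i s) = \<eta> s"
    "f x \<in> P \<Longrightarrow> x \<in> h i ` ball 0 1 \<Longrightarrow> even_at (h i) (ball 0 1) x"
    "f x \<in> P \<Longrightarrow> f y \<in> P \<Longrightarrow> x \<in> h i ` ball 0 1 \<Longrightarrow> y \<in> h i ` ball 0 1 \<Longrightarrow> x = y"
    "q' \<in> P \<inter> J \<Longrightarrow> \<exists>u. u holomorphic_on ball 0 1 \<and> (\<forall>s\<in>ball 0 1. h i s - q' = u s ^ \<nu> q')" for i s x y q'
    subgoal by (rule hi[THEN conjunct1])
    subgoal by (rule hi[THEN conjunct2, THEN conjunct1])
    subgoal by (rule hi[THEN conjunct2, THEN conjunct2, THEN conjunct1, rule_format])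
    subgoal by (rule hi[THEN conjunct2, THEN conjunct2, THEN conjunct2, THEN conjunct1, rule_format])
    subgoal by (rule hi[THEN conjunct2, THEN conjunct2, THEN conjunct2, THEN conjunct2, THEN conjunct1, rule_format])
    subgoal by (rule hi[THEN conjunct2, THEN conjunct2, THEN conjunct2, THEN conjunct2, THEN conjunct2, rule_format])
    done
  have \<sigma>8: "norm (\<sigma> i) \<le> 1/8" for i using \<sigma>(1) unfolding chart_def by blast
  have hB: "norm (h i s) \<le> C' * (1 + Z)" if "norm s \<le> 1/2" for i s
  proof -
    have "norm (h i s) \<le> C' * (1 + norm (h i (\<sigma> i)))"
      by (rule C'(2)[OF h(1) h(4) h(5) \<sigma>8 that that, THEN conjunct1])
    also have "\<dots> \<le> C' * (1 + Z)" unfolding h(2) using Z C'(1) by (intro mult_left_mono) auto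
    finally show ?thesis .
  qed
  \<comment> \<open>By \<open>G_Om\<close> the base point lies in \<open>Om\<close>. The domain D,
    punctured unless 0 itself is the base parameter, is connected and its image avoids P.\<close>
  have Om4: "\<eta> (1/4) \<in> Om"
  proof -
    have wOm: "\<eta> (\<sigma> 0) \<in> Om" unfolding \<sigma>(2) using wG G_Om by blast
    define D where "D = (if \<sigma> 0 = 0 then ball 0 1 else ball (0::complex) 1 - {0})"
    have cD: "connected D" unfolding D_def using connected_punctured_ball[of "0::complex" 1] by simp
    have DP: "\<eta> ` D \<subseteq> - P" using \<sigma>(1)[of 0] \<eta>(2) unfolding chart_def D_def by (auto split: if_splits)
    have "D \<subseteq> ball 0 1" unfolding D_def by auto
    then have "connected (\<eta> ` D)"
      using cD \<eta>(1) by (intro connected_continuous_image holomorphic_on_imp_continuous_on holomorphic_on_subset[OF \<eta>(1)])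
    moreover have "\<sigma> 0 \<in> D" "1/4 \<in> D" using \<sigma>8[of 0] unfolding D_def by auto
    ultimately have "\<eta> ` D \<subseteq> connected_component_set (- P) (\<eta> (\<sigma> 0))" "\<eta> (1/4) \<in> \<eta> ` D"
      using DP connected_component_maximal[of "\<eta> (\<sigma> 0)" "\<eta> ` D" "- P"] by (simp_all add: imageI)
    moreover have "connected_component_set (- P) (\<eta> (\<sigma> 0)) = Om"
      using wOm connected_component_eq[of "\<eta> (\<sigma> 0)" "- P" "of_real R"] unfolding Om_def by blast
    ultimately show ?thesis by (metis subsetD)
  qed
  have nq: "strict_mono (\<lambda>i. n (q i))" using strict_mono_o[OF nmono qmono] by (simp add: o_def)
  have q4: "(1/4::complex) \<in> ball 0 1" "(1/4::complex) \<noteq> 0" by auto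
  obtain t c0 where t: "strict_mono (t::nat \<Rightarrow> nat)" "uniform_limit (cball 0 (1/4)) (h \<circ> t) (\<lambda>_. c0) sequentially"
    using lifts_shrink[OF \<eta>(1,2) Om4 q4 \<eta>(3) nq h(1,3) hB] by metis
  have "\<forall>\<^sub>F k in sequentially. norm (deriv ((h \<circ> t) k) (\<sigma> (t k))) \<le> e / (2 * A) * \<omega> (z (q (t k)))"
    by (rule small_deriv[OF _ _ _ t(2)]) (use h(1,2,6) \<sigma>8 zP e \<eta>(4) in auto)
  then obtain k where k: "norm (deriv (h (t k)) (\<sigma> (t k))) \<le> e / (2 * A) * \<omega> (z (q (t k)))"
    unfolding eventually_sequentially by auto
  define i where "i = t k"
  define D where "D = norm (deriv (f ^^ n (q i)) (z (q i)))"
  have D0: "0 < D" unfolding D_def using deriv_funpow_nz[of "n (q i)" "z (q i)"] wP[of "q i"] unfolding w_def by simp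
  have \<omega>0: "0 < \<omega> (z (q i))" by (rule \<omega>_pos[OF zP])
  have "\<omega> (w (q i)) \<le> A * (D * norm (deriv (h i) (\<sigma> i)))"
    using \<sigma>(3)[of i] chart_lift_deriv[OF \<sigma>(1)[of i] h(1)[of i] h(2)[of i] h(3)] unfolding D_def by simp
  also have "\<dots> \<le> A * (D * (e / (2 * A) * \<omega> (z (q i))))"
    using k D0 \<eta>(4) unfolding i_def by (intro mult_left_mono) auto
  also have "\<dots> = e / 2 * (D * \<omega> (z (q i)))" using \<eta>(4) by simp
  finally have "ratio (n (q i)) (z (q i)) \<le> e / 2"
    unfolding ratio_def w_def[symmetric] D_def[symmetric] using D0 \<omega>0 by (simp add: field_simps)
  then show False using rat[of "q i"] e by simp
qed

text \<open>Ratios multiply along orbits and G is backward invariant, so a ratio at most 1/2 after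
  n0 steps can be iterated; \<open>\<theta>\<close> is the n0-th root of 1/2.\<close>

lemma ratio_exponential:
  obtains C \<theta> where "0 < C" "0 < \<theta>" "\<theta> < 1" "\<And>n z. (f ^^ n) z \<in> G \<Longrightarrow> ratio n z \<le> C * \<theta> ^ n"
proof -
  obtain C where C: "0 < C" "\<And>n z. 1 \<le> n \<Longrightarrow> (f ^^ n) z \<in> G \<Longrightarrow> ratio n z \<le> C"
    by (rule ratio_bound) blast
  obtain n1 where n1: "\<And>n z. n1 \<le> n \<Longrightarrow> (f ^^ n) z \<in> G \<Longrightarrow> ratio n z \<le> 1/2"
    by (rule ratio_small[of "1/2"]) auto
  define n0 where "n0 = max n1 1"
  have n0: "1 \<le> n0" "n1 \<le> n0" unfolding n0_def by auto
  define C1 where "C1 = max 1 C"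
  have base: "ratio j z \<le> C1" if "(f ^^ j) z \<in> G" for j z
  proof (cases "j = 0")
    case True
    have "z \<notin> P" using that True G_P by auto
    then have "0 < \<omega> z" by (rule \<omega>_pos)
    moreover have "deriv (f ^^ 0) z = 1" by (simp add: id_def)
    ultimately have "ratio 0 z = 1" unfolding ratio_def by simp
    then show ?thesis using True unfolding C1_def by simp
  next
    case False
    then show ?thesis using C(2)[of j z] that unfolding C1_def by simp
  qed
  have step: "ratio (n0 * m + j) z \<le> C1 * (1/2) ^ m" if "(f ^^ (n0 * m + j)) z \<in> G" for m j z
    using that
  proof (induction m arbitrary: z)
    case 0
    then show ?case using base by simp
  next
    case (Suc m)
    have eq: "n0 * Suc m + j = (n0 * m + j) + n0" by simp
    have y: "(f ^^ (n0 * m + j)) ((f ^^ n0) z) \<in> G" using Suc.prems unfolding eq funpow_add[of "n0 * m + j"] by simp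
    then have yG: "(f ^^ n0) z \<in> G" by (rule G_iter)
    have P: "(f ^^ ((n0 * m + j) + n0)) z \<notin> P" using Suc.prems G_P unfolding eq by blast
    have "ratio (n0 * Suc m + j) z = ratio (n0 * m + j) ((f ^^ n0) z) * ratio n0 z" unfolding eq by (rule ratio_add[OF P])
    also have "\<dots> \<le> (C1 * (1/2) ^ m) * (1/2)"
    proof (rule mult_mono)
      show "ratio (n0 * m + j) ((f ^^ n0) z) \<le> C1 * (1/2) ^ m" by (rule Suc.IH[OF y])
      show "ratio n0 z \<le> 1/2" by (rule n1[OF n0(2) yG])
      show "0 \<le> ratio n0 z" by (rule ratio_nonneg) (use yG G_P in blast)
    qed (simp add: C1_def)
    finally show ?case by simp
  qed
  define \<theta> where "\<theta> = (1/2 :: real) powr (1 / real n0)"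
  have \<theta>0: "0 < \<theta>" unfolding \<theta>_def by simp
  have \<theta>n: "\<theta> ^ n0 = 1/2"
  proof -
    have "\<theta> ^ n0 = \<theta> powr real n0" using \<theta>0 by (simp add: powr_realpow)
    also have "\<dots> = 1/2" unfolding \<theta>_def powr_powr using n0 by simp
    finally show ?thesis .
  qed
  have \<theta>1: "\<theta> < 1" using \<theta>n one_le_power[of \<theta> n0] by linarith
  have "ratio n z \<le> (2 * C1) * \<theta> ^ n" if "(f ^^ n) z \<in> G" for n z
  proof -
    define m j where "m = n div n0" and "j = n mod n0"
    have nmj: "n = n0 * m + j" "j < n0" unfolding m_def j_def using n0 by auto
    have "ratio n z \<le> C1 * (1/2) ^ m" using step[of m j z] that nmj by simp
    also have "(1/2) ^ m = \<theta> ^ (n0 * m)" unfolding \<theta>n[symmetric] by (simp add: power_mult)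
    \<comment> \<open>The factor 2 absorbs the remaining j < n0 steps, as
      \<open>\<theta> ^ j\<close> is at least 1/2.\<close>
    also have "C1 * \<theta> ^ (n0 * m) \<le> C1 * (2 * \<theta> ^ n)"
    proof (rule mult_left_mono)
      have "1/2 \<le> \<theta> ^ j" unfolding \<theta>n[symmetric] using nmj(2) \<theta>0 \<theta>1 by (intro power_decreasing) auto
      then have "\<theta> ^ (n0 * m) * 1 \<le> \<theta> ^ (n0 * m) * (2 * \<theta> ^ j)" using \<theta>0 by (intro mult_left_mono) auto
      then show "\<theta> ^ (n0 * m) \<le> 2 * \<theta> ^ n" using nmj(1) by (simp add: power_add mult_ac)
    qed (simp add: C1_def)
    finally show ?thesis unfolding C1_def by (simp add: mult_ac)
  qed
  then show thesis using that[of "2 * C1" \<theta>] \<theta>0 \<theta>1 unfolding C1_def by simp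
qed

text \<open>Outside the disc the density function \<open>\<omega>\<close> is at least 1, and
  everywhere it is at most its expression at infinity. In this form the cone points no longer
  appear.\<close>

lemma annulus_deriv:
  obtains C \<theta> where "0 < C" "0 < \<theta>" "\<theta> < 1"
    "\<And>n z. R \<le> norm ((f ^^ n) z) \<Longrightarrow> 1 / norm (deriv (f ^^ n) z) \<le> C * \<theta> ^ n * ((1 + norm z) * ln (3 + (norm z)\<^sup>2))"
proof -
  obtain C \<theta> where C: "0 < C" "0 < \<theta>" "\<theta> < 1" "\<And>n z. (f ^^ n) z \<in> G \<Longrightarrow> ratio n z \<le> C * \<theta> ^ n"
    using ratio_exponential by metis
  have "1 / norm (deriv (f ^^ n) z) \<le> C * \<theta> ^ n * ((1 + norm z) * ln (3 + (norm z)\<^sup>2))"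
    if far: "R \<le> norm ((f ^^ n) z)" for n z
  proof -
    define w where "w = (f ^^ n) z"
    have wG: "w \<in> G" using G_far far unfolding w_def by blast
    have zP: "z \<notin> P" "w \<notin> P" using G_iter wG G_P unfolding w_def by blast+
    have "\<not> near q w" for q using near_norm far unfolding w_def by (auto simp: not_less[symmetric])
    then have "1 \<le> \<omega> w" by (rule \<omega>_ge(2))
    define D where "D = norm (deriv (f ^^ n) z)"
    have D: "0 < D" unfolding D_def using deriv_funpow_nz[of n z] zP unfolding w_def by simp
    have \<omega>0: "0 < \<omega> z" by (rule \<omega>_pos[OF zP(1)])
    have "1 / D \<le> \<omega> w / D" using \<open>1 \<le> \<omega> w\<close> D by (intro divide_right_mono) auto
    also have "\<dots> = ratio n z * \<omega> z" unfolding ratio_def w_def[symmetric] D_def[symmetric] using \<omega>0 by simp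
    also have "\<dots> \<le> C * \<theta> ^ n * \<omega> z" using C(4)[of n z] wG \<omega>0 unfolding w_def by (intro mult_right_mono) auto
    also have "\<dots> \<le> C * \<theta> ^ n * ((1 + norm z) * ln (3 + (norm z)\<^sup>2))"
      using \<omega>_le C by (intro mult_left_mono) auto
    finally show ?thesis unfolding D_def .
  qed
  then show thesis using that C by blast
qed

end

section \<open>Disconnecting the escaping set\<close>

lemma lift_vector_derivative:
  fixes \<gamma> \<rho> :: "real \<Rightarrow> complex"
  assumes F: "F holomorphic_on UNIV" "deriv F (\<gamma> t) \<noteq> 0"
    and \<gamma>: "isCont \<gamma> t" "\<forall>\<^sub>F s in at t. F (\<gamma> s) = \<rho> s" "F (\<gamma> t) = \<rho> t"
    and \<rho>: "(\<rho> has_vector_derivative d) (at t)"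
  shows "(\<gamma> has_vector_derivative d / deriv F (\<gamma> t)) (at t)"
proof -
  obtain \<delta> \<epsilon> g where g: "0 < \<delta>" "0 < \<epsilon>" "g holomorphic_on ball (F (\<gamma> t)) \<epsilon>"
    "\<And>z. z \<in> ball (\<gamma> t) \<delta> \<Longrightarrow> F z \<in> ball (F (\<gamma> t)) \<epsilon> \<Longrightarrow> g (F z) = z"
    by (rule local_inverse[OF F, of 1]) auto
  have contF: "isCont F (\<gamma> t)"
    using holomorphic_on_imp_continuous_on[OF F(1)] by (simp add: continuous_on_eq_continuous_at)
  have in1: "\<forall>\<^sub>F s in at t. \<gamma> s \<in> ball (\<gamma> t) \<delta>"
    by (rule topological_tendstoD[OF \<gamma>(1)[unfolded isCont_def] open_ball]) (use g(1) in simp)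
  have "isCont (\<lambda>s. F (\<gamma> s)) t" by (rule isCont_o2[OF \<gamma>(1) contF])
  then have in2: "\<forall>\<^sub>F s in at t. F (\<gamma> s) \<in> ball (F (\<gamma> t)) \<epsilon>"
    unfolding isCont_def by (rule topological_tendstoD[OF _ open_ball]) (use g(2) in simp)
  have eq: "\<forall>\<^sub>F s in at t. (g \<circ> \<rho>) s = \<gamma> s"
    using in1 in2 \<gamma>(2) by eventually_elim (metis comp_apply g(4))
  have gF: "(g has_field_derivative deriv g (F (\<gamma> t))) (at (F (\<gamma> t)))"
    by (rule holomorphic_derivI[OF g(3) open_ball]) (use g(2) in simp)
  have FF: "(F has_field_derivative deriv F (\<gamma> t)) (at (\<gamma> t))"
    by (rule holomorphic_derivI[OF F(1) open_UNIV UNIV_I])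
  have "(g \<circ> F has_field_derivative deriv g (F (\<gamma> t)) * deriv F (\<gamma> t)) (at (\<gamma> t))"
    by (rule DERIV_chain[OF gF FF])
  moreover have "\<forall>\<^sub>F z in at (\<gamma> t). (g \<circ> F) z = z"
  proof -
    have "\<forall>\<^sub>F z in at (\<gamma> t). z \<in> ball (\<gamma> t) \<delta>" by (rule eventually_at_in_open') (use g(1) in auto)
    moreover have "\<forall>\<^sub>F z in at (\<gamma> t). F z \<in> ball (F (\<gamma> t)) \<epsilon>"
      by (rule topological_tendstoD[OF contF[unfolded isCont_def] open_ball]) (use g(2) in simp)
    ultimately show ?thesis by eventually_elim (use g(4) in auto)
  qed
  moreover have "(g \<circ> F) (\<gamma> t) = \<gamma> t" using g by simp
  ultimately have "((\<lambda>z. z) has_field_derivative deriv g (F (\<gamma> t)) * deriv F (\<gamma> t)) (at (\<gamma> t))"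
    unfolding has_field_derivative_def by (rule has_derivative_transform_eventually) auto
  then have "deriv g (F (\<gamma> t)) * deriv F (\<gamma> t) = 1" using DERIV_ident DERIV_unique by blast
  then have dg: "deriv g (F (\<gamma> t)) = 1 / deriv F (\<gamma> t)" using F(2) by (simp add: field_simps)
  have "(g \<circ> \<rho> has_vector_derivative d * deriv g (F (\<gamma> t))) (at t)"
    by (rule field_vector_diff_chain_at[OF \<rho>]) (use gF \<gamma>(3) in simp)
  then have gd: "(g \<circ> \<rho> has_vector_derivative d / deriv F (\<gamma> t)) (at t)" unfolding dg by simp
  have "(g \<circ> \<rho>) t = \<gamma> t" using g(1,2,4) \<gamma>(3) by (metis centre_in_ball comp_apply)
  then show ?thesis
    using has_derivative_transform_eventually[OF gd[unfolded has_vector_derivative_def] eq _ UNIV_I]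
    unfolding has_vector_derivative_def by blast
qed

text \<open>A Lipschitz function for the metric |dz| / ((1 + |z|) ln (3 + |z|^2)): the length of a
  path bounds the growth of \<open>loglog\<close> along it, and a bound on \<open>loglog\<close>
  bounds |z|.\<close>

definition loglog :: "complex \<Rightarrow> real" where "loglog z = ln (ln (3 + (norm z)\<^sup>2))"

lemma loglog_deriv_bound:
  assumes \<gamma>: "(\<gamma> has_vector_derivative v) (at t)"
    and v: "norm v \<le> K * ((1 + norm (\<gamma> t)) * ln (3 + (norm (\<gamma> t))\<^sup>2))" and K: "0 \<le> K"
  obtains l where "((\<lambda>s. loglog (\<gamma> s)) has_real_derivative l) (at t)" "\<bar>l\<bar> \<le> 4 * K"
proof -
  define x where "x = norm (\<gamma> t)"
  define L where "L = ln (3 + x\<^sup>2)"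
  have L: "1 \<le> L" unfolding L_def by (rule ln3_ge)
  have x: "0 \<le> x" "0 < 3 + x\<^sup>2" unfolding x_def by (auto intro: add_pos_nonneg)
  have "((\<lambda>s. \<gamma> s \<bullet> \<gamma> s) has_vector_derivative (\<gamma> t \<bullet> v + v \<bullet> \<gamma> t)) (at t)"
    by (rule bounded_bilinear.has_vector_derivative[OF bounded_bilinear_inner \<gamma> \<gamma>])
  then have "((\<lambda>s. (norm (\<gamma> s))\<^sup>2) has_real_derivative 2 * (\<gamma> t \<bullet> v)) (at t)"
    unfolding has_real_derivative_iff_has_vector_derivative power2_norm_eq_inner by (simp add: inner_commute)
  then have "((\<lambda>s. 3 + (norm (\<gamma> s))\<^sup>2) has_real_derivative 2 * (\<gamma> t \<bullet> v)) (at t)"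
    using DERIV_add[OF DERIV_const] by fastforce
  moreover have "(ln has_real_derivative inverse (3 + x\<^sup>2)) (at (3 + x\<^sup>2))" by (rule DERIV_ln[OF x(2)])
  ultimately have "((\<lambda>s. ln (3 + (norm (\<gamma> s))\<^sup>2)) has_real_derivative inverse (3 + x\<^sup>2) * (2 * (\<gamma> t \<bullet> v))) (at t)"
    unfolding x_def by (rule DERIV_chain2[rotated])
  moreover have "(ln has_real_derivative inverse L) (at L)" by (rule DERIV_ln) (use L in simp)
  ultimately have "((\<lambda>s. loglog (\<gamma> s)) has_real_derivative inverse L * (inverse (3 + x\<^sup>2) * (2 * (\<gamma> t \<bullet> v)))) (at t)"
    unfolding L_def x_def loglog_def by (rule DERIV_chain2[rotated])
  then have D: "((\<lambda>s. loglog (\<gamma> s)) has_real_derivative (2 * (\<gamma> t \<bullet> v)) / (3 + x\<^sup>2) / L) (at t)"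
    by (simp add: divide_inverse mult_ac)
  have "\<bar>\<gamma> t \<bullet> v\<bar> \<le> x * (K * ((1 + x) * L))"
  proof -
    have "\<bar>\<gamma> t \<bullet> v\<bar> \<le> x * norm v" unfolding x_def by (rule Cauchy_Schwarz_ineq2)
    also have "\<dots> \<le> x * (K * ((1 + x) * L))" using v x unfolding x_def L_def by (intro mult_left_mono)
    finally show ?thesis .
  qed
  also have "\<dots> = K * L * (x + x\<^sup>2)" by (simp add: algebra_simps power2_eq_square)
  also have "\<dots> \<le> K * L * (2 * (3 + x\<^sup>2))"
  proof (rule mult_left_mono)
    have "0 \<le> (x - 1)\<^sup>2" by simp
    then show "x + x\<^sup>2 \<le> 2 * (3 + x\<^sup>2)" using x by (simp add: power2_eq_square algebra_simps)
  qed (use K L in simp)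
  finally have "2 * \<bar>\<gamma> t \<bullet> v\<bar> \<le> 4 * K * (L * (3 + x\<^sup>2))" by (simp add: algebra_simps)
  then have "\<bar>(2 * (\<gamma> t \<bullet> v)) / (3 + x\<^sup>2) / L\<bar> \<le> 4 * K"
    using L x by (simp add: abs_mult abs_divide pos_divide_le_eq mult.assoc mult.commute[of L])
  with D show thesis by (rule that)
qed

context subhyperbolic_disc begin

text \<open>The retraction moves z along the lift of a radial segment that is traversed with speed
  at most R2. Dividing by the derivative of f^n gives speed at most R2 * K in the metric at
  infinity, and the mean value theorem bounds the increment.\<close>

lemma ret_loglog:
  assumes R2: "norm ((f ^^ n) z) \<le> R2" and K: "0 \<le> K"
    and dK: "\<And>z. R \<le> norm ((f ^^ n) z) \<Longrightarrow> 1 / norm (deriv (f ^^ n) z) \<le> K * ((1 + norm z) * ln (3 + (norm z)\<^sup>2))"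
  shows "loglog (ret n z) \<le> loglog z + 4 * (R2 * K)"
proof (cases "z \<in> X n")
  case False
  then have "ret n z = z" by (intro ret_id) (simp add: X_def)
  moreover have "0 \<le> R2" using R2 norm_ge_zero[of "(f ^^ n) z"] by linarith
  ultimately show ?thesis using K by simp
next
  case True
  define w where "w = (f ^^ n) z"
  have w: "R \<le> norm w" "norm w \<le> R2" using True R2 unfolding X_def w_def by auto
  have w0: "0 < norm w" using w Rpos by linarith
  define \<gamma> where "\<gamma> t = RH n (t, z)" for t
  define \<rho> where "\<rho> t = radial 0 R (t, w)" for t
  have c\<gamma>: "continuous_on {0..1} \<gamma>" unfolding \<gamma>_def by (rule RH_cont[OF True])
  have F\<gamma>: "(f ^^ n) (\<gamma> t) = \<rho> t" if "t \<in> {0..1}" for t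
    unfolding \<gamma>_def \<rho>_def w_def by (rule RH_funpow[OF True that])
  have R\<rho>: "R \<le> norm (\<rho> t)" if "t \<in> {0..1}" for t
    using dist_radial(1)[of R 0 w t] Rpos w that unfolding \<rho>_def by simp
  define d where "d = of_real (R / norm w - 1) * w"
  have d\<rho>: "(\<rho> has_vector_derivative d) (at t)" for t
    unfolding \<rho>_def radial_def d_def
    by (auto intro!: derivative_eq_intros simp: has_vector_derivative_def scaleR_conv_of_real algebra_simps diff_divide_distrib) (use w0 in auto)
  have "norm d = \<bar>R / norm w - 1\<bar> * norm w" unfolding d_def norm_mult norm_of_real ..
  also have "\<dots> = norm w - R" using w w0 by (simp add: abs_if field_simps)
  also have "\<dots> \<le> R2" using w Rpos by linarith
  finally have nd: "norm d \<le> R2" .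
  have step: "\<exists>l. ((\<lambda>s. loglog (\<gamma> s)) has_real_derivative l) (at t) \<and> \<bar>l\<bar> \<le> 4 * (R2 * K)" if t: "0 < t" "t < 1" for t
  proof -
    have far: "R \<le> norm ((f ^^ n) (\<gamma> t))" using R\<rho> F\<gamma> t by simp
    then have dn: "deriv (f ^^ n) (\<gamma> t) \<noteq> 0"
      using X_not_P[of "(f ^^ n) (\<gamma> t)" 0] by (intro deriv_funpow_nz) (simp add: X_def)
    have "continuous_on {0<..<1} \<gamma>" by (rule continuous_on_subset[OF c\<gamma>]) auto
    then have ic: "isCont \<gamma> t" using t by (simp add: continuous_on_eq_continuous_at)
    have "\<forall>\<^sub>F s in at t. s \<in> {0<..<1}" by (rule eventually_at_in_open') (use t in auto)
    then have ev: "\<forall>\<^sub>F s in at t. (f ^^ n) (\<gamma> s) = \<rho> s" by eventually_elim (use F\<gamma> in auto)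
    have D: "(\<gamma> has_vector_derivative d / deriv (f ^^ n) (\<gamma> t)) (at t)"
      by (rule lift_vector_derivative[OF hol_funpow dn ic ev _ d\<rho>]) (use F\<gamma> t in simp)
    have "norm (d / deriv (f ^^ n) (\<gamma> t)) = norm d * (1 / norm (deriv (f ^^ n) (\<gamma> t)))" by (simp add: norm_divide)
    also have "\<dots> \<le> R2 * (K * ((1 + norm (\<gamma> t)) * ln (3 + (norm (\<gamma> t))\<^sup>2)))"
      using nd dK[OF far] order_trans[OF norm_ge_zero nd] by (intro mult_mono) auto
    finally have "norm (d / deriv (f ^^ n) (\<gamma> t)) \<le> (R2 * K) * ((1 + norm (\<gamma> t)) * ln (3 + (norm (\<gamma> t))\<^sup>2))"
      by (simp add: mult.assoc)
    moreover have "0 \<le> R2 * K" using K order_trans[OF norm_ge_zero nd] by simp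
    ultimately show ?thesis by (metis loglog_deriv_bound[OF D])
  qed
  have "continuous_on {0..1} (\<lambda>s. loglog (\<gamma> s))"
  proof -
    have "3 + (norm x)\<^sup>2 \<noteq> 0" "ln (3 + (norm x)\<^sup>2) \<noteq> 0" for x :: complex
      using ln3_ge[of "norm x"] zero_le_power2[of "norm x"] by linarith+
    then show ?thesis unfolding loglog_def by (intro continuous_intros c\<gamma>) auto
  qed
  then obtain l t where lt: "0 < t" "t < 1" "((\<lambda>s. loglog (\<gamma> s)) has_real_derivative l) (at t)"
    "loglog (\<gamma> 1) - loglog (\<gamma> 0) = l"
    using MVT[of 0 1 "\<lambda>s. loglog (\<gamma> s)"] step by (force simp: real_differentiable_def)
  then have "\<bar>l\<bar> \<le> 4 * (R2 * K)" using step[OF lt(1,2)] DERIV_unique by blast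
  then show ?thesis using lt(4) ret_X[OF True] RH_0[OF True] unfolding \<gamma>_def by simp
qed

section \<open>The composed retractions and the sets T_N\<close>

primrec g :: "nat \<Rightarrow> complex \<Rightarrow> complex" where
  "g 0 z = z"
| "g (Suc n) z = ret (Suc n) (g n z)"

lemma g_cont: "continuous_on A (g n)"
proof -
  have "continuous_on UNIV (g n)"
  proof (induction n)
    case 0
    then show ?case by (simp add: continuous_on_id)
  next
    case (Suc n)
    then show ?case using continuous_on_compose2[OF ret_cont Suc] by simp
  qed
  then show ?thesis using continuous_on_subset by blast
qed

lemma g_fix: "f z \<in> P \<Longrightarrow> g n z = z"
proof (induction n)
  case (Suc n)
  have "(f ^^ Suc n) z \<in> P" using funpow_P[OF Suc.prems, of n] by (simp add: funpow_swap1)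
  then have "ret (Suc n) z = z" by (intro ret_id) (use Pball in force)
  then show ?case using Suc by simp
qed simp

lemma g_semiconj: "f (g (Suc n) z) = g n (ret 0 (f z))"
  by (induction n) (simp_all add: ret_semiconj)

text \<open>For k >= 1 the argument of g on the right lies in the disc, since \<open>ret 0\<close>
  is applied last. So a bound for g on the disc controls f^k (g n z) for every z.\<close>

lemma g_orbit: "k \<le> n \<Longrightarrow> (f ^^ k) (g n z) = g (n - k) (((ret 0 \<circ> f) ^^ k) z)"
proof (induction k arbitrary: n z)
  case (Suc k)
  then obtain m where m: "n = Suc m" "k \<le> m" by (cases n) auto
  have "(f ^^ Suc k) (g n z) = (f ^^ k) (g m (ret 0 (f z)))" by (simp only: funpow_Suc_right m(1) g_semiconj comp_apply)
  also have "\<dots> = g (m - k) (((ret 0 \<circ> f) ^^ Suc k) z)"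
    unfolding Suc.IH[OF m(2)] by (simp only: funpow_Suc_right comp_apply)
  finally show ?case unfolding m(1) by (simp only: diff_Suc_Suc)
qed simp

text \<open>If z lies in the disc, so does f^n (g n z), and f^(n+1) (g n z) has modulus at most R2.
  The next retraction therefore covers a bounded radial distance, its effect on
  \<open>loglog\<close> is of order \<open>\<theta>\<close>^(n+1), and the sum converges.\<close>

lemma g_bounded:
  obtains M where "\<And>n z. norm z \<le> R \<Longrightarrow> norm (g n z) \<le> M"
proof -
  obtain C \<theta> where C: "0 < C" "0 < \<theta>" "\<theta> < 1"
    "\<And>n z. R \<le> norm ((f ^^ n) z) \<Longrightarrow> 1 / norm (deriv (f ^^ n) z) \<le> C * \<theta> ^ n * ((1 + norm z) * ln (3 + (norm z)\<^sup>2))"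
    using annulus_deriv by metis
  have "compact (f ` cball 0 R)" by (intro compact_continuous_image contf compact_cball)
  then obtain R2 where R2: "\<And>z. norm z \<le> R \<Longrightarrow> norm (f z) \<le> R2"
    using bounded_iff[THEN iffD1, OF compact_imp_bounded] by (metis imageI mem_cball_0)
  have R20: "0 \<le> R2" using order_trans[OF norm_ge_zero R2[of 0]] Rpos by simp
  define B where "B = ln (ln (3 + R\<^sup>2)) + 4 * (R2 * C) / (1 - \<theta>)"
  have "loglog (g n z) \<le> B" if z: "norm z \<le> R" for n z
  proof -
    have "loglog (g n z) \<le> loglog z + 4 * (R2 * C) * (\<Sum>k=1..n. \<theta> ^ k)"
    proof (induction n)
      case (Suc n)
      have "norm ((f ^^ n) (g n z)) \<le> R"
      proof (cases n)
        case 0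
        then show ?thesis using z by simp
      next
        case (Suc m)
        then show ?thesis using ret_funpow[of "Suc m" "g m z"] by simp
      qed
      then have "norm ((f ^^ Suc n) (g n z)) \<le> R2" using R2 by simp
      then have "loglog (ret (Suc n) (g n z)) \<le> loglog (g n z) + 4 * (R2 * (C * \<theta> ^ Suc n))"
        by (rule ret_loglog) (use C(1,2) in simp, rule C(4))
      then show ?case using Suc by (simp add: algebra_simps)
    qed simp
    also have "\<dots> \<le> B"
    proof -
      have "loglog z \<le> ln (ln (3 + R\<^sup>2))"
      proof -
        have "ln (3 + (norm z)\<^sup>2) \<le> ln (3 + R\<^sup>2)" using power_mono[OF z, of 2] by (intro ln_mono) (auto simp: add_pos_nonneg)
        then show ?thesis unfolding loglog_def using ln3_ge[of "norm z"] by (intro ln_mono[of "ln _"]) linarith+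
      qed
      moreover have "(\<Sum>k=1..n. \<theta> ^ k) \<le> 1 / (1 - \<theta>)"
      proof -
        have "(\<Sum>k=1..n. \<theta> ^ k) \<le> (\<Sum>k<Suc n. \<theta> ^ k)" using C by (intro sum_mono2) auto
        also have "\<dots> \<le> (\<Sum>k. \<theta> ^ k)" using C by (intro sum_le_suminf summable_geometric) auto
        also have "\<dots> = 1 / (1 - \<theta>)" using C by (intro suminf_geometric) auto
        finally show ?thesis .
      qed
      then have "4 * (R2 * C) * (\<Sum>k=1..n. \<theta> ^ k) \<le> 4 * (R2 * C) * (1 / (1 - \<theta>))"
        using R20 C by (intro mult_left_mono) auto
      ultimately show ?thesis unfolding B_def by simp
    qed
    finally show ?thesis .
  qed
  then have "norm (g n z) \<le> sqrt (exp (exp B))" if "norm z \<le> R" for n z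
  proof -
    have L: "0 < ln (3 + (norm (g n z))\<^sup>2)" using ln3_ge[of "norm (g n z)"] by linarith
    have "ln (ln (3 + (norm (g n z))\<^sup>2)) \<le> B"
      using \<open>\<And>z n. norm z \<le> R \<Longrightarrow> loglog (g n z) \<le> B\<close>[OF that] unfolding loglog_def .
    then have "ln (3 + (norm (g n z))\<^sup>2) \<le> exp B" using L exp_le_cancel_iff[of "ln (ln (3 + (norm (g n z))\<^sup>2))" B] by simp
    then have "exp (ln (3 + (norm (g n z))\<^sup>2)) \<le> exp (exp B)" by simp
    then have "3 + (norm (g n z))\<^sup>2 \<le> exp (exp B)" by (simp add: add_pos_nonneg)
    then show ?thesis by (intro real_le_rsqrt) linarith
  qed
  then show thesis by (rule that)
qed

definition T where "T N = closure (\<Union>n\<in>{N..}. range (g n))"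

lemma T_decreasing: "N \<le> M \<Longrightarrow> T M \<subseteq> T N"
  unfolding T_def by (intro closure_mono UN_mono) auto

lemma T_P: "f z \<in> P \<Longrightarrow> z \<in> T N"
  unfolding T_def using g_fix[of z N] closure_subset by (metis (no_types, lifting) UN_I atLeast_iff order_refl rangeI subsetD)

lemma T_connected: "connected (T N)"
proof -
  have "a \<in> range (g n)" for n using g_fix[of a n] a invP by (metis image_subset_iff rangeI)
  then have "connected (\<Union>n\<in>{N..}. range (g n))"
    by (intro connected_Union) (auto intro!: connected_continuous_image g_cont)
  then show ?thesis unfolding T_def by (rule connected_imp_connected_closure)
qed

text \<open>T N contains f^-1(P), which has points of arbitrarily large modulus by
  \<open>annulus_preimage\<close>.\<close>

lemma T_unbounded: "\<not> bounded (T N)"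
proof
  assume "bounded (T N)"
  then obtain B where B: "\<And>x. x \<in> T N \<Longrightarrow> norm x \<le> B" unfolding bounded_iff by blast
  obtain t0 where t0: "\<And>t. t0 \<le> t \<Longrightarrow> \<exists>x. t \<le> norm x \<and> norm x \<le> 4 * t \<and> f x \<in> {a, b}"
    using annulus_preimage ab by metis
  obtain x where "max t0 (B + 1) \<le> norm x" "f x \<in> {a, b}" using t0[of "max t0 (B + 1)"] by auto
  then show False using B[OF T_P, of x] a b by auto
qed

text \<open>M is the bound of \<open>g_bounded\<close> and the same for all N; this uniformity lets
  \<open>escaping_not_T\<close> exclude each escaping point from some T N.\<close>

lemma T_orbit:
  obtains M where "\<And>N k z. z \<in> T N \<Longrightarrow> 1 \<le> k \<Longrightarrow> k \<le> N \<Longrightarrow> norm ((f ^^ k) z) \<le> M"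
proof -
  obtain M where M: "\<And>n z. norm z \<le> R \<Longrightarrow> norm (g n z) \<le> M" using g_bounded by blast
  have "norm ((f ^^ k) z) \<le> M" if zT: "z \<in> T N" and k: "1 \<le> k" "k \<le> N" for N k z
  proof -
    have "closed {z. norm ((f ^^ k) z) \<le> M}" by (intro closed_Collect_le continuous_intros cont_funpow)
    moreover have "(\<Union>n\<in>{N..}. range (g n)) \<subseteq> {z. norm ((f ^^ k) z) \<le> M}"
    proof
      fix w assume "w \<in> (\<Union>n\<in>{N..}. range (g n))"
      then obtain n x where n: "N \<le> n" "w = g n x" by auto
      obtain j where j: "k = Suc j" using k(1) by (cases k) auto
      have "norm (((ret 0 \<circ> f) ^^ k) x) \<le> R" unfolding j using ret_funpow[of 0] by simp
      then show "w \<in> {z. norm ((f ^^ k) z) \<le> M}" unfolding n(2) using g_orbit[of k n x] n(1) k(2) M by simp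
    qed
    ultimately show ?thesis using zT unfolding T_def by (metis (no_types, lifting) closure_minimal mem_Collect_eq subsetD)
  qed
  then show thesis by (rule that)
qed

lemma escaping_not_T:
  assumes "z \<in> escaping_set f"
  obtains N where "z \<notin> T N"
proof -
  obtain M where M: "\<And>N k z. z \<in> T N \<Longrightarrow> 1 \<le> k \<Longrightarrow> k \<le> N \<Longrightarrow> norm ((f ^^ k) z) \<le> M" using T_orbit by metis
  have "\<forall>\<^sub>F n in sequentially. M + 1 \<le> norm ((f ^^ n) z)"
    using assms unfolding escaping_set_def filterlim_at_infinity_conv_norm_at_top filterlim_at_top by blast
  then obtain N where N: "\<And>n. N \<le> n \<Longrightarrow> M + 1 \<le> norm ((f ^^ n) z)" unfolding eventually_sequentially by blast
  have "z \<notin> T (Suc N)" using M[of z "Suc N" "Suc N"] N[of "Suc N"] by fastforce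
  then show thesis by (rule that)
qed

section \<open>Separation of the escaping set\<close>

lemma escaping_iff: "f z \<in> escaping_set f \<longleftrightarrow> z \<in> escaping_set f"
proof -
  have "z \<in> escaping_set f \<longleftrightarrow> filterlim (\<lambda>n. (f ^^ Suc n) z) at_infinity sequentially"
    unfolding escaping_set_def by (simp only: mem_Collect_eq filterlim_sequentially_Suc[of "\<lambda>n. (f ^^ n) z"])
  then show ?thesis unfolding escaping_set_def by (simp add: funpow_swap1)
qed

text \<open>Two different escaping values x and x' together have preimages of arbitrarily large
  modulus; among three of these, two lie over the same value.\<close>

lemma escaping_two_preimages:
  obtains y1 y2 where "y1 \<in> escaping_set f" "y2 \<in> escaping_set f" "y1 \<noteq> y2" "f y1 = f y2"
proof -
  obtain x where x: "x \<in> escaping_set f" using escaping_set_nonempty by blast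
  then have xn: "(f ^^ n) x \<in> escaping_set f" for n using escaping_iff by (induction n) auto
  have "\<forall>\<^sub>F n in sequentially. norm x + 1 \<le> norm ((f ^^ n) x)"
    using x unfolding escaping_set_def filterlim_at_infinity_conv_norm_at_top filterlim_at_top by blast
  then obtain n where n: "norm x + 1 \<le> norm ((f ^^ n) x)" unfolding eventually_sequentially by blast
  define x' where "x' = (f ^^ n) x"
  have x': "x' \<in> escaping_set f" "x \<noteq> x'" using xn n unfolding x'_def by auto
  obtain t0 where t0: "\<And>t. t0 \<le> t \<Longrightarrow> \<exists>z. t \<le> norm z \<and> norm z \<le> 4 * t \<and> f z \<in> {x, x'}"
    using annulus_preimage[OF x'(2)] by metis
  obtain z1 where z1: "f z1 \<in> {x, x'}" using t0 by blast
  obtain z2 where z2: "norm z1 + 1 \<le> norm z2" "f z2 \<in> {x, x'}" using t0[of "max t0 (norm z1 + 1)"] by auto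
  obtain z3 where z3: "norm z2 + 1 \<le> norm z3" "f z3 \<in> {x, x'}" using t0[of "max t0 (norm z2 + 1)"] by auto
  have "z1 \<noteq> z2" "z2 \<noteq> z3" "z1 \<noteq> z3" using z2 z3 by auto
  moreover have "z1 \<in> escaping_set f" "z2 \<in> escaping_set f" "z3 \<in> escaping_set f"
    using z1 z2 z3 x x'(1) escaping_iff by (metis insertE singletonD)+
  moreover have "f z1 = f z2 \<or> f z2 = f z3 \<or> f z1 = f z3" using z1 z2 z3 by auto
  ultimately show thesis using that by blast
qed

text \<open>T N is connected, so the complement of a component of - T N is connected. It contains
  the unbounded set T N, so it forms a single unbounded component, which is the criterion for simple
  connectivity.\<close>

lemma T_complement:
  assumes "x \<notin> T N"
  shows "open (connected_component_set (- T N) x)" "simply_connected (connected_component_set (- T N) x)"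
proof -
  define W where "W = connected_component_set (- T N) x"
  have cl: "closed (T N)" unfolding T_def by simp
  then show op: "open W" unfolding W_def by (intro open_connected_component) (simp add: open_Compl)
  have "W \<in> components (- T N)" unfolding W_def components_def using assms by auto
  then have conn: "connected (- W)" by (rule component_complement_connected[OF T_connected])
  have sub: "T N \<subseteq> - W" unfolding W_def using connected_component_subset[of "- T N" x] by auto
  then have "- W \<noteq> {}" using T_unbounded[of N] by auto
  then have "components (- W) = {- W}" using conn by (simp add: components_eq_sing_iff)
  moreover have "\<not> bounded (- W)" using T_unbounded bounded_subset sub by blast
  ultimately show "simply_connected W"
    by (simp add: simply_connected_eq_unbounded_complement_components[OF op]) (simp add: W_def)
qed

theorem escaping_set_disconnected: "\<not> connected (escaping_set f)"
proof
  define I where "I = escaping_set f"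
  assume "connected (escaping_set f)"
  then have cI: "connected I" unfolding I_def .
  obtain y1 y2 where y: "y1 \<in> I" "y2 \<in> I" "y1 \<noteq> y2" "f y1 = f y2"
    using escaping_two_preimages unfolding I_def by metis
  define x0 where "x0 = f y1"
  have x0: "x0 \<in> I" using y(1) escaping_iff unfolding I_def x0_def by blast
  define W where "W N = connected_component_set (- T N) x0" for N
  have W_mono: "W N \<subseteq> W M" if "N \<le> M" for N M
    unfolding W_def by (intro connected_component_mono) (use T_decreasing[OF that] in blast)
  have W_T: "W N \<subseteq> - T N" for N unfolding W_def by (rule connected_component_subset)
  have x0W: "x0 \<in> W N" if "x \<in> W N" for x N
    using that connected_component_in[of "- T N" x0 x] unfolding W_def by (simp add: connected_component_refl)
  have W: "open (W N)" "simply_connected (W N)" "connected (W N)" if "x \<in> W N" for x N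
    using T_complement[of x0 N] x0W[OF that] W_T[of N] simply_connected_imp_connected unfolding W_def by blast+
  have nP: "x \<notin> P" if "x \<in> W N" for x N using T_P[of x N] that W_T[of N] invP by blast
  \<comment> \<open>The open sets - T N increase and cover the connected set I, so z is joined to x0
    by a path in their union. By compactness the path avoids a single T N and stays in W N.\<close>
  have IW: "\<exists>N. z \<in> W N" if "z \<in> I" for z
  proof -
    define D where "D = (\<Union>N. - T N)"
    have Oo: "open D" unfolding D_def T_def by (intro open_UN ballI open_Compl closed_closure)
    have "I \<subseteq> D" unfolding I_def D_def using escaping_not_T by blast
    then have "I \<subseteq> connected_component_set D x0" by (rule connected_component_maximal[OF x0 cI])
    then have "path_component D x0 z"
      using that path_component_eq_connected_component_set[OF open_imp_locally_path_connected[OF Oo], of x0] by blast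
    then obtain p where p: "path p" "path_image p \<subseteq> D" "pathstart p = x0" "pathfinish p = z"
      unfolding path_component_def by blast
    obtain \<C> where \<C>: "finite \<C>" "path_image p \<subseteq> (\<Union>N\<in>\<C>. - T N)"
      by (rule compactE_image[OF compact_path_image[OF p(1)], of UNIV "\<lambda>N. - T N"])
         (use p(2) in \<open>auto simp: D_def T_def\<close>)
    have "(\<Union>N\<in>\<C>. - T N) \<subseteq> - T (Max (insert 0 \<C>))"
      using T_decreasing Max_ge[of "insert 0 \<C>"] \<C>(1) by blast
    then have "path_image p \<subseteq> W (Max (insert 0 \<C>))"
      unfolding W_def using p \<C>(2)
      by (intro connected_component_maximal connected_path_image) (auto simp: pathstart_in_path_image)
    then show ?thesis using p(4) pathfinish_in_path_image[of p] by blast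
  qed
  define br where "br y N h \<longleftrightarrow> h holomorphic_on W N \<and> (\<forall>x\<in>W N. f (h x) = x) \<and> h x0 = y" for y N h
  \<comment> \<open>Collects the images of all branches that take x0 to y. For different y these are
    disjoint: branches with a common value z agree at f z, hence also at x0.\<close>
  define S where "S y = (\<Union>(N, h)\<in>{(N, h). br y N h}. h ` W N)" for y
  have S_open: "open (S y)" for y
    unfolding S_def
  proof (intro open_UN ballI)
    fix q assume "q \<in> {(N, h). br y N h}"
    then obtain N h where q: "q = (N, h)" "br y N h" by auto
    have "open (h ` W N)"
    proof (cases "W N = {}")
      case False
      then show ?thesis
        using open_mapping_thm3[of h "W N"] q(2) W unfolding br_def by (metis all_not_in_conv inj_onI)
    qed simp
    then show "open (case q of (N, h) \<Rightarrow> h ` W N)" unfolding q by simp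
  qed
  have agree: "h z = k z" if "h holomorphic_on W N" "k holomorphic_on W N" "\<And>x. x \<in> W N \<Longrightarrow> f (h x) = x"
    "\<And>x. x \<in> W N \<Longrightarrow> f (k x) = x" "x \<in> W N" "h x = k x" "z \<in> W N" for h k x z N
    by (rule lift_unique[where f=f and U="W N" and ?x0.0=x and x=z, OF holf])
       (use that W(3)[OF that(5)] holomorphic_on_imp_continuous_on deriv_nz nP in auto)
  have S_disjoint: "y = y'" if z: "z \<in> S y" "z \<in> S y'" for y y' z
  proof -
    obtain N h where h: "br y N h" "z \<in> h ` W N" using z(1) unfolding S_def by auto
    obtain M k where k: "br y' M k" "z \<in> k ` W M" using z(2) unfolding S_def by auto
    have hz: "f z \<in> W N" "h (f z) = z" using h unfolding br_def by auto
    have kz: "f z \<in> W M" "k (f z) = z" using k unfolding br_def by auto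
    define m where "m = min N M"
    have m: "W m \<subseteq> W N" "W m \<subseteq> W M" "f z \<in> W m" using W_mono hz(1) kz(1) unfolding m_def by (auto simp: min_def)
    have "h x0 = k x0"
      by (rule agree[of h m k "f z"])
         (use h(1) k(1) m hz(2) kz(2) x0W[OF m(3)] in \<open>auto simp: br_def intro: holomorphic_on_subset\<close>)
    then show ?thesis using h(1) k(1) unfolding br_def by simp
  qed
  have S_cover: "\<exists>y. z \<in> S y" if z: "z \<in> I" for z
  proof -
    have "f z \<in> I" using z escaping_iff unfolding I_def by blast
    then obtain N where N: "f z \<in> W N" using IW by blast
    obtain h where h: "h holomorphic_on W N" "h (f z) = z" "\<And>x. x \<in> W N \<Longrightarrow> f (h x) = x"
      by (rule lift_hol[OF W(1,2)[OF N], of "\<lambda>x. x" "f z" z]) (use nP N in \<open>auto intro: holomorphic_on_ident\<close>)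
    have "br (h x0) N h" unfolding br_def using h by blast
    moreover have "z \<in> h ` W N" using h(2) N by (metis imageI)
    ultimately show ?thesis unfolding S_def by blast
  qed
  have S_y: "y \<in> S y" if yI: "y \<in> I" and fy: "f y = x0" for y
  proof -
    obtain y' where y': "y \<in> S y'" using S_cover[OF yI] by blast
    then obtain N h where h: "br y' N h" "y \<in> h ` W N" unfolding S_def by auto
    then have "h (f y) = y" unfolding br_def by auto
    then have "y' = y" using h(1) fy unfolding br_def by simp
    then show ?thesis using y' by simp
  qed
  have "S y1 \<inter> I = {} \<or> (\<Union>y'\<in>- {y1}. S y') \<inter> I = {}"
  proof (rule connectedD[OF cI S_open])
    show "open (\<Union>y'\<in>- {y1}. S y')" by (intro open_UN ballI S_open)
    show "S y1 \<inter> (\<Union>y'\<in>- {y1}. S y') \<inter> I = {}" using S_disjoint[of _ y1] by auto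
    show "I \<subseteq> S y1 \<union> (\<Union>y'\<in>- {y1}. S y')" using S_cover by blast
  qed
  moreover have "y1 \<in> S y1" "y2 \<in> S y2" using S_y y unfolding x0_def by auto
  ultimately show False using y(1-3) by auto
qed

end

section \<open>The Julia set\<close>

lemma fatou_set_subsequence:
  assumes "z \<in> fatou_set f"
  obtains \<rho> where "0 < \<rho>"
    "\<And>n :: nat \<Rightarrow> nat. \<exists>r :: nat \<Rightarrow> nat. strict_mono r \<and>
       ((\<exists>h. uniform_limit (cball z \<rho>) (\<lambda>k. f ^^ n (r k)) h sequentially) \<or>
        (\<forall>M. \<forall>\<^sub>F k in sequentially. \<forall>w\<in>cball z \<rho>. M < norm ((f ^^ n (r k)) w)))"
proof -
  obtain U where U: "open U" "z \<in> U" "normal_family_on U (range (\<lambda>n. f ^^ n))"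
    using assms unfolding fatou_set_def by blast
  obtain \<rho> where \<rho>: "0 < \<rho>" "cball z \<rho> \<subseteq> U" using U(1,2) open_contains_cball by blast
  have "\<exists>r :: nat \<Rightarrow> nat. strict_mono r \<and>
       ((\<exists>h. uniform_limit (cball z \<rho>) (\<lambda>k. f ^^ n (r k)) h sequentially) \<or>
        (\<forall>M. \<forall>\<^sub>F k in sequentially. \<forall>w\<in>cball z \<rho>. M < norm ((f ^^ n (r k)) w)))" for n :: "nat \<Rightarrow> nat"
  proof -
    have K: "compact (cball z \<rho>) \<and> cball z \<rho> \<subseteq> U" using \<rho>(2) by simp
    have "range (\<lambda>k. f ^^ n k) \<subseteq> range (\<lambda>n. f ^^ n)" by auto
    from U(3)[unfolded normal_family_on_def, rule_format, OF this]
    obtain r :: "nat \<Rightarrow> nat" where r: "strict_mono r"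
      "(\<exists>h. \<forall>K. compact K \<and> K \<subseteq> U \<longrightarrow> uniform_limit K (\<lambda>k. f ^^ n (r k)) h sequentially) \<or>
       (\<forall>K. compact K \<and> K \<subseteq> U \<longrightarrow> (\<forall>M. \<forall>\<^sub>F k in sequentially. \<forall>w\<in>K. M < norm ((f ^^ n (r k)) w)))"
      by blast
    from r(2) K have "(\<exists>h. uniform_limit (cball z \<rho>) (\<lambda>k. f ^^ n (r k)) h sequentially) \<or>
        (\<forall>M. \<forall>\<^sub>F k in sequentially. \<forall>w\<in>cball z \<rho>. M < norm ((f ^^ n (r k)) w))" by blast
    with r(1) show ?thesis by blast
  qed
  with \<rho>(1) show thesis by (rule that)
qed

lemma fatou_setI:
  assumes V: "open V" "connected V" "z \<in> V"
    and sub: "\<And>n :: nat \<Rightarrow> nat. \<exists>r :: nat \<Rightarrow> nat. strict_mono r \<and>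
      ((\<exists>h. \<forall>K. compact K \<longrightarrow> K \<subseteq> V \<longrightarrow> uniform_limit K (\<lambda>k. f ^^ n (r k)) h sequentially) \<or>
       (\<forall>M. \<forall>\<^sub>F k in sequentially. \<forall>w\<in>V. M < norm ((f ^^ n (r k)) w)))"
  shows "z \<in> fatou_set f"
proof -
  have "normal_family_on V (range (\<lambda>n. f ^^ n))"
    unfolding normal_family_on_def
  proof (intro allI impI)
    fix g :: "nat \<Rightarrow> complex \<Rightarrow> complex" assume "range g \<subseteq> range (\<lambda>n. f ^^ n)"
    then have "\<forall>k. \<exists>n. g k = f ^^ n" by auto
    then obtain n where n: "\<And>k. g k = f ^^ n k" by metis
    obtain r :: "nat \<Rightarrow> nat" where r: "strict_mono r"
      "(\<exists>h. \<forall>K. compact K \<longrightarrow> K \<subseteq> V \<longrightarrow> uniform_limit K (\<lambda>k. f ^^ n (r k)) h sequentially) \<or>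
       (\<forall>M. \<forall>\<^sub>F k in sequentially. \<forall>w\<in>V. M < norm ((f ^^ n (r k)) w))"
      using sub[of n] by blast
    have far: "\<forall>\<^sub>F k in sequentially. \<forall>w\<in>K. M < norm (g (r k) w)"
      if "\<forall>M. \<forall>\<^sub>F k in sequentially. \<forall>w\<in>V. M < norm ((f ^^ n (r k)) w)" "K \<subseteq> V" for K M
      using that(1)[rule_format, of M] by eventually_elim (use that(2) n in auto)
    show "\<exists>r :: nat \<Rightarrow> nat. strict_mono r \<and>
         ((\<exists>h. \<forall>K. compact K \<and> K \<subseteq> V \<longrightarrow> uniform_limit K (\<lambda>k. g (r k)) h sequentially) \<or>
          (\<forall>K. compact K \<and> K \<subseteq> V \<longrightarrow> (\<forall>M. \<forall>\<^sub>F k in sequentially. \<forall>z\<in>K. M < norm (g (r k) z))))"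
      using r(2)
    proof
      assume "\<exists>h. \<forall>K. compact K \<longrightarrow> K \<subseteq> V \<longrightarrow> uniform_limit K (\<lambda>k. f ^^ n (r k)) h sequentially"
      then show ?thesis using r(1) unfolding n by blast
    next
      assume "\<forall>M. \<forall>\<^sub>F k in sequentially. \<forall>w\<in>V. M < norm ((f ^^ n (r k)) w)"
      from far[OF this] show ?thesis using r(1) by blast
    qed
  qed
  then show ?thesis unfolding fatou_set_def using V by blast
qed

context postsingular_pair begin

text \<open>Normality of the iterates f^(n k + 1) near x is normality of f^(n k) on the image of a
  disc, which is open. The contrapositive is the backward invariance of J.\<close>

lemma fatou_forward:
  assumes "x \<in> fatou_set f" shows "f x \<in> fatou_set f"
proof -
  obtain \<rho> where \<rho>: "0 < \<rho>"
    "\<And>n :: nat \<Rightarrow> nat. \<exists>r :: nat \<Rightarrow> nat. strict_mono r \<and>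
       ((\<exists>h. uniform_limit (cball x \<rho>) (\<lambda>k. f ^^ n (r k)) h sequentially) \<or>
        (\<forall>M. \<forall>\<^sub>F k in sequentially. \<forall>w\<in>cball x \<rho>. M < norm ((f ^^ n (r k)) w)))"
    by (rule fatou_set_subsequence[OF assms]) (rule that, assumption+)
  define V where "V = f ` ball x \<rho>"
  have "\<not> f constant_on UNIV"
  proof
    assume "f constant_on UNIV"
    then obtain y where "\<And>z. f z = y" unfolding constant_on_def by auto
    then have "\<forall>z. f z = poly [:y:] z" by simp
    then show False using nonpoly by blast
  qed
  then have "open V" unfolding V_def
    by (intro open_mapping_thm[OF holf open_UNIV connected_UNIV]) auto
  moreover have "connected V" unfolding V_def by (intro connected_continuous_image contf connected_ball)
  moreover have "f x \<in> V" unfolding V_def using \<rho>(1) by simp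
  moreover have "\<exists>r :: nat \<Rightarrow> nat. strict_mono r \<and>
      ((\<exists>h. \<forall>K. compact K \<longrightarrow> K \<subseteq> V \<longrightarrow> uniform_limit K (\<lambda>k. f ^^ n (r k)) h sequentially) \<or>
       (\<forall>M. \<forall>\<^sub>F k in sequentially. \<forall>w\<in>V. M < norm ((f ^^ n (r k)) w)))" for n :: "nat \<Rightarrow> nat"
  proof -
    obtain r :: "nat \<Rightarrow> nat" where r: "strict_mono r"
      "(\<exists>h. uniform_limit (cball x \<rho>) (\<lambda>k. f ^^ Suc (n (r k))) h sequentially) \<or>
        (\<forall>M. \<forall>\<^sub>F k in sequentially. \<forall>w\<in>cball x \<rho>. M < norm ((f ^^ Suc (n (r k))) w))"
      using \<rho>(2)[of "\<lambda>k. Suc (n k)"] by blast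
    from r(2) show ?thesis
    proof
      assume "\<exists>h. uniform_limit (cball x \<rho>) (\<lambda>k. f ^^ Suc (n (r k))) h sequentially"
      then obtain h where h: "uniform_limit (cball x \<rho>) (\<lambda>k. f ^^ Suc (n (r k))) h sequentially" by blast
      \<comment> \<open>f may identify points of the disc, so the limit on V is defined pointwise;
        at f u it equals h u.\<close>
      define h' where "h' w = lim (\<lambda>k. (f ^^ n (r k)) w)" for w
      have h': "h' (f u) = h u" if "u \<in> cball x \<rho>" for u
      proof -
        have "(\<lambda>k. (f ^^ Suc (n (r k))) u) \<longlonglongrightarrow> h u" by (rule tendsto_uniform_limitI[OF h that])
        then show ?thesis unfolding h'_def by (intro limI) (simp only: funpow_Suc_right comp_apply)
      qed
      have "uniform_limit V (\<lambda>k. f ^^ n (r k)) h' sequentially"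
        unfolding uniform_limit_iff
      proof (intro allI impI)
        fix e :: real assume "0 < e"
        from uniform_limitD[OF h this]
        show "\<forall>\<^sub>F k in sequentially. \<forall>w\<in>V. dist ((f ^^ n (r k)) w) (h' w) < e"
        proof eventually_elim
          case (elim k)
          show ?case
          proof
            fix w assume "w \<in> V"
            then obtain u where u: "u \<in> cball x \<rho>" "w = f u" unfolding V_def using ball_subset_cball by blast
            then show "dist ((f ^^ n (r k)) w) (h' w) < e"
              using elim[rule_format, OF u(1)] h'[OF u(1)] by (simp add: funpow_swap1)
          qed
        qed
      qed
      then show ?thesis using r(1) uniform_limit_on_subset by blast
    next
      assume far: "\<forall>M. \<forall>\<^sub>F k in sequentially. \<forall>w\<in>cball x \<rho>. M < norm ((f ^^ Suc (n (r k))) w)"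
      have "\<forall>\<^sub>F k in sequentially. \<forall>w\<in>V. M < norm ((f ^^ n (r k)) w)" for M
        using far[rule_format, of M]
      proof eventually_elim
        case (elim k)
        then show ?case unfolding V_def by (auto simp: funpow_swap1)
      qed
      then show ?thesis using r(1) by blast
    qed
  qed
  ultimately show ?thesis by (rule fatou_setI)
qed

text \<open>The orbit of y stays in P, so no subsequence of iterates tends to infinity near y, and a
  finite limit h is continuous with |h y| <= R. Two errors of 1/3 then keep the nearby orbits below
  R + 1.\<close>

lemma fatou_trapped:
  assumes "y \<in> P" "y \<in> fatou_set f"
  obtains \<epsilon> where "0 < \<epsilon>" "\<And>z n. z \<in> ball y \<epsilon> \<Longrightarrow> norm ((f ^^ n) z) < R + 1"
proof (rule ccontr)
  assume neg: "\<not> thesis"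
  have "\<exists>z n. z \<in> ball y (1 / real (Suc k)) \<and> R + 1 \<le> norm ((f ^^ n) z)" for k
    using neg that[of "1 / real (Suc k)"] by (meson not_le of_nat_0_less_iff zero_less_Suc zero_less_divide_1_iff)
  then obtain z n where z: "\<And>k. z k \<in> ball y (1 / real (Suc k))" "\<And>k. R + 1 \<le> norm ((f ^^ n k) (z k))" by metis
  obtain \<rho> where \<rho>: "0 < \<rho>"
    "\<And>n :: nat \<Rightarrow> nat. \<exists>r :: nat \<Rightarrow> nat. strict_mono r \<and>
       ((\<exists>h. uniform_limit (cball y \<rho>) (\<lambda>k. f ^^ n (r k)) h sequentially) \<or>
        (\<forall>M. \<forall>\<^sub>F k in sequentially. \<forall>w\<in>cball y \<rho>. M < norm ((f ^^ n (r k)) w)))"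
    by (rule fatou_set_subsequence[OF assms(2)]) (rule that, assumption+)
  obtain r :: "nat \<Rightarrow> nat" where r: "strict_mono r"
    "(\<exists>h. uniform_limit (cball y \<rho>) (\<lambda>k. f ^^ n (r k)) h sequentially) \<or>
     (\<forall>M. \<forall>\<^sub>F k in sequentially. \<forall>w\<in>cball y \<rho>. M < norm ((f ^^ n (r k)) w))"
    using \<rho>(2)[of n] by blast
  have Py: "norm ((f ^^ m) y) < R" for m using funpow_P[OF assms(1)] norm_P by blast
  from r(2) show False
  proof
    assume "\<forall>M. \<forall>\<^sub>F k in sequentially. \<forall>w\<in>cball y \<rho>. M < norm ((f ^^ n (r k)) w)"
    then obtain k where "\<forall>w\<in>cball y \<rho>. R < norm ((f ^^ n (r k)) w)" unfolding eventually_sequentially by blast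
    then show False using Py[of "n (r k)"] \<rho>(1) by (metis centre_in_cball less_asym less_imp_le)
  next
    assume "\<exists>h. uniform_limit (cball y \<rho>) (\<lambda>k. f ^^ n (r k)) h sequentially"
    then obtain h where h: "uniform_limit (cball y \<rho>) (\<lambda>k. f ^^ n (r k)) h sequentially" by blast
    have hc: "continuous_on (cball y \<rho>) h"
      by (rule uniform_limit_theorem[OF _ h]) (simp_all add: cont_funpow)
    have yin: "y \<in> cball y \<rho>" using \<rho>(1) by simp
    obtain d where d: "0 < d" "\<And>w. w \<in> cball y \<rho> \<Longrightarrow> dist w y < d \<Longrightarrow> dist (h w) (h y) < 1/3"
      using hc[unfolded continuous_on_iff, rule_format, OF yin, of "1/3"] by auto
    have hy: "norm (h y) \<le> R"
      by (rule tendsto_upperbound[OF tendsto_norm[OF tendsto_uniform_limitI[OF h yin]]])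
         (use Py less_imp_le in \<open>auto intro!: always_eventually\<close>)
    obtain K where K: "\<And>k w. K \<le> k \<Longrightarrow> w \<in> cball y \<rho> \<Longrightarrow> dist ((f ^^ n (r k)) w) (h w) < 1/3"
      using uniform_limitD[OF h, of "1/3"] unfolding eventually_sequentially by (meson divide_pos_pos zero_less_numeral zero_less_one)
    obtain K' where K': "1 / real (Suc K') < min \<rho> d" using reals_Archimedean[of "min \<rho> d"] \<rho>(1) d(1)
      by (auto simp: inverse_eq_divide)
    define k where "k = max K K'"
    have "K' \<le> r k" using seq_suble[OF r(1), of k] unfolding k_def by linarith
    then have "1 / real (Suc (r k)) \<le> 1 / real (Suc K')" by (intro divide_left_mono) auto
    then have "dist y (z (r k)) < min \<rho> d" using z(1)[of "r k"] K' by (simp only: mem_ball)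
    then have zz: "z (r k) \<in> cball y \<rho>" "dist (z (r k)) y < d" by (auto simp: dist_commute)
    have "norm ((f ^^ n (r k)) (z (r k))) \<le> dist ((f ^^ n (r k)) (z (r k))) (h (z (r k))) + dist (h (z (r k))) (h y) + norm (h y)"
      using dist_triangle[of "(f ^^ n (r k)) (z (r k))" 0 "h (z (r k))"] dist_triangle[of "h (z (r k))" 0 "h y"] by simp
    also have "\<dots> < R + 1" using K[of k, OF _ zz(1)] d(2)[OF zz] hy unfolding k_def by fastforce
    finally show False using z(2)[of "r k"] by simp
  qed
qed

text \<open>The cycle is superattracting: f^n has derivative 0 at x and maps a small disc about x
  into itself. All iterates are bounded there, and Montel's theorem applies.\<close>

lemma periodic_critical_fatou:
  assumes n: "1 \<le> n" "(f ^^ n) x = x" and d: "deriv f x = 0"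
  shows "x \<in> fatou_set f"
proof -
  have "deriv (f ^^ Suc m) x = 0" for m
  proof (induction m)
    case 0
    then show ?case using deriv_funpow_Suc[of 0 x] d by simp
  next
    case (Suc m)
    then show ?case unfolding deriv_funpow_Suc[of "Suc m"] by (simp del: funpow.simps)
  qed
  then have dn: "deriv (f ^^ n) x = 0" using n(1) by (cases n) auto
  have "((f ^^ n) has_derivative (*) 0) (at x)"
    using holomorphic_derivI[OF hol_funpow open_UNIV UNIV_I, of n x] unfolding dn has_field_derivative_def .
  then obtain \<epsilon> where \<epsilon>: "0 < \<epsilon>" "\<And>y. norm (y - x) < \<epsilon> \<Longrightarrow> norm ((f ^^ n) y - (f ^^ n) x - 0 * (y - x)) \<le> 1 * norm (y - x)"
    unfolding has_derivative_at_alt using zero_less_one by blast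
  have inv: "((f ^^ n) ^^ q) y \<in> ball x \<epsilon>" if "y \<in> ball x \<epsilon>" for q y
  proof (induction q)
    case (Suc q)
    then have "norm (((f ^^ n) ^^ q) y - x) < \<epsilon>" by (simp add: dist_norm norm_minus_commute)
    from \<epsilon>(2)[OF this] this show ?case by (simp add: dist_norm norm_minus_commute n(2))
  qed (use that in simp)
  have "compact (\<Union>j<n. (f ^^ j) ` cball x \<epsilon>)"
    by (intro compact_UN compact_continuous_image cont_funpow compact_cball) auto
  then obtain B where B: "\<And>w. w \<in> (\<Union>j<n. (f ^^ j) ` cball x \<epsilon>) \<Longrightarrow> norm w \<le> B"
    using compact_imp_bounded bounded_iff by metis
  have bd: "norm ((f ^^ m) y) \<le> B" if "y \<in> ball x \<epsilon>" for m y
  proof (rule B)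
    have "(f ^^ m) y = (f ^^ (m mod n)) (((f ^^ n) ^^ (m div n)) y)"
      by (metis comp_apply funpow_add funpow_mult mod_mult_div_eq mult.commute)
    moreover have "((f ^^ n) ^^ (m div n)) y \<in> cball x \<epsilon>" using inv[OF that] ball_subset_cball by blast
    moreover have "m mod n \<in> {..<n}" using n(1) by simp
    ultimately show "(f ^^ m) y \<in> (\<Union>j<n. (f ^^ j) ` cball x \<epsilon>)" by (metis UN_I imageI)
  qed
  show ?thesis
  proof (rule fatou_setI[of "ball x \<epsilon>"])
    fix k :: "nat \<Rightarrow> nat"
    obtain h r where "strict_mono (r :: nat \<Rightarrow> nat)"
      "\<And>K. compact K \<Longrightarrow> K \<subseteq> ball x \<epsilon> \<Longrightarrow> uniform_limit K ((\<lambda>i. f ^^ k i) \<circ> r) h sequentially"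
    proof (rule Montel[of "ball x \<epsilon>" "range (\<lambda>m. f ^^ m)" "\<lambda>i. f ^^ k i"])
      show "\<exists>B. \<forall>h\<in>range (\<lambda>m. f ^^ m). \<forall>z\<in>K. norm (h z) \<le> B" if "K \<subseteq> ball x \<epsilon>" for K
        using bd that by blast
    qed (auto intro: hol_funpow)
    then show "\<exists>r :: nat \<Rightarrow> nat. strict_mono r \<and>
      ((\<exists>h. \<forall>K. compact K \<longrightarrow> K \<subseteq> ball x \<epsilon> \<longrightarrow> uniform_limit K (\<lambda>i. f ^^ k (r i)) h sequentially) \<or>
       (\<forall>M. \<forall>\<^sub>F i in sequentially. \<forall>w\<in>ball x \<epsilon>. M < norm ((f ^^ k (r i)) w)))"
      unfolding o_def by blast
  qed (use \<epsilon>(1) in auto)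
qed

end

section \<open>From strong subhyperbolicity to the orbifold setting\<close>

lemma singular_values_postsingular: "singular_values f \<subseteq> postsingular_set f"
proof -
  have "singular_values f = (f ^^ 0) ` singular_values f" by simp
  also have "\<dots> \<subseteq> (\<Union>n. (f ^^ n) ` singular_values f)" by (rule UN_upper) simp
  also have "\<dots> \<subseteq> postsingular_set f" unfolding postsingular_set_def by (rule closure_subset)
  finally show ?thesis .
qed

lemma postsingular_set_invariant:
  assumes "continuous_on UNIV f"
  shows "f ` postsingular_set f \<subseteq> postsingular_set f"
proof -
  define U where "U = (\<Union>n. (f ^^ n) ` singular_values f)"
  have "f ` U \<subseteq> U"
  proof (clarsimp simp: U_def)
    fix n x assume "x \<in> singular_values f"
    then show "\<exists>m. f ((f ^^ n) x) \<in> (f ^^ m) ` singular_values f" by (intro exI[of _ "Suc n"]) auto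
  qed
  then have "f ` closure U \<subseteq> closure U"
    by (intro image_closure_subset continuous_on_subset[OF assms]) (use closure_subset in auto)
  then show ?thesis unfolding postsingular_set_def U_def .
qed

theorem corollary1p4:
  fixes f :: "complex \<Rightarrow> complex"
  assumes "transcendental_entire f"
    and "strongly_subhyperbolic f"
  shows "\<not> connected (escaping_set f)"
proof -
  define P J where "P = postsingular_set f" and "J = julia_set f"
  have holf: "f holomorphic_on UNIV" and nonpoly: "\<not> (\<exists>p. \<forall>z. f z = poly p z)"
    using assms(1) unfolding transcendental_entire_def by blast+
  have cF: "compact (P \<inter> fatou_set f)" and fJ: "finite (P \<inter> J)" and asy: "J \<inter> asymptotic_values f = {}"
    using assms(2) unfolding strongly_subhyperbolic_def subhyperbolic_def P_def J_def by blast+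
  obtain d where d: "\<And>z. z \<in> J \<Longrightarrow> local_degree f z < d"
    using assms(2) unfolding strongly_subhyperbolic_def J_def by blast
  have PJ: "P - J = P \<inter> fatou_set f" unfolding J_def julia_set_def by blast
  have closedP: "closed P" unfolding P_def postsingular_set_def by simp
  have singP: "singular_values f \<subseteq> P" unfolding P_def by (rule singular_values_postsingular)
  have invP: "f ` P \<subseteq> P"
    unfolding P_def by (rule postsingular_set_invariant[OF holomorphic_on_imp_continuous_on[OF holf]])
  have "bounded ((P \<inter> fatou_set f) \<union> (P \<inter> J))"
    using cF fJ by (simp add: compact_imp_bounded finite_imp_bounded)
  then have "bounded P" by (rule bounded_subset) (auto simp: J_def julia_set_def)
  then obtain B where "0 < B" "\<And>x. x \<in> P \<Longrightarrow> norm x < B" using bounded_pos_less by metis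
  then have B: "0 < B" "P \<subseteq> ball 0 B" "0 < B + 1" "P \<subseteq> ball 0 (B + 1)" by force+
  obtain a b where two: "a \<in> P" "b \<in> P" "a \<noteq> b"
    using postsingular_two_points[OF holf nonpoly closedP singP invP] by metis
  \<comment> \<open>Two radii occur because \<open>fatou_trapped\<close> loses 1: P lies in the ball
    of radius B, orbits near its Fatou part stay in the ball of radius B + 1, and the latter is the
    disc of the main argument.\<close>
  interpret postsingular_pair f P B a b
    by unfold_locales (fact holf closedP singP invP B two nonpoly)+
  have J_backward: "x \<in> J" if "f x \<in> J" for x using that fatou_forward unfolding J_def julia_set_def by blast
  have trap: "\<exists>N. open N \<and> P - J \<subseteq> N \<and> (\<forall>z\<in>N. \<forall>n. norm ((f ^^ n) z) < B + 1)"
  proof -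
    have "\<forall>y\<in>P - J. \<exists>\<epsilon>>0. \<forall>z\<in>ball y \<epsilon>. \<forall>n. norm ((f ^^ n) z) < B + 1"
      unfolding PJ using fatou_trapped by (metis IntE)
    then obtain \<epsilon> where \<epsilon>: "\<And>y. y \<in> P - J \<Longrightarrow> 0 < \<epsilon> y \<and> (\<forall>z\<in>ball y (\<epsilon> y). \<forall>n. norm ((f ^^ n) z) < B + 1)"
      by metis
    show ?thesis
      by (rule exI[of _ "\<Union>y\<in>P - J. ball y (\<epsilon> y)"]) (use \<epsilon> in \<open>auto intro!: open_UN\<close>)
  qed
  interpret sub: subhyperbolic_disc f P "B + 1" a b J "nat d"
  proof unfold_locales
    show "deriv f x \<noteq> 0" if "x \<in> J" "1 \<le> n" "(f ^^ n) x = x" for x n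
      using periodic_critical_fatou[OF that(2,3)] that(1) unfolding J_def julia_set_def by blast
    show "local_degree f x \<le> int (nat d)" if "x \<in> J" for x using d[OF that] by linarith
    show "x \<notin> asymptotic_values f" if "x \<in> J" for x using that asy by blast
    show "closed (P - J)" unfolding PJ by (rule compact_imp_closed[OF cF])
  qed (fact holf closedP singP invP B two nonpoly fJ J_backward trap)+
  show ?thesis by (rule sub.escaping_set_disconnected)
qed

end
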